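(* Let $\beta=\beta(n)=\sigma(n)+i\tau$, where $\tau\in\mathbb{R}$ is constant and, for some constant $u\in\mathbb{R}$, the real sequence $\sigma(n)$ satisfies $$\sigma(n)=\frac{\sigma_1}{2}-\frac{u}{2\sqrt{na_1}}+o\left(\frac1{\sqrt n}\right),\qquad n\to\infty.$$ Then, in distribution as $n\to\infty$, $$\frac{\mathcal{Z}_n(\beta)-\mathbb{E}\mathcal{Z}_n(\beta)}{\sqrt{\operatorname{Var}\mathcal{Z}_n(\beta)}}\longrightarrow\begin{cases}N_{\mathbb{C}}(0,\Phi(u)), & \text{if }\tau\ne0,\\ N_{\mathbb{R}}(0,\Phi(u)), & \text{if }\tau=0,\end{cases}$$ where $\Phi$ is the standard normal distribution function.
   Context: GREM. Fix $d\in\mathbb{N}$, variances $a_1,\dots,a_d>0$, branching exponents $\alpha_1,\dots,\alpha_d>1$, and sequences of natural numbers $N_{n,1},\dots,N_{n,d}$ with $\lim_{n\to\infty}N_{n,j}/\alpha_j^n=1$ for each $j$. Let $\mathbb{S}_n=\{\varepsilon=(\varepsilon_1,\dots,\varepsilon_d)\in\mathbb{N}^d:1\le\varepsilon_j\le N_{n,j},\ 1\le j\le d\}$. Let $\{\xi_{\varepsilon_1\dots\varepsilon_j}:1\le j\le d,\ 1\le\varepsilon_i\le N_{n,i}\}$ be independent real standard normal random variables, $X_\varepsilon=\sum_{j=1}^d\sqrt{a_j}\,\xi_{\varepsilon_1\dots\varepsilon_j}$, and $\mathcal{Z}_n(\beta)=\sum_{\varepsilon\in\mathbb{S}_n}e^{\beta\sqrt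 n X_\varepsilon}$, $\beta\in\mathbb{C}$. Put $\sigma_j=\sqrt{2\log\alpha_j/a_j}$; it is assumed throughout that $\sigma_1<\dots<\sigma_d$. For a complex random variable $Z$, $\operatorname{Var}Z=\mathbb{E}|Z|^2-|\mathbb{E}Z|^2$. $N_{\mathbb{R}}(0,\theta^2)$ is the real Gaussian law with mean zero and variance $\theta^2$; $N_{\mathbb{C}}(0,\theta^2)$ is the law of $X+iY$ with $X,Y\sim N_{\mathbb{R}}(0,\theta^2/2)$ independent. *)

theory Defs
  imports "HOL-Probability.Probability" "HOL-Library.Landau_Symbols"
begin

text \<open>
  Levels are numbered from 1 as in the paper; a tuple $(\varepsilon_1,\dots,\varepsilon_j)$ is the
  list of length \<open>j\<close> whose entry at position \<open>i - 1\<close> is $\varepsilon_i$. Lists, rather than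
  extensional functions on \<open>{1..j}\<close>, keep tuples of different lengths distinct.
  Here \<open>N i\<close> is the number of branches at level \<open>i\<close> (for a fixed \<open>n\<close>).
\<close>

definition grem_words :: "(nat \<Rightarrow> nat) \<Rightarrow> nat \<Rightarrow> nat list set" where
  "grem_words N j = {\<epsilon>. length \<epsilon> = j \<and> (\<forall>i\<in>{1..j}. 1 \<le> \<epsilon> ! (i - 1) \<and> \<epsilon> ! (i - 1) \<le> N i)}"

definition grem_energy ::
    "nat \<Rightarrow> (nat \<Rightarrow> real) \<Rightarrow> (nat list \<Rightarrow> 'a \<Rightarrow> real) \<Rightarrow> nat list \<Rightarrow> 'a \<Rightarrow> real" where
  "grem_energy d a \<xi> \<epsilon> \<omega> = (\<Sum>j=1..d. sqrt (a j) * \<xi> (take j \<epsilon>) \<omega>)"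

definition grem_partition ::
    "nat \<Rightarrow> (nat \<Rightarrow> real) \<Rightarrow> (nat \<Rightarrow> nat) \<Rightarrow> (nat list \<Rightarrow> 'a \<Rightarrow> real) \<Rightarrow> nat \<Rightarrow> complex \<Rightarrow> 'a \<Rightarrow> complex" where
  "grem_partition d a N \<xi> n \<beta> \<omega> =
     (\<Sum>\<epsilon>\<in>grem_words N d. exp (\<beta> * of_real (sqrt (real n) * grem_energy d a \<xi> \<epsilon> \<omega>)))"

definition grem_sigma :: "(nat \<Rightarrow> real) \<Rightarrow> (nat \<Rightarrow> real) \<Rightarrow> nat \<Rightarrow> real" where
  "grem_sigma a \<alpha> j = sqrt (2 * ln (\<alpha> j) / a j)"

definition complex_variance :: "'a measure \<Rightarrow> ('a \<Rightarrow> complex) \<Rightarrow> real" where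
  "complex_variance M Z = (\<integral>\<omega>. (cmod (Z \<omega>))\<^sup>2 \<partial>M) - (cmod (\<integral>\<omega>. Z \<omega> \<partial>M))\<^sup>2"

definition complex_standardize :: "'a measure \<Rightarrow> ('a \<Rightarrow> complex) \<Rightarrow> 'a \<Rightarrow> complex" where
  "complex_standardize M Z \<omega> =
     (Z \<omega> - (\<integral>\<omega>'. Z \<omega>' \<partial>M)) / of_real (sqrt (complex_variance M Z))"

text \<open>
  The library's \<^const>\<open>weak_conv_m\<close> is confined to measures on the real line. The random variables
  may live on different probability spaces.
\<close>

definition converges_in_distribution ::
    "(nat \<Rightarrow> 'a measure) \<Rightarrow> (nat \<Rightarrow> 'a \<Rightarrow> 'b::topological_space) \<Rightarrow> 'b measure \<Rightarrow> bool" where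
  "converges_in_distribution M Z \<mu> \<longleftrightarrow>
     (\<forall>f :: 'b \<Rightarrow> real. continuous_on UNIV f \<longrightarrow> bounded (range f) \<longrightarrow>
        (\<lambda>n. \<integral>z. f z \<partial>distr (M n) borel (Z n)) \<longlonglongrightarrow> (\<integral>z. f z \<partial>\<mu>))"

text \<open>
  The parameter \<open>v\<close> is the variance, whereas \<^const>\<open>normal_density\<close> takes the standard deviation.
  The density only represents the Gaussian law for \<open>v > 0\<close>, and a standard normal distribution
  function takes only positive values.
\<close>

definition gaussian_real :: "real \<Rightarrow> real measure" where
  "gaussian_real v = density lborel (normal_density 0 (sqrt v))"

definition gaussian_real_in_complex :: "real \<Rightarrow> complex measure" where
  "gaussian_real_in_complex v = distr (gaussian_real v) borel complex_of_real"

definition gaussian_complex :: "real \<Rightarrow> complex measure" where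
  "gaussian_complex v =
     distr (gaussian_real (v / 2) \<Otimes>\<^sub>M gaussian_real (v / 2)) borel (\<lambda>(x, y). Complex x y)"

end

theory Submission
  imports Defs "HOL-Real_Asymp.Real_Asymp" "HOL-Library.Sublist"
begin

text \<open>
  Group the leaves by their first coordinate: $\mathcal{Z}_n = \sum_{k \le N} e^{(s + ir)\xi_k} W_k$
  with $s = \sigma(n)\sqrt{n a_1}$, $r = \tau\sqrt{n a_1}$, $N = N_{n,1}$, and i.i.d. subtree
  sums $W_k$ independent of the $\xi_k$.
  All levels below the first are strictly subcritical since $\sigma_1 < \sigma_j$, so a
  Rosenthal-type inequality, applied level by level, gives
  $E|W|^p \le C (E|W|^2)^{p/2}$ for some $p > 2$.

  The first level is critical, which means $2s - \sqrt{2 \ln N} \to -u$. Discarding the terms with $\xi_k > T$,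
  where $T$ is slightly below $\sqrt{2 \ln N}$, changes the sum negligibly in probability and
  in mean. The discarded terms do carry variance: tilting the Gaussian by $2s$ shows that the
  remaining variance is the fraction $\Phi(T - 2s) \to \Phi(u)$. The truncated sum satisfies Lyapunov's
  condition. Its pseudo-variance $E(Z - EZ)^2$ is a truncated Gaussian integral oscillating with frequency
  $2r$, hence negligible when $\tau \ne 0$, which makes the limit isotropic.
\<close>

section \<open>Weak convergence in the complex plane\<close>

text \<open>At criticality the variance sits at the edge of the sample. Second moments weight a
  standard Gaussian x by exp(2 s x), which recentres it at 2 s, and 2 s is within O(1) of L = sqrt(2
  ln N), where the maximum of N Gaussians lies. So an order-one share of the second moment comes
  from values that almost never occur, and a Lindeberg condition cannot hold before truncation. The
  normalisation keeps the full variance: tightness then comes for free, while the truncated sum has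
  limiting variance \<Phi>(u) < 1.

  The exponent p can only be slightly larger than 2. Level j preserves the bound E|W|^p \<le> C
  (E|W|^2)^(p/2), with C independent of n, if p (\<sigma>_1 / 2)^2 a_j < ln \<alpha>_j. At p = 2
  this reads \<sigma>_1 < \<sigma>_j; being strict, it survives a small increase of p. At the first
  level there is equality already at p = 2, which is why that level alone has to be
  truncated.\<close>

inductive trig_poly :: "(complex \<Rightarrow> complex) \<Rightarrow> bool" where
  char: "trig_poly (\<lambda>z. c * exp (\<i> * of_real (\<theta> \<bullet> z)))"
| add: "trig_poly f \<Longrightarrow> trig_poly g \<Longrightarrow> trig_poly (\<lambda>z. f z + g z)"

lemma trig_poly_const: "trig_poly (\<lambda>z. c)"
  using trig_poly.char[of c 0] by simp

text \<open>Frequencies of characters add under multiplication, so the class is an algebra and can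
  be substituted into polynomials.\<close>

lemma trig_poly_mult:
  assumes "trig_poly f" "trig_poly g"
  shows "trig_poly (\<lambda>z. f z * g z)"
  using assms
proof (induction f rule: trig_poly.induct)
  case (char c \<theta>)
  from char show ?case
  proof (induction g rule: trig_poly.induct)
    case (char c' \<theta>')
    have "(\<lambda>z. c * exp (\<i> * complex_of_real (\<theta> \<bullet> z)) * (c' * exp (\<i> * complex_of_real (\<theta>' \<bullet> z))))
      = (\<lambda>z. (c * c') * exp (\<i> * complex_of_real ((\<theta> + \<theta>') \<bullet> z)))"
      by (auto simp: inner_add_left exp_add[symmetric] algebra_simps)
    then show ?case using trig_poly.char[of "c * c'" "\<theta> + \<theta>'"] by simp
  next
    case (add f g)
    then show ?case using trig_poly.add by (simp add: algebra_simps)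
  qed
next
  case (add f f')
  then show ?case using trig_poly.add by (simp add: algebra_simps)
qed

lemma trig_poly_cos: "trig_poly (\<lambda>z. of_real (cos (\<theta> \<bullet> z)))"
proof -
  have "(\<lambda>z. complex_of_real (cos (\<theta> \<bullet> z))) =
    (\<lambda>z. (1/2) * exp (\<i> * of_real (\<theta> \<bullet> z)) + (1/2) * exp (\<i> * of_real ((-\<theta>) \<bullet> z)))"
    by (auto simp: cos_exp_eq cos_of_real[symmetric] field_simps simp del: cos_of_real)
  then show ?thesis using trig_poly.add[OF trig_poly.char trig_poly.char] by metis
qed

lemma trig_poly_sin: "trig_poly (\<lambda>z. of_real (sin (\<theta> \<bullet> z)))"
proof -
  have "(\<lambda>z. complex_of_real (sin (\<theta> \<bullet> z))) =
    (\<lambda>z. (-\<i>/2) * exp (\<i> * of_real (\<theta> \<bullet> z)) + (\<i>/2) * exp (\<i> * of_real ((-\<theta>) \<bullet> z)))"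
    by (auto simp: sin_exp_eq sin_of_real[symmetric] field_simps simp del: sin_of_real)
  then show ?thesis using trig_poly.add[OF trig_poly.char trig_poly.char] by metis
qed

lemma trig_poly_polynomial_cis:
  fixes g :: "complex \<times> complex \<Rightarrow> real"
  assumes "real_polynomial_function g"
  shows "trig_poly (\<lambda>z. of_real (g (cis (\<theta>1 \<bullet> z), cis (\<theta>2 \<bullet> z))))"
  using assms
proof (induction g rule: real_polynomial_function.induct)
  case (linear f)
  interpret bounded_linear f by fact
  \<comment> \<open>The base case of \<open>real_polynomial_function\<close> is an arbitrary bounded
    linear functional, here on pairs of complex numbers. Expanding it in the four real coordinates
    exposes the cosines and sines.\<close>
  have f: "f (w1, w2) = f (1, 0) * Re w1 + f (\<i>, 0) * Im w1 + f (0, 1) * Re w2 + f (0, \<i>) * Im w2"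
    for w1 w2
  proof -
    have "(w1, w2) = Re w1 *\<^sub>R (1, 0) + Im w1 *\<^sub>R (\<i>, 0) + Re w2 *\<^sub>R (0, 1) + Im w2 *\<^sub>R (0, \<i>)"
      by (auto simp: complex_eq_iff)
    then have "f (w1, w2) = f (Re w1 *\<^sub>R (1, 0) + Im w1 *\<^sub>R (\<i>, 0) + Re w2 *\<^sub>R (0, 1) + Im w2 *\<^sub>R (0, \<i>))"
      by simp
    then show ?thesis unfolding add scaleR by simp
  qed
  show ?case
    by (subst f, unfold cis.sel of_real_add of_real_mult)
       (intro trig_poly.add trig_poly_mult trig_poly_const trig_poly_cos trig_poly_sin)
qed (simp_all add: trig_poly_const trig_poly.add trig_poly_mult)

lemma trig_poly_integrable:
  assumes "trig_poly h" "prob_space \<mu>" "sets \<mu> = sets borel"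
  shows "integrable \<mu> h"
  using assms(1)
proof (induction rule: trig_poly.induct)
  case (char c \<theta>)
  interpret prob_space \<mu> by fact
  have [measurable]: "(\<lambda>z. c * exp (\<i> * complex_of_real (\<theta> \<bullet> z))) \<in> borel_measurable \<mu>"
    unfolding measurable_cong_sets[OF assms(3) refl]
    by (intro borel_measurable_continuous_onI continuous_intros)
  show ?case
    by (rule integrable_const_bound[where B="norm c"]) (auto simp: norm_mult)
qed auto

text \<open>Convergence of characteristic functions is the case of a single character. The class is
  generated from characters by sums alone, so linearity of the integral does the rest.\<close>

lemma trig_poly_tendsto:
  assumes "trig_poly h"
    and \<nu>: "\<And>n. prob_space (\<nu> n)" "\<And>n. sets (\<nu> n) = sets borel"
    and \<mu>: "prob_space \<mu>" "sets \<mu> = sets borel"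
    and char: "\<And>\<theta>. (\<lambda>n. \<integral>z. exp (\<i> * of_real (\<theta> \<bullet> z)) \<partial>\<nu> n) \<longlonglongrightarrow> (\<integral>z. exp (\<i> * of_real (\<theta> \<bullet> z)) \<partial>\<mu>)"
  shows "(\<lambda>n. \<integral>z. h z \<partial>\<nu> n) \<longlonglongrightarrow> (\<integral>z. h z \<partial>\<mu>)"
  using assms(1)
proof (induction rule: trig_poly.induct)
  case (char c \<theta>)
  show ?case using assms(6)[of \<theta>] by (auto intro!: tendsto_intros)
next
  case (add f g)
  note i = trig_poly_integrable[OF add.hyps(1)] trig_poly_integrable[OF add.hyps(2)]
  show ?case
    using tendsto_add[OF add.IH]
    by (simp add: i \<nu> \<mu>)
qed

text \<open>
  Wrapping the plane around a torus turns a bounded continuous function, cut off outside a large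
  square, into a function on a compact set, where Stone--Weierstrass applies; the resulting
  approximation is periodic and therefore stays bounded on the whole plane.
\<close>

lemma trig_approx:
  fixes f :: "complex \<Rightarrow> real"
  assumes f: "continuous_on UNIV f" and B: "\<And>z. \<bar>f z\<bar> \<le> B" and R: "R > 0" and e: "e > 0"
  obtains h where "trig_poly (\<lambda>z. of_real (h z))"
    "\<And>z. cmod z \<le> R \<Longrightarrow> \<bar>f z - h z\<bar> \<le> e" "\<And>z. \<bar>h z\<bar> \<le> B + e"
proof -
  \<comment> \<open>\<open>clip\<close> is 0 for nonpositive arguments and 1 from 1/2 on. Applied to
    a cosine it removes the half of the circle on which \<open>arcsin\<close> of the sine is no
    longer the angle.\<close>
  define clip where "clip c = min 1 (max 0 (2 * c))" for c :: real
  define S :: "(complex \<times> complex) set" where "S = sphere 0 1 \<times> sphere 0 1"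
  define F where "F w = f (Complex (R * arcsin (Im (fst w))) (R * arcsin (Im (snd w)))) * (clip (Re (fst w)) * clip (Re (snd w)))"
    for w :: "complex \<times> complex"
  have clip: "0 \<le> clip c" "clip c \<le> 1" for c by (auto simp: clip_def)
  have clip1: "clip (cos x) = 1" if "\<bar>x\<bar> \<le> 1" for x
  proof -
    have "cos 1 \<le> cos \<bar>x\<bar>" using that pi_gt3 by (intro cos_monotone_0_pi_le) auto
    \<comment> \<open>Since pi > 3, cos 1 is at least cos(pi/3) = 1/2. This is why the square of
      half-width R is scaled to angles in [-1, 1].\<close>
    moreover have "cos (pi/3) \<le> cos (1::real)" using pi_gt3 by (intro cos_monotone_0_pi_le) auto
    ultimately show ?thesis by (simp add: clip_def cos_60)
  qed
  have S: "compact S" unfolding S_def by (intro compact_Times) auto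
  have "continuous_on S F"
  proof -
    have i: "Im (fst w) \<in> {-1..1}" "Im (snd w) \<in> {-1..1}" if "w \<in> S" for w
      using that abs_Im_le_cmod[of "fst w"] abs_Im_le_cmod[of "snd w"] by (auto simp: S_def)
    show ?thesis unfolding F_def clip_def Complex_eq
      using i by (intro continuous_intros continuous_on_compose2[OF f]) auto
  qed
  then obtain g where g: "real_polynomial_function g" "\<And>w. w \<in> S \<Longrightarrow> \<bar>F w - g w\<bar> < e"
    using Stone_Weierstrass_real_polynomial_function[OF S _ e] by metis
  \<comment> \<open>The angles are Re z / R and Im z / R, written as inner products to match
    \<open>trig_poly_polynomial_cis\<close>.\<close>
  define q where "q z = (cis (of_real (1/R) \<bullet> z), cis ((\<i> / of_real R) \<bullet> z))" for z :: complex
  have qS: "q z \<in> S" for z by (auto simp: q_def S_def)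
  have q: "q z = (cis (Re z / R), cis (Im z / R))" for z
    by (auto simp: q_def inner_complex_def Im_divide power2_eq_square)
  have FB: "\<bar>F w\<bar> \<le> B" for w
  proof -
    have "\<bar>F w\<bar> \<le> B * 1"
      unfolding F_def abs_mult using clip B
      by (intro mult_mono mult_le_one) (auto intro: order_trans[OF _ B])
    then show ?thesis by simp
  qed
  have Ff: "F (q z) = f z" if "cmod z \<le> R" for z
  proof -
    have x: "\<bar>Re z / R\<bar> \<le> 1" "\<bar>Im z / R\<bar> \<le> 1"
      using that R abs_Re_le_cmod[of z] abs_Im_le_cmod[of z] by auto
    have "arcsin (sin t) = t" if "\<bar>t\<bar> \<le> 1" for t :: real
      using that pi_gt3 unfolding abs_le_iff by (intro arcsin_sin) linarith+
    note this[OF x(1)] this[OF x(2)]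
    with R show ?thesis using clip1[OF x(1)] clip1[OF x(2)] by (simp add: F_def q)
  qed
  show thesis
  proof (rule that[of "\<lambda>z. g (q z)"])
    show "trig_poly (\<lambda>z. complex_of_real (g (q z)))"
      unfolding q_def by (rule trig_poly_polynomial_cis[OF g(1)])
    show "\<bar>f z - g (q z)\<bar> \<le> e" if "cmod z \<le> R" for z
      using g(2)[OF qS, of z] Ff[OF that] by simp
    show "\<bar>g (q z)\<bar> \<le> B + e" for z
      using g(2)[OF qS, of z] FB[of "q z"] by linarith
  qed
qed

section \<open>Levy's continuity theorem\<close>

text \<open>The disc contributes at most e. Off the disc the integrand is at most 2 B + e and the
  mass at most \<delta>; this is where h must be bounded on the whole plane.\<close>

lemma integral_diff_tight_bound:
  fixes f h :: "complex \<Rightarrow> real"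
  assumes "prob_space \<nu>" "sets \<nu> = sets borel"
    and f: "f \<in> borel_measurable borel" "\<And>z. \<bar>f z\<bar> \<le> B"
    and h: "integrable \<nu> h" "\<And>z. \<bar>h z\<bar> \<le> B + e"
    and fh: "\<And>z. cmod z \<le> R \<Longrightarrow> \<bar>f z - h z\<bar> \<le> e"
    and t: "measure \<nu> {z. R < cmod z} \<le> \<delta>" and "e \<ge> 0"
  shows "\<bar>(\<integral>z. f z \<partial>\<nu>) - (\<integral>z. h z \<partial>\<nu>)\<bar> \<le> e + (2 * B + e) * \<delta>"
proof -
  interpret prob_space \<nu> by fact
  have [measurable_cong]: "sets \<nu> = sets borel" by fact
  have [measurable]: "f \<in> borel_measurable \<nu>" using f(1) by measurable
  have B: "B \<ge> 0" using f(2)[of 0] by linarith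
  have fi: "integrable \<nu> f" by (rule integrable_const_bound[where B=B]) (use f in auto)
  have sp: "space \<nu> = UNIV" using sets_eq_imp_space_eq[OF assms(2)] by simp
  let ?A = "{z. R < cmod z}"
  have A: "?A \<in> sets \<nu>" by measurable
  have ii: "integrable \<nu> (indicator ?A :: complex \<Rightarrow> real)"
    using A by (intro integrable_real_indicator) (auto simp: less_top[symmetric])
  have "\<bar>(\<integral>z. f z \<partial>\<nu>) - (\<integral>z. h z \<partial>\<nu>)\<bar> = \<bar>\<integral>z. f z - h z \<partial>\<nu>\<bar>" using fi h by simp
  also have "\<dots> \<le> (\<integral>z. \<bar>f z - h z\<bar> \<partial>\<nu>)" by (rule integral_abs_bound)
  also have "\<dots> \<le> (\<integral>z. e + (2 * B + e) * indicator ?A z \<partial>\<nu>)"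
  proof (rule integral_mono)
    show "integrable \<nu> (\<lambda>z. e + (2 * B + e) * indicator ?A z)"
      using ii by simp
    fix z show "\<bar>f z - h z\<bar> \<le> e + (2 * B + e) * indicator ?A z"
      using fh[of z] f(2)[of z] h(2)[of z] \<open>e \<ge> 0\<close> by (cases "cmod z \<le> R") auto
  qed (use fi h in auto)
  also have "\<dots> = e + (2 * B + e) * prob ?A" using A ii by (simp add: prob_space)
  also have "\<dots> \<le> e + (2 * B + e) * \<delta>" using t B \<open>e \<ge> 0\<close> by (intro add_left_mono mult_left_mono) auto
  finally show ?thesis .
qed

text \<open>A trigonometric polynomial that is close to f on a large disc and bounded everywhere
  reduces the claim to integrals that converge by hypothesis. Tightness controls the complement of
  the disc.\<close>

theorem levy_continuity_complex:
  fixes \<nu> :: "nat \<Rightarrow> complex measure" and f :: "complex \<Rightarrow> real"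
  assumes \<nu>: "\<And>n. prob_space (\<nu> n)" "\<And>n. sets (\<nu> n) = sets borel"
    and \<mu>: "prob_space \<mu>" "sets \<mu> = sets borel"
    and char: "\<And>\<theta>. (\<lambda>n. \<integral>z. exp (\<i> * of_real (\<theta> \<bullet> z)) \<partial>\<nu> n) \<longlonglongrightarrow> (\<integral>z. exp (\<i> * of_real (\<theta> \<bullet> z)) \<partial>\<mu>)"
    and tight: "\<And>\<delta>. \<delta> > 0 \<Longrightarrow> \<exists>R. \<forall>n. measure (\<nu> n) {z. R < cmod z} \<le> \<delta>"
    and f: "continuous_on UNIV f" "bounded (range f)"
  shows "(\<lambda>n. \<integral>z. f z \<partial>\<nu> n) \<longlonglongrightarrow> (\<integral>z. f z \<partial>\<mu>)"
proof (rule metric_LIMSEQ_I)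
  fix \<epsilon> :: real assume \<epsilon>: "\<epsilon> > 0"
  obtain B where B: "\<And>z. \<bar>f z\<bar> \<le> B" using f(2) by (auto simp: bounded_iff)
  have B0: "B \<ge> 0" using B[of 0] by linarith
  have fm: "f \<in> borel_measurable borel" using f(1) by (rule borel_measurable_continuous_onI)
  interpret \<mu>: prob_space \<mu> by fact
  have [measurable_cong]: "sets \<mu> = sets borel" by fact
  define e where "e = min 1 (\<epsilon> / 8)"
  \<comment> \<open>Scaled so that (2 B + 1) \<delta> = \<epsilon> / 8. Then each of the two
    approximation errors is at most \<epsilon> / 4, which leaves \<epsilon> / 2 for the convergence
    of the integrals of h.\<close>
  define \<delta> where "\<delta> = \<epsilon> / (8 * (2 * B + 1))"
  have e: "0 < e" "e \<le> 1" "e \<le> \<epsilon> / 8" and \<delta>: "0 < \<delta>" using \<epsilon> B0 by (auto simp: e_def \<delta>_def)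
  have "(2 * B + e) * \<delta> \<le> (2 * B + 1) * \<delta>" using e \<delta> B0 by (intro mult_right_mono) auto
  also have "\<dots> = \<epsilon> / 8" using B0 by (simp add: \<delta>_def field_simps add_nonneg_eq_0_iff)
  finally have small: "e + (2 * B + e) * \<delta> \<le> \<epsilon> / 4" using e by simp
  obtain R1 where R1: "\<And>n. measure (\<nu> n) {z. R1 < cmod z} \<le> \<delta>" using tight[OF \<delta>] by auto
  \<comment> \<open>A single law is tight: the sets decrease to the empty set.\<close>
  have "(\<lambda>n. measure \<mu> {z. real n < cmod z}) \<longlonglongrightarrow> measure \<mu> (\<Inter>n. {z. real n < cmod z})"
    by (intro \<mu>.finite_Lim_measure_decseq) (auto simp: decseq_def)
  also have "(\<Inter>n. {z. real n < cmod z}) = {}"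
    by auto (meson not_le real_arch_simple)
  finally have "(\<lambda>n. measure \<mu> {z. real n < cmod z}) \<longlonglongrightarrow> 0" by simp
  then have "\<forall>\<^sub>F n in sequentially. measure \<mu> {z. real n < cmod z} < \<delta>" using \<delta> by (rule order_tendstoD)
  then obtain m where m: "measure \<mu> {z. real m < cmod z} < \<delta>" by (auto simp: eventually_sequentially)
  define R where "R = max 1 (max R1 (real m))"
  have R: "R > 0" by (auto simp: R_def)
  have tR: "measure (\<nu> n) {z. R < cmod z} \<le> \<delta>" for n
  proof -
    interpret prob_space "\<nu> n" by fact
    have [measurable_cong]: "sets (\<nu> n) = sets borel" by fact
    show ?thesis using R1[of n] by (rule order_trans[rotated], intro finite_measure_mono) (auto simp: R_def)
  qed
  have tR\<mu>: "measure \<mu> {z. R < cmod z} \<le> \<delta>"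
    using m[THEN less_imp_le] by (rule order_trans[rotated], intro \<mu>.finite_measure_mono) (auto simp: R_def)
  obtain h where h: "trig_poly (\<lambda>z. of_real (h z))"
    "\<And>z. cmod z \<le> R \<Longrightarrow> \<bar>f z - h z\<bar> \<le> e" "\<And>z. \<bar>h z\<bar> \<le> B + e"
    using trig_approx[OF f(1) B R e(1)] by metis
  have hi: "integrable (\<nu> n) h" "integrable \<mu> h" for n
    using trig_poly_integrable[OF h(1) \<nu>, of n] trig_poly_integrable[OF h(1) \<mu>]
    by (simp_all only: complex_of_real_integrable_eq)
  have "(\<lambda>n. \<integral>z. h z \<partial>\<nu> n) \<longlonglongrightarrow> (\<integral>z. h z \<partial>\<mu>)"
    using trig_poly_tendsto[OF h(1) \<nu> \<mu> char] by (simp add: tendsto_of_real_iff)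
  then obtain n0 where n0: "\<And>n. n \<ge> n0 \<Longrightarrow> dist (\<integral>z. h z \<partial>\<nu> n) (\<integral>z. h z \<partial>\<mu>) < \<epsilon> / 2"
    using \<epsilon> by (metis metric_LIMSEQ_D half_gt_zero)
  have "dist (\<integral>z. f z \<partial>\<nu> n) (\<integral>z. f z \<partial>\<mu>) < \<epsilon>" if "n \<ge> n0" for n
    using integral_diff_tight_bound[OF \<nu>[of n] fm B hi(1) h(3) h(2) tR less_imp_le[OF e(1)]]
      integral_diff_tight_bound[OF \<mu> fm B hi(2) h(3) h(2) tR\<mu> less_imp_le[OF e(1)]]
      n0[OF that] small
    unfolding dist_real_def by linarith
  then show "\<exists>n0. \<forall>n\<ge>n0. dist (\<integral>z. f z \<partial>\<nu> n) (\<integral>z. f z \<partial>\<mu>) < \<epsilon>" by blast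
qed

section \<open>Moments of sums of independent variables\<close>

text \<open>After division by a + b both terms lie in [0, 1], where t \<le> t^e.\<close>

lemma powr_add_le:
  fixes a b e :: real
  assumes "0 \<le> a" "0 \<le> b" "0 < e" "e \<le> 1"
  shows "(a + b) powr e \<le> a powr e + b powr e"
proof (cases "a + b = 0")
  case False
  define c where "c = a + b"
  have c: "c > 0" using False assms by (simp add: c_def)
  have *: "t \<le> t powr e" if "0 \<le> t" "t \<le> 1" for t :: real
    using that assms powr_mono'[of e 1 t] by simp
  have "1 = a / c + b / c" using c by (simp add: c_def add_divide_distrib[symmetric])
  also have "\<dots> \<le> (a / c) powr e + (b / c) powr e"
    using assms c by (intro add_mono *) (auto simp: c_def)
  also have "\<dots> = (a powr e + b powr e) / c powr e"
    using assms c by (simp add: powr_divide add_divide_distrib)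
  finally show ?thesis using c by (simp add: field_simps c_def)
qed (use assms in \<open>auto simp: add_nonneg_eq_0_iff\<close>)

lemma powr_add_le':
  fixes a b p :: real
  assumes "0 \<le> a" "0 \<le> b" "0 \<le> p"
  shows "(a + b) powr p \<le> 2 powr p * (a powr p + b powr p)"
proof -
  have "(a + b) powr p \<le> (2 * max a b) powr p" using assms by (intro powr_mono2) auto
  also have "\<dots> = 2 powr p * max a b powr p" using assms by (simp add: powr_mult)
  also have "max a b powr p \<le> a powr p + b powr p" by (auto simp: max_def)
  finally show ?thesis by simp
qed

text \<open>With g(x) = x |x|^e, split g(x + y) - g(x) = y |x + y|^e + x (|x + y|^e - |x|^e). The
  first term is bounded by subadditivity of the e-th power. In the second, factoring out |x| leaves
  |t^e - 1| \<le> |t - 1| for the ratio t of the moduli.\<close>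

lemma norm_signed_powr_diff_le:
  fixes x y :: complex
  assumes "0 < e" "e \<le> 1"
  shows "cmod ((x + y) * of_real (cmod (x + y) powr e) - x * of_real (cmod x powr e))
    \<le> cmod y * (2 * cmod x powr e + cmod y powr e)"
proof -
  let ?A = "cmod (x + y)" and ?B = "cmod x"
  have 1: "?B * \<bar>?A powr e - ?B powr e\<bar> \<le> ?B powr e * cmod y"
  proof (cases "x = 0")
    case False
    then have B: "?B > 0" by simp
    define t where "t = ?A / ?B"
    have t: "t \<ge> 0" "?A = t * ?B" using B by (auto simp: t_def)
    have "\<bar>t powr e - 1\<bar> \<le> \<bar>t - 1\<bar>"
    proof (cases "t \<le> 1")
      case True
      then have "t \<le> t powr e" "t powr e \<le> 1"
        using assms t powr_mono'[of e 1 t] by (auto intro: powr_le1)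
      then show ?thesis by simp
    next
      case False
      then have "t powr e \<le> t" "1 \<le> t powr e"
        using assms powr_mono[of e 1 t] by (auto intro: ge_one_powr_ge_zero)
      then show ?thesis by simp
    qed
    then have "?B powr e * (?B * \<bar>t powr e - 1\<bar>) \<le> ?B powr e * (?B * \<bar>t - 1\<bar>)"
      using B by (intro mult_left_mono) auto
    also have "?B * \<bar>t - 1\<bar> = \<bar>?A - ?B\<bar>"
      unfolding t(2) using B by (simp add: abs_mult[symmetric] algebra_simps abs_if)
    also have "\<bar>?A - ?B\<bar> \<le> cmod y"
      using norm_triangle_ineq3[of "x + y" x] by simp
    also have "?B powr e * (?B * \<bar>t powr e - 1\<bar>) = ?B * \<bar>?A powr e - ?B powr e\<bar>"
    proof -
      have "?A powr e = t powr e * ?B powr e" using t B by (simp add: powr_mult)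
      then have "\<bar>?A powr e - ?B powr e\<bar> = \<bar>?B powr e * (t powr e - 1)\<bar>" by (simp add: algebra_simps)
      then show ?thesis by (simp add: abs_mult)
    qed
    finally show ?thesis by (simp add: mult_left_mono)
  qed simp
  have "(x + y) * of_real (?A powr e) - x * of_real (?B powr e)
      = y * of_real (?A powr e) + x * of_real (?A powr e - ?B powr e)"
    by (simp add: algebra_simps)
  also have "cmod \<dots> \<le> cmod y * ?A powr e + ?B * \<bar>?A powr e - ?B powr e\<bar>"
    by (rule order_trans[OF norm_triangle_ineq]) (simp add: norm_mult del: of_real_diff)
  also have "\<dots> \<le> cmod y * (?B powr e + cmod y powr e) + ?B powr e * cmod y"
  proof -
    have "?A powr e \<le> (?B + cmod y) powr e"
      using assms norm_triangle_ineq by (intro powr_mono2) auto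
    also have "\<dots> \<le> ?B powr e + cmod y powr e"
      using assms by (intro powr_add_le) auto
    finally show ?thesis by (intro add_mono 1 mult_left_mono) auto
  qed
  finally show ?thesis by (simp add: algebra_simps)
qed

lemma powr_le_one_plus_powr:
  fixes x p q :: real
  assumes "0 \<le> x" "0 \<le> q" "q \<le> p"
  shows "x powr q \<le> 1 + x powr p"
proof (cases "x \<le> 1")
  case True
  then have "x powr q \<le> 1" using assms by (intro powr_le1) auto
  then show ?thesis by (simp add: add_increasing2)
next
  case False
  then have "x powr q \<le> x powr p" using assms by (intro powr_mono) auto
  then show ?thesis by simp
qed

lemma borel_measurable_cnj[measurable]: "cnj \<in> borel_measurable borel"
  by (intro borel_measurable_continuous_onI continuous_intros)

section \<open>Absolute moments of complex random variables\<close>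

context prob_space
begin

definition has_moment :: "real \<Rightarrow> ('a \<Rightarrow> complex) \<Rightarrow> bool" where
  "has_moment p X \<longleftrightarrow> X \<in> borel_measurable M \<and> integrable M (\<lambda>\<omega>. cmod (X \<omega>) powr p)"

lemma has_momentD[dest]:
  "has_moment p X \<Longrightarrow> X \<in> borel_measurable M"
  "has_moment p X \<Longrightarrow> integrable M (\<lambda>\<omega>. cmod (X \<omega>) powr p)"
  by (auto simp: has_moment_def)

lemma has_moment_mono:
  assumes "has_moment p X" "0 \<le> q" "q \<le> p"
  shows "has_moment q X"
proof -
  have [measurable]: "X \<in> borel_measurable M" using assms by auto
  have "integrable M (\<lambda>\<omega>. cmod (X \<omega>) powr q)"
    by (rule Bochner_Integration.integrable_bound[where f="\<lambda>\<omega>. 1 + cmod (X \<omega>) powr p"])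
      (use assms powr_le_one_plus_powr in \<open>auto intro!: AE_I2\<close>)
  then show ?thesis by (simp add: has_moment_def)
qed

lemma has_moment_integrable:
  assumes "has_moment p X" "1 \<le> p"
  shows "integrable M X"
proof -
  have "has_moment 1 X" using has_moment_mono[OF assms(1)] assms(2) by simp
  then have "integrable M (\<lambda>\<omega>. norm (X \<omega>))" "X \<in> borel_measurable M"
    by (auto simp: has_moment_def)
  then show ?thesis by (rule integrable_norm_cancel)
qed

lemma has_moment_square:
  assumes "has_moment p X" "2 \<le> p"
  shows "integrable M (\<lambda>\<omega>. (cmod (X \<omega>))\<^sup>2)"
proof -
  have "has_moment 2 X" using has_moment_mono[OF assms(1)] assms(2) by simp
  then show ?thesis by (auto simp: has_moment_def)
qed

lemma has_moment_bound:
  assumes "has_moment p X" "Y \<in> borel_measurable M" "\<And>\<omega>. cmod (Y \<omega>) \<le> cmod (X \<omega>)" "0 \<le> p"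
  shows "has_moment p Y"
  unfolding has_moment_def
proof (intro conjI assms(2) Bochner_Integration.integrable_bound[OF has_momentD(2)[OF assms(1)]])
  show "(\<lambda>\<omega>. cmod (Y \<omega>) powr p) \<in> borel_measurable M" using assms(2) by measurable
  show "AE \<omega> in M. norm (cmod (Y \<omega>) powr p) \<le> norm (cmod (X \<omega>) powr p)"
    using assms by (auto intro!: AE_I2 powr_mono2)
qed

lemma has_moment_const: "has_moment p (\<lambda>\<omega>. c)"
  by (simp add: has_moment_def)

lemma has_moment_cmult:
  assumes "has_moment p X" shows "has_moment p (\<lambda>\<omega>. c * X \<omega>)"
  using assms by (auto simp: has_moment_def norm_mult powr_mult)

lemma has_moment_add:
  assumes "has_moment p X" "has_moment p Y" "0 \<le> p"
  shows "has_moment p (\<lambda>\<omega>. X \<omega> + Y \<omega>)"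
proof -
  have [measurable]: "X \<in> borel_measurable M" "Y \<in> borel_measurable M" using assms by auto
  have le: "cmod (X \<omega> + Y \<omega>) powr p \<le> 2 powr p * (cmod (X \<omega>) powr p + cmod (Y \<omega>) powr p)" for \<omega>
    using assms(3) norm_triangle_ineq
    by (intro order_trans[OF powr_mono2 powr_add_le']) auto
  have "integrable M (\<lambda>\<omega>. cmod (X \<omega> + Y \<omega>) powr p)"
  proof (rule Bochner_Integration.integrable_bound)
    show "integrable M (\<lambda>\<omega>. 2 powr p * (cmod (X \<omega>) powr p + cmod (Y \<omega>) powr p))"
      using has_momentD(2)[OF assms(1)] has_momentD(2)[OF assms(2)] by simp
    show "AE \<omega> in M. norm (cmod (X \<omega> + Y \<omega>) powr p) \<le> norm (2 powr p * (cmod (X \<omega>) powr p + cmod (Y \<omega>) powr p))"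
      by (intro AE_I2 order_trans[OF _ abs_ge_self[unfolded real_norm_def[symmetric]]]) (use le in simp)
  qed measurable
  then show ?thesis by (simp add: has_moment_def)
qed

lemma has_moment_diff:
  assumes "has_moment p X" "has_moment p Y" "0 \<le> p"
  shows "has_moment p (\<lambda>\<omega>. X \<omega> - Y \<omega>)"
  using has_moment_add[OF assms(1) has_moment_cmult[OF assms(2), of "-1"] assms(3)] by simp

lemma has_moment_sum:
  assumes "\<And>k. k \<in> I \<Longrightarrow> has_moment p (X k)" "0 \<le> p"
  shows "has_moment p (\<lambda>\<omega>. \<Sum>k\<in>I. X k \<omega>)"
  using assms(1)
  by (induction I rule: infinite_finite_induct) (auto intro: has_moment_const has_moment_add[OF _ _ assms(2)])

section \<open>Independence and second moments\<close>

lemma indep_vars_imp_indep_var: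
  assumes "indep_vars (\<lambda>_. borel) X I" "j \<in> I" "k \<in> I" "j \<noteq> k"
    and "f \<in> borel_measurable borel" "g \<in> borel_measurable borel"
  shows "indep_var borel (\<lambda>\<omega>. f (X j \<omega>)) borel (\<lambda>\<omega>. g (X k \<omega>))"
proof -
  have *: "indep_var (Pi\<^sub>M {j} (\<lambda>_. borel)) (\<lambda>\<omega>. restrict (\<lambda>i. X i \<omega>) {j})
    (Pi\<^sub>M {k} (\<lambda>_. borel)) (\<lambda>\<omega>. restrict (\<lambda>i. X i \<omega>) {k})"
    using assms by (intro indep_var_restrict[OF assms(1)]) auto
  have "indep_var borel ((\<lambda>x. f (x j)) \<circ> (\<lambda>\<omega>. restrict (\<lambda>i. X i \<omega>) {j}))
    borel ((\<lambda>x. g (x k)) \<circ> (\<lambda>\<omega>. restrict (\<lambda>i. X i \<omega>) {k}))"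
    by (intro indep_var_compose[OF *] measurable_compose[OF _ assms(5)] measurable_compose[OF _ assms(6)]
        measurable_component_singleton) auto
  then show ?thesis by (simp add: comp_def)
qed

text \<open>Meant for the decoupling in the Rosenthal argument: one summand against the sum of all
  the others.\<close>

lemma indep_vars_imp_indep_var_sum:
  fixes X :: "'i \<Rightarrow> 'a \<Rightarrow> complex"
  assumes "indep_vars (\<lambda>_. borel) X I" "finite I" "k \<in> I"
    and "f \<in> borel_measurable borel" "g \<in> borel_measurable borel"
  shows "indep_var borel (\<lambda>\<omega>. f (X k \<omega>)) borel (\<lambda>\<omega>. g (\<Sum>j\<in>I - {k}. X j \<omega>))"
proof -
  have *: "indep_var (Pi\<^sub>M {k} (\<lambda>_. borel)) (\<lambda>\<omega>. restrict (\<lambda>i. X i \<omega>) {k})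
    (Pi\<^sub>M (I - {k}) (\<lambda>_. borel)) (\<lambda>\<omega>. restrict (\<lambda>i. X i \<omega>) (I - {k}))"
    using assms by (intro indep_var_restrict[OF assms(1)]) auto
  have "indep_var borel ((\<lambda>x. f (x k)) \<circ> (\<lambda>\<omega>. restrict (\<lambda>i. X i \<omega>) {k}))
    borel ((\<lambda>x. g (\<Sum>j\<in>I - {k}. x j)) \<circ> (\<lambda>\<omega>. restrict (\<lambda>i. X i \<omega>) (I - {k})))"
    by (intro indep_var_compose[OF *] measurable_compose[OF _ assms(4)] measurable_compose[OF _ assms(5)]
        borel_measurable_sum measurable_component_singleton) auto
  then show ?thesis by (simp add: comp_def)
qed

lemma integrable_mult_of_square:
  fixes X Y :: "'a \<Rightarrow> complex"
  assumes "has_moment 2 X" "has_moment 2 Y"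
  shows "integrable M (\<lambda>\<omega>. X \<omega> * Y \<omega>)"
proof (rule Bochner_Integration.integrable_bound)
  show "integrable M (\<lambda>\<omega>. (cmod (X \<omega>))\<^sup>2 + (cmod (Y \<omega>))\<^sup>2)"
    using assms has_moment_square by auto
  have "cmod (X \<omega> * Y \<omega>) \<le> (cmod (X \<omega>))\<^sup>2 + (cmod (Y \<omega>))\<^sup>2" for \<omega>
    using sum_squares_bound[of "cmod (X \<omega>)" "cmod (Y \<omega>)"]
      mult_nonneg_nonneg[OF norm_ge_zero[of "X \<omega>"] norm_ge_zero[of "Y \<omega>"]] unfolding norm_mult
    by (simp only: mult.assoc)
  then show "AE \<omega> in M. norm (X \<omega> * Y \<omega>) \<le> norm ((cmod (X \<omega>))\<^sup>2 + (cmod (Y \<omega>))\<^sup>2)"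
    by (auto intro!: AE_I2)
qed (use assms in \<open>auto simp: has_moment_def\<close>)

lemma has_moment_cnj: "has_moment p X \<Longrightarrow> has_moment p (\<lambda>\<omega>. cnj (X \<omega>))"
  by (auto simp: has_moment_def)

text \<open>Expand the square; off the diagonal independence factors the expectations, so only the
  diagonal deviates from the square of the mean. The means are kept because the formula serves for
  centred and for uncentred summands.\<close>

lemma expectation_norm_square_sum:
  fixes Y :: "'i \<Rightarrow> 'a \<Rightarrow> complex"
  assumes "finite I" "indep_vars (\<lambda>_. borel) Y I" and m: "\<And>k. k \<in> I \<Longrightarrow> has_moment 2 (Y k)"
  shows "(\<integral>\<omega>. (cmod (\<Sum>k\<in>I. Y k \<omega>))\<^sup>2 \<partial>M) =
    (\<Sum>k\<in>I. (\<integral>\<omega>. (cmod (Y k \<omega>))\<^sup>2 \<partial>M) - (cmod (\<integral>\<omega>. Y k \<omega> \<partial>M))\<^sup>2) + (cmod (\<Sum>k\<in>I. \<integral>\<omega>. Y k \<omega> \<partial>M))\<^sup>2"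
proof -
  define \<mu> where "\<mu> k = (\<integral>\<omega>. Y k \<omega> \<partial>M)" for k
  note int = has_moment_integrable[OF m]
  have ii: "integrable M (\<lambda>\<omega>. Y j \<omega> * cnj (Y k \<omega>))" if "j \<in> I" "k \<in> I" for j k
    using that m by (intro integrable_mult_of_square has_moment_cnj)
  have jk: "(\<integral>\<omega>. Y j \<omega> * cnj (Y k \<omega>) \<partial>M) = \<mu> j * cnj (\<mu> k) +
     (if j = k then of_real ((\<integral>\<omega>. (cmod (Y k \<omega>))\<^sup>2 \<partial>M) - (cmod (\<mu> k))\<^sup>2) else 0)" if "j \<in> I" "k \<in> I" for j k
  proof (cases "j = k")
    case True
    have "(\<integral>\<omega>. Y k \<omega> * cnj (Y k \<omega>) \<partial>M) = (\<integral>\<omega>. of_real ((cmod (Y k \<omega>))\<^sup>2) \<partial>M)"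
      by (simp only: complex_norm_square)
    then show ?thesis using True by (simp add: complex_norm_square[symmetric] del: of_real_power flip: of_real_add)
  next
    case False
    have "(\<integral>\<omega>. Y j \<omega> * cnj (Y k \<omega>) \<partial>M) = (\<integral>\<omega>. Y j \<omega> \<partial>M) * (\<integral>\<omega>. cnj (Y k \<omega>) \<partial>M)"
      using that False int
      by (intro indep_var_lebesgue_integral indep_vars_imp_indep_var[OF assms(2), of j k "\<lambda>x. x" cnj]) auto
    then show ?thesis using False by (simp add: \<mu>_def)
  qed
  have "complex_of_real (\<integral>\<omega>. (cmod (\<Sum>k\<in>I. Y k \<omega>))\<^sup>2 \<partial>M) = (\<integral>\<omega>. of_real ((cmod (\<Sum>k\<in>I. Y k \<omega>))\<^sup>2) \<partial>M)"
    by (rule integral_complex_of_real[symmetric])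
  also have "\<dots> = (\<integral>\<omega>. (\<Sum>j\<in>I. \<Sum>k\<in>I. Y j \<omega> * cnj (Y k \<omega>)) \<partial>M)"
    by (simp only: complex_norm_square cnj_sum sum_product)
  also have "\<dots> = (\<Sum>j\<in>I. \<Sum>k\<in>I. \<integral>\<omega>. Y j \<omega> * cnj (Y k \<omega>) \<partial>M)"
    using ii by (subst Bochner_Integration.integral_sum; simp)+
  also have "\<dots> = (\<Sum>j\<in>I. \<Sum>k\<in>I. \<mu> j * cnj (\<mu> k) +
     (if j = k then of_real ((\<integral>\<omega>. (cmod (Y k \<omega>))\<^sup>2 \<partial>M) - (cmod (\<mu> k))\<^sup>2) else 0))"
    using jk by (intro sum.cong refl) auto
  also have "\<dots> = (\<Sum>j\<in>I. \<mu> j) * cnj (\<Sum>k\<in>I. \<mu> k) + (\<Sum>k\<in>I. of_real ((\<integral>\<omega>. (cmod (Y k \<omega>))\<^sup>2 \<partial>M) - (cmod (\<mu> k))\<^sup>2))"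
    using assms(1) by (simp add: sum.distrib sum_product sum.delta)
  also have "\<dots> = of_real ((\<Sum>k\<in>I. (\<integral>\<omega>. (cmod (Y k \<omega>))\<^sup>2 \<partial>M) - (cmod (\<mu> k))\<^sup>2) + (cmod (\<Sum>k\<in>I. \<mu> k))\<^sup>2)"
    by (simp only: complex_norm_square[symmetric] of_real_sum of_real_add) (simp add: add.commute)
  finally show ?thesis unfolding \<mu>_def by (simp only: of_real_eq_iff)
qed

lemma expectation_centered_square:
  assumes "has_moment 2 X"
  shows "(\<integral>\<omega>. (cmod (X \<omega> - (\<integral>\<omega>'. X \<omega>' \<partial>M)))\<^sup>2 \<partial>M) = complex_variance M X"
proof -
  define \<mu> where "\<mu> = (\<integral>\<omega>. X \<omega> \<partial>M)"
  define h where "h \<omega> = Re (cnj \<mu> * X \<omega>)" for \<omega>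
  have iX: "integrable M X" using has_moment_integrable[OF assms] by simp
  have eq: "(cmod (X \<omega> - \<mu>))\<^sup>2 = (cmod (X \<omega>))\<^sup>2 - 2 * h \<omega> + (cmod \<mu>)\<^sup>2" for \<omega>
    unfolding h_def cmod_power2 by (simp add: power2_eq_square algebra_simps)
  have i: "integrable M h" unfolding h_def using iX by (intro integrable_Re) simp
  have "(\<integral>\<omega>. h \<omega> \<partial>M) = Re (\<integral>\<omega>. cnj \<mu> * X \<omega> \<partial>M)"
    unfolding h_def using iX by (intro integral_Re) auto
  also have "\<dots> = (cmod \<mu>)\<^sup>2" by (simp add: \<mu>_def[symmetric] cmod_power2) (simp add: power2_eq_square)
  finally show ?thesis
    unfolding \<mu>_def[symmetric] eq using has_moment_square[OF assms] i
    by (simp add: prob_space complex_variance_def \<mu>_def[symmetric])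
qed

text \<open>The bound is \<le> 1 and not = 1 because a vanishing variance makes the quotient 0. It
  is all that tightness requires.\<close>

lemma complex_standardize_second_moment:
  assumes X: "has_moment 2 X"
  shows "complex_standardize M X \<in> borel_measurable M"
    and "integrable M (\<lambda>\<omega>. (cmod (complex_standardize M X \<omega>))\<^sup>2)"
    and "(\<integral>\<omega>. (cmod (complex_standardize M X \<omega>))\<^sup>2 \<partial>M) \<le> 1"
proof -
  have [measurable]: "X \<in> borel_measurable M" using X by auto
  let ?v = "complex_variance M X"
  show "complex_standardize M X \<in> borel_measurable M" unfolding complex_standardize_def by measurable
  have v: "0 \<le> ?v" unfolding expectation_centered_square[OF X, symmetric] by simp
  have eq: "(cmod (complex_standardize M X \<omega>))\<^sup>2 = (cmod (X \<omega> - (\<integral>\<omega>'. X \<omega>' \<partial>M)))\<^sup>2 / ?v" for \<omega>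
    unfolding complex_standardize_def norm_divide power_divide norm_of_real using v by simp
  have i: "integrable M (\<lambda>\<omega>. (cmod (X \<omega> - (\<integral>\<omega>'. X \<omega>' \<partial>M)))\<^sup>2)"
    by (rule has_moment_square[OF has_moment_diff[OF X has_moment_const]]) auto
  show "integrable M (\<lambda>\<omega>. (cmod (complex_standardize M X \<omega>))\<^sup>2)"
    unfolding eq using i by simp
  show "(\<integral>\<omega>. (cmod (complex_standardize M X \<omega>))\<^sup>2 \<partial>M) \<le> 1"
    unfolding eq integral_divide_zero expectation_centered_square[OF X] by simp
qed

section \<open>A Rosenthal inequality for exponents between 2 and 3\<close>

text \<open>Jensen's inequality for t^(e/2), obtained pointwise from Young's inequality for t =
  |X|^2 / V and 1 with weights e/2 and 1 - e/2.\<close>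

lemma expectation_powr_le:
  assumes "has_moment 2 X" "(\<integral>\<omega>. (cmod (X \<omega>))\<^sup>2 \<partial>M) \<le> V" "V > 0" "0 < e" "e \<le> 1"
  shows "(\<integral>\<omega>. cmod (X \<omega>) powr e \<partial>M) \<le> V powr (e / 2)"
proof -
  have i: "integrable M (\<lambda>\<omega>. cmod (X \<omega>) powr e)"
    using has_moment_mono[OF assms(1), of e] assms by auto
  have i2: "integrable M (\<lambda>\<omega>. (cmod (X \<omega>))\<^sup>2)" using has_moment_square assms by auto
  have pw: "cmod (X \<omega>) powr e \<le> V powr (e/2) * (e/2 * ((cmod (X \<omega>))\<^sup>2 / V) + (1 - e/2))" for \<omega>
  proof (cases "X \<omega> = 0")
    case False
    define t where "t = (cmod (X \<omega>))\<^sup>2 / V"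
    have t: "t > 0" using False assms by (simp add: t_def)
    have "t powr (e/2) * 1 powr (1 - e/2) \<le> e/2 * t + (1 - e/2) * 1"
      using assms t by (intro Youngs_inequality_0) auto
    moreover have "cmod (X \<omega>) powr e = V powr (e/2) * t powr (e/2)"
    proof -
      have "V powr (e/2) * t powr (e/2) = ((cmod (X \<omega>))\<^sup>2) powr (e/2)"
        using assms t by (simp add: powr_mult[symmetric] t_def)
      also have "\<dots> = cmod (X \<omega>) powr e"
        using False by (simp add: powr_powr flip: powr_numeral)
      finally show ?thesis by simp
    qed
    ultimately show ?thesis by (simp add: t_def mult_left_mono)
  qed (use assms in simp)
  have "(\<integral>\<omega>. cmod (X \<omega>) powr e \<partial>M) \<le> (\<integral>\<omega>. V powr (e/2) * (e/2 * ((cmod (X \<omega>))\<^sup>2 / V) + (1 - e/2)) \<partial>M)"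
    by (intro integral_mono pw i) (use i2 in auto)
  also have "\<dots> = V powr (e/2) * (e/2 * ((\<integral>\<omega>. (cmod (X \<omega>))\<^sup>2 \<partial>M) / V) + (1 - e/2))"
    using i2 by (simp add: prob_space)
  also have "\<dots> \<le> V powr (e/2) * (e/2 * 1 + (1 - e/2))"
    using assms by (intro mult_left_mono add_right_mono) auto
  finally show ?thesis by simp
qed

text \<open>
  Writing $|S|^{2+e} = \sum_k \bar Y_k g(S)$ with $g(x) = x |x|^e$, independence allows to replace
  $g(S)$ by $g(S) - g(S - Y_k)$, which is controlled by the Lipschitz-type bound above.
\<close>

theorem rosenthal:
  fixes Y :: "'i \<Rightarrow> 'a \<Rightarrow> complex"
  assumes fin: "finite I" and ind: "indep_vars (\<lambda>_. borel) Y I"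
    and e: "0 < e" "e \<le> 1"
    and m: "\<And>k. k \<in> I \<Longrightarrow> has_moment (2 + e) (Y k)"
    and zero: "\<And>k. k \<in> I \<Longrightarrow> (\<integral>\<omega>. Y k \<omega> \<partial>M) = 0"
    and V: "(\<Sum>k\<in>I. \<integral>\<omega>. (cmod (Y k \<omega>))\<^sup>2 \<partial>M) \<le> V" "V > 0"
  shows "(\<integral>\<omega>. cmod (\<Sum>k\<in>I. Y k \<omega>) powr (2 + e) \<partial>M)
    \<le> 2 * V powr (1 + e/2) + (\<Sum>k\<in>I. \<integral>\<omega>. cmod (Y k \<omega>) powr (2 + e) \<partial>M)"
proof -
  define g where "g x = x * of_real (cmod x powr e)" for x :: complex
  define S where "S \<omega> = (\<Sum>k\<in>I. Y k \<omega>)" for \<omega>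
  define R where "R k \<omega> = (\<Sum>j\<in>I - {k}. Y j \<omega>)" for k \<omega>
  have [measurable]: "g \<in> borel_measurable borel" unfolding g_def by measurable
  have m2: "has_moment 2 (Y k)" if "k \<in> I" for k using has_moment_mono[OF m[OF that]] e by simp
  have [measurable]: "Y k \<in> borel_measurable M" if "k \<in> I" for k using m[OF that] by auto
  have S: "has_moment (2 + e) S" unfolding S_def by (intro has_moment_sum m) (use e in auto)
  have R: "has_moment (2 + e) (R k)" for k unfolding R_def by (intro has_moment_sum m) (use e in auto)
  have R2: "has_moment 2 (R k)" for k using has_moment_mono[OF R] e by simp
  have Sk: "S \<omega> = R k \<omega> + Y k \<omega>" if "k \<in> I" for k \<omega>
    using that fin by (simp add: S_def R_def sum.remove[of I k])
  have [measurable]: "S \<in> borel_measurable M" "R k \<in> borel_measurable M" for k using S R by auto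
  have ng: "cmod (g x) = cmod x powr (1 + e)" for x
    by (cases "x = 0") (auto simp: g_def norm_mult powr_add)
  have hg: "integrable M (\<lambda>\<omega>. g (R k \<omega>))" for k
  proof -
    have "has_moment (1 + e) (R k)" using has_moment_mono[OF R] e by simp
    then have "integrable M (\<lambda>\<omega>. cmod (g (R k \<omega>)))" by (auto simp: ng)
    then show ?thesis by (rule integrable_norm_cancel) measurable
  qed
  \<comment> \<open>Centred independent summands have additive second moments, so leaving out one of
    them cannot raise the second moment above V.\<close>
  have Rk: "(\<integral>\<omega>. (cmod (R k \<omega>))\<^sup>2 \<partial>M) \<le> V" for k
  proof -
    have ind': "indep_vars (\<lambda>_. borel) Y (I - {k})" by (rule indep_vars_subset[OF ind]) auto
    have "(\<integral>\<omega>. (cmod (R k \<omega>))\<^sup>2 \<partial>M) = (\<Sum>j\<in>I - {k}. (\<integral>\<omega>. (cmod (Y j \<omega>))\<^sup>2 \<partial>M))"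
      unfolding R_def using m2 zero fin by (subst expectation_norm_square_sum[OF _ ind']) auto
    also have "\<dots> \<le> (\<Sum>j\<in>I. (\<integral>\<omega>. (cmod (Y j \<omega>))\<^sup>2 \<partial>M))"
      using fin by (intro sum_mono2) auto
    finally show ?thesis using V by simp
  qed
  have Re_pw: "cmod (S \<omega>) powr (2 + e) = Re (\<Sum>k\<in>I. cnj (Y k \<omega>) * g (S \<omega>))" for \<omega>
  proof -
    have "(\<Sum>k\<in>I. cnj (Y k \<omega>) * g (S \<omega>)) = cnj (S \<omega>) * g (S \<omega>)"
      by (simp add: S_def sum_distrib_right)
    also have "\<dots> = of_real ((cmod (S \<omega>))\<^sup>2 * cmod (S \<omega>) powr e)"
      unfolding g_def of_real_mult complex_norm_square by (simp add: mult_ac)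
    finally show ?thesis by (cases "S \<omega> = 0") (auto simp: powr_add simp flip: powr_numeral)
  qed
  \<comment> \<open>The first term will factorise by independence and sum up to at most 2 V^(1 +
    e/2); the second one is the moment of order 2 + e of the summand.\<close>
  have bnd: "cmod (cnj (Y k \<omega>) * (g (S \<omega>) - g (R k \<omega>)))
      \<le> 2 * ((cmod (Y k \<omega>))\<^sup>2 * cmod (R k \<omega>) powr e) + cmod (Y k \<omega>) powr (2 + e)" if "k \<in> I" for k \<omega>
  proof -
    have "cmod (g (S \<omega>) - g (R k \<omega>)) \<le> cmod (Y k \<omega>) * (2 * cmod (R k \<omega>) powr e + cmod (Y k \<omega>) powr e)"
      unfolding g_def Sk[OF that] by (rule norm_signed_powr_diff_le[OF e])
    then have "cmod (cnj (Y k \<omega>) * (g (S \<omega>) - g (R k \<omega>)))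
       \<le> cmod (Y k \<omega>) * (cmod (Y k \<omega>) * (2 * cmod (R k \<omega>) powr e + cmod (Y k \<omega>) powr e))"
      by (simp add: norm_mult mult_left_mono)
    also have "\<dots> = 2 * ((cmod (Y k \<omega>))\<^sup>2 * cmod (R k \<omega>) powr e) + cmod (Y k \<omega>) powr (2 + e)"
      by (cases "Y k \<omega> = 0") (auto simp: powr_add power2_eq_square algebra_simps)
    finally show ?thesis .
  qed
  have prod: "integrable M (\<lambda>\<omega>. (cmod (Y k \<omega>))\<^sup>2 * cmod (R k \<omega>) powr e)"
    "(\<integral>\<omega>. (cmod (Y k \<omega>))\<^sup>2 * cmod (R k \<omega>) powr e \<partial>M) = (\<integral>\<omega>. (cmod (Y k \<omega>))\<^sup>2 \<partial>M) * (\<integral>\<omega>. cmod (R k \<omega>) powr e \<partial>M)"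
    if "k \<in> I" for k
  proof -
    have iv: "indep_var borel (\<lambda>\<omega>. (cmod (Y k \<omega>))\<^sup>2) borel (\<lambda>\<omega>. cmod (R k \<omega>) powr e)"
      unfolding R_def by (rule indep_vars_imp_indep_var_sum[OF ind fin that, of "\<lambda>x. (cmod x)\<^sup>2" "\<lambda>x. cmod x powr e"]) measurable
    have "integrable M (\<lambda>\<omega>. cmod (R k \<omega>) powr e)" using has_moment_mono[OF R, of e k] e by auto
    from indep_var_integrable[OF iv _ this] indep_var_lebesgue_integral[OF iv _ this]
    show "integrable M (\<lambda>\<omega>. (cmod (Y k \<omega>))\<^sup>2 * cmod (R k \<omega>) powr e)"
    "(\<integral>\<omega>. (cmod (Y k \<omega>))\<^sup>2 * cmod (R k \<omega>) powr e \<partial>M) = (\<integral>\<omega>. (cmod (Y k \<omega>))\<^sup>2 \<partial>M) * (\<integral>\<omega>. cmod (R k \<omega>) powr e \<partial>M)"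
      using has_moment_square[OF m2[OF that]] by auto
  qed
  have iB: "integrable M (\<lambda>\<omega>. 2 * ((cmod (Y k \<omega>))\<^sup>2 * cmod (R k \<omega>) powr e) + cmod (Y k \<omega>) powr (2 + e))"
    if "k \<in> I" for k
    using prod(1)[OF that] m[OF that]
    by (intro Bochner_Integration.integrable_add integrable_mult_right) (auto simp: has_moment_def)
  have iD: "integrable M (\<lambda>\<omega>. cnj (Y k \<omega>) * (g (S \<omega>) - g (R k \<omega>)))" if "k \<in> I" for k
  proof (rule Bochner_Integration.integrable_bound[OF iB[OF that]])
    show "AE \<omega> in M. norm (cnj (Y k \<omega>) * (g (S \<omega>) - g (R k \<omega>)))
      \<le> norm (2 * ((cmod (Y k \<omega>))\<^sup>2 * cmod (R k \<omega>) powr e) + cmod (Y k \<omega>) powr (2 + e))"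
      by (intro AE_I2 order_trans[OF bnd[OF that]]) (simp only: real_norm_def abs_ge_self)
  qed (use that in measurable)
  have ivR: "indep_var borel (\<lambda>\<omega>. cnj (Y k \<omega>)) borel (\<lambda>\<omega>. g (R k \<omega>))" if "k \<in> I" for k
    unfolding R_def by (rule indep_vars_imp_indep_var_sum[OF ind fin that, of cnj g]) measurable
  have iY: "integrable M (Y k)" if "k \<in> I" for k using has_moment_integrable[OF m2[OF that]] by simp
  \<comment> \<open>Subtracting g(R k) is free because Y k is centred and independent of R
    k.\<close>
  have iR: "integrable M (\<lambda>\<omega>. cnj (Y k \<omega>) * g (R k \<omega>))"
    and zR: "(\<integral>\<omega>. cnj (Y k \<omega>) * g (R k \<omega>) \<partial>M) = 0" if "k \<in> I" for k
    using indep_var_integrable[OF ivR[OF that]] indep_var_lebesgue_integral[OF ivR[OF that]]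
      iY[OF that] hg zero[OF that] by auto
  have "(\<integral>\<omega>. cmod (S \<omega>) powr (2 + e) \<partial>M) = (\<integral>\<omega>. Re (\<Sum>k\<in>I. cnj (Y k \<omega>) * (g (S \<omega>) - g (R k \<omega>)) + cnj (Y k \<omega>) * g (R k \<omega>)) \<partial>M)"
    unfolding Re_pw by (simp add: algebra_simps)
  also have "\<dots> = Re (\<integral>\<omega>. (\<Sum>k\<in>I. cnj (Y k \<omega>) * (g (S \<omega>) - g (R k \<omega>)) + cnj (Y k \<omega>) * g (R k \<omega>)) \<partial>M)"
    using iD iR by (intro integral_Re) auto
  also have "\<dots> = Re (\<Sum>k\<in>I. \<integral>\<omega>. cnj (Y k \<omega>) * (g (S \<omega>) - g (R k \<omega>)) \<partial>M)"
    using iD iR zR by (subst Bochner_Integration.integral_sum) (auto cong: sum.cong)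
  also have "\<dots> \<le> (\<Sum>k\<in>I. (\<integral>\<omega>. cmod (cnj (Y k \<omega>) * (g (S \<omega>) - g (R k \<omega>))) \<partial>M))"
    unfolding Re_sum by (intro sum_mono order_trans[OF complex_Re_le_cmod] integral_norm_bound)
  also have "\<dots> \<le> (\<Sum>k\<in>I. (\<integral>\<omega>. 2 * ((cmod (Y k \<omega>))\<^sup>2 * cmod (R k \<omega>) powr e) + cmod (Y k \<omega>) powr (2 + e) \<partial>M))"
    by (intro sum_mono integral_mono iB bnd integrable_norm iD)
  also have "\<dots> = (\<Sum>k\<in>I. 2 * ((\<integral>\<omega>. (cmod (Y k \<omega>))\<^sup>2 \<partial>M) * (\<integral>\<omega>. cmod (R k \<omega>) powr e \<partial>M)) + (\<integral>\<omega>. cmod (Y k \<omega>) powr (2 + e) \<partial>M))"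
    using prod m by (intro sum.cong refl) (subst Bochner_Integration.integral_add, auto)
  also have "\<dots> \<le> (\<Sum>k\<in>I. 2 * ((\<integral>\<omega>. (cmod (Y k \<omega>))\<^sup>2 \<partial>M) * V powr (e/2)) + (\<integral>\<omega>. cmod (Y k \<omega>) powr (2 + e) \<partial>M))"
    using expectation_powr_le[OF R2 Rk V(2) e] by (intro sum_mono add_right_mono mult_left_mono) auto
  also have "\<dots> = 2 * ((\<Sum>k\<in>I. \<integral>\<omega>. (cmod (Y k \<omega>))\<^sup>2 \<partial>M) * V powr (e/2)) + (\<Sum>k\<in>I. \<integral>\<omega>. cmod (Y k \<omega>) powr (2 + e) \<partial>M)"
    by (simp add: sum.distrib sum_distrib_left sum_distrib_right)
  also have "\<dots> \<le> 2 * (V * V powr (e/2)) + (\<Sum>k\<in>I. \<integral>\<omega>. cmod (Y k \<omega>) powr (2 + e) \<partial>M)"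
    using V by (intro add_right_mono mult_left_mono mult_right_mono) auto
  finally show ?thesis using V(2) by (simp add: S_def powr_add)
qed

end

section \<open>Gaussian integrals\<close>

abbreviation (input) "Phi \<equiv> cdf std_normal_distribution"

section \<open>Exponential tilting of the standard Gaussian\<close>

lemma std_normal_density_shift:
  "std_normal_density (x + t) * exp (t * (x + t)) = exp (t\<^sup>2 / 2) * std_normal_density x"
proof -
  have "- (x + t)\<^sup>2 / 2 + t * (x + t) = t\<^sup>2 / 2 + - x\<^sup>2 / 2"
    by (simp add: power2_eq_square field_simps)
  then show ?thesis
    unfolding std_normal_density_def by (simp add: mult_exp_exp[symmetric] exp_add[symmetric])
qed

text \<open>The Cameron-Martin shift in one dimension: completing the square turns the weight exp(t
  x) into a translation by t. Values in a Banach space let the same identity cover real indicators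
  and complex oscillating integrands.\<close>

lemma
  fixes h :: "real \<Rightarrow> 'b::{banach, second_countable_topology}"
  assumes [measurable]: "h \<in> borel_measurable borel"
  shows integral_std_normal_tilt:
      "(\<integral>x. exp (t * x) *\<^sub>R h x \<partial>std_normal_distribution) = exp (t\<^sup>2 / 2) *\<^sub>R (\<integral>x. h (x + t) \<partial>std_normal_distribution)"
    and integrable_std_normal_tilt:
      "integrable std_normal_distribution (\<lambda>x. exp (t * x) *\<^sub>R h x) \<longleftrightarrow> integrable std_normal_distribution (\<lambda>x. h (x + t))"
proof -
  have *: "std_normal_density (t + 1 * x) *\<^sub>R (exp (t * (t + 1 * x)) *\<^sub>R h (t + 1 * x))
    = exp (t\<^sup>2 / 2) *\<^sub>R (std_normal_density x *\<^sub>R h (x + t))" for x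
    using std_normal_density_shift[of x t] by (simp add: add.commute)
  have "(\<integral>x. exp (t * x) *\<^sub>R h x \<partial>std_normal_distribution)
      = (\<integral>x. std_normal_density x *\<^sub>R (exp (t * x) *\<^sub>R h x) \<partial>lborel)"
    by (subst integral_density) auto
  also have "\<dots> = (\<integral>x. exp (t\<^sup>2 / 2) *\<^sub>R (std_normal_density x *\<^sub>R h (x + t)) \<partial>lborel)"
    by (subst lborel_integral_real_affine[where c=1 and t=t], simp) (simp only: * abs_one scaleR_one)
  also have "\<dots> = exp (t\<^sup>2 / 2) *\<^sub>R (\<integral>x. std_normal_density x *\<^sub>R h (x + t) \<partial>lborel)"
    by (rule integral_scaleR_right)
  also have "(\<integral>x. std_normal_density x *\<^sub>R h (x + t) \<partial>lborel) = (\<integral>x. h (x + t) \<partial>std_normal_distribution)"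
    by (subst integral_density) auto
  finally show "(\<integral>x. exp (t * x) *\<^sub>R h x \<partial>std_normal_distribution) = exp (t\<^sup>2 / 2) *\<^sub>R (\<integral>x. h (x + t) \<partial>std_normal_distribution)" .
  have "integrable std_normal_distribution (\<lambda>x. exp (t * x) *\<^sub>R h x)
      \<longleftrightarrow> integrable lborel (\<lambda>x. std_normal_density x *\<^sub>R (exp (t * x) *\<^sub>R h x))"
    by (subst integrable_density) auto
  also have "\<dots> \<longleftrightarrow> integrable lborel (\<lambda>x. exp (t\<^sup>2 / 2) *\<^sub>R (std_normal_density x *\<^sub>R h (x + t)))"
    by (subst lborel_integrable_real_affine_iff[symmetric, where c=1 and t=t], simp) (simp only: *)
  also have "\<dots> \<longleftrightarrow> integrable lborel (\<lambda>x. std_normal_density x *\<^sub>R h (x + t))"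
    using integrable_scaleR_right[of "exp (t\<^sup>2 / 2)" lborel "\<lambda>x. std_normal_density x *\<^sub>R h (x + t)"]
      integrable_scaleR_right[of "1 / exp (t\<^sup>2 / 2)" lborel "\<lambda>x. exp (t\<^sup>2 / 2) *\<^sub>R (std_normal_density x *\<^sub>R h (x + t))"]
    by (simp only: scaleR_scaleR) (auto simp del: integrable_scaleR_right)
  also have "\<dots> \<longleftrightarrow> integrable std_normal_distribution (\<lambda>x. h (x + t))"
    by (subst integrable_density) auto
  finally show "integrable std_normal_distribution (\<lambda>x. exp (t * x) *\<^sub>R h x) \<longleftrightarrow> integrable std_normal_distribution (\<lambda>x. h (x + t))" .
qed

lemma prob_space_std_normal: "prob_space std_normal_distribution"
  by (rule prob_space_normal_density) simp

lemma integrable_std_normal_exp: "integrable std_normal_distribution (\<lambda>x. exp (t * x))"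
  and integral_std_normal_exp: "(\<integral>x. exp (t * x) \<partial>std_normal_distribution) = exp (t\<^sup>2 / 2)"
proof -
  interpret prob_space std_normal_distribution by (rule prob_space_std_normal)
  show "integrable std_normal_distribution (\<lambda>x. exp (t * x))"
    using integrable_std_normal_tilt[of "\<lambda>_. 1 :: real" t] by simp
  show "(\<integral>x. exp (t * x) \<partial>std_normal_distribution) = exp (t\<^sup>2 / 2)"
    using integral_std_normal_tilt[of "\<lambda>_. 1 :: real" t] prob_space by simp
qed

lemma integral_std_normal_exp_atMost:
  "(\<integral>x. exp (t * x) * indicator {..b} x \<partial>std_normal_distribution) = exp (t\<^sup>2 / 2) * Phi (b - t)"
proof -
  interpret prob_space std_normal_distribution by (rule prob_space_std_normal)
  have "(\<lambda>x. indicator {..b} (x + t) :: real) = indicator {..b - t}"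
    by (auto simp: indicator_def fun_eq_iff)
  then show ?thesis
    using integral_std_normal_tilt[of "indicator {..b} :: real \<Rightarrow> real" t] by (simp add: cdf_def)
qed

lemma integral_std_normal_exp_greaterThan:
  "(\<integral>x. exp (t * x) * indicator {b<..} x \<partial>std_normal_distribution) = exp (t\<^sup>2 / 2) * measure std_normal_distribution {b - t<..}"
proof -
  interpret prob_space std_normal_distribution by (rule prob_space_std_normal)
  have "(\<lambda>x. indicator {b<..} (x + t) :: real) = indicator {b - t<..}"
    by (auto simp: indicator_def fun_eq_iff)
  then show ?thesis
    using integral_std_normal_tilt[of "indicator {b<..} :: real \<Rightarrow> real" t] by simp
qed

section \<open>Tail and oscillation bounds for the standard Gaussian\<close>

lemma std_normal_density_le: "std_normal_density x \<le> exp (- x\<^sup>2 / 2)"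
proof -
  have "1 \<le> sqrt (2 * pi)" using pi_gt3 by simp
  then have "1 / sqrt (2 * pi) \<le> 1" by simp
  then show ?thesis unfolding std_normal_density_def
    by (metis exp_ge_zero mult_left_le_one_le mult.commute mult_right_mono mult_1)
qed

lemma std_normal_density_deriv:
  "(std_normal_density has_real_derivative - x * std_normal_density x) (at x)"
  unfolding std_normal_density_def
  by (auto intro!: derivative_eq_intros simp: field_simps)

lemma std_normal_density_tendsto_0:
  "(std_normal_density \<longlongrightarrow> 0) at_top" "(std_normal_density \<longlongrightarrow> 0) at_bot"
proof -
  have t: "filterlim (\<lambda>x::real. - x\<^sup>2 / 2) at_bot at_top" "filterlim (\<lambda>x::real. - x\<^sup>2 / 2) at_bot at_bot"
    by real_asymp+
  have e: "((\<lambda>x::real. exp (- x\<^sup>2 / 2)) \<longlongrightarrow> 0) at_top" "((\<lambda>x::real. exp (- x\<^sup>2 / 2)) \<longlongrightarrow> 0) at_bot"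
    using filterlim_compose[OF exp_at_bot t(1)] filterlim_compose[OF exp_at_bot t(2)] by auto
  show "(std_normal_density \<longlongrightarrow> 0) at_top"
    by (rule tendsto_sandwich[OF _ _ tendsto_const e(1)]) (intro always_eventually allI normal_density_nonneg std_normal_density_le)+
  show "(std_normal_density \<longlongrightarrow> 0) at_bot"
    by (rule tendsto_sandwich[OF _ _ tendsto_const e(2)]) (intro always_eventually allI normal_density_nonneg std_normal_density_le)+
qed

text \<open>The classical bound on the Mills ratio: beyond x the factor y / x is at least 1, and y
  times the density has minus the density as antiderivative.\<close>

lemma std_normal_tail_le:
  assumes "x > 0"
  shows "measure std_normal_distribution {x<..} \<le> exp (- x\<^sup>2 / 2) / x"
proof -
  interpret prob_space std_normal_distribution by (rule prob_space_std_normal)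
  have "emeasure std_normal_distribution {x<..} = (\<integral>\<^sup>+y. ennreal (std_normal_density y) * indicator {x<..} y \<partial>lborel)"
    by (subst emeasure_density) auto
  also have "\<dots> \<le> (\<integral>\<^sup>+y. ennreal (y * std_normal_density y / x) * indicator {x..} y \<partial>lborel)"
  proof (intro nn_integral_mono)
    fix y
    have "std_normal_density y \<le> y * std_normal_density y / x" if "x < y"
    proof -
      have "x * std_normal_density y \<le> y * std_normal_density y" using that by (intro mult_right_mono) auto
      then show ?thesis using assms by (simp add: field_simps)
    qed
    then show "ennreal (std_normal_density y) * indicator {x<..} y \<le> ennreal (y * std_normal_density y / x) * indicator {x..} y"
      by (auto simp: indicator_def intro!: ennreal_leI)
  qed
  also have "\<dots> = ennreal (0 - (- std_normal_density x / x))"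
  proof (rule nn_integral_FTC_atLeast[where F="\<lambda>y. - std_normal_density y / x"])
    show "((\<lambda>x'. - std_normal_density x' / x) \<longlongrightarrow> 0) at_top"
      using assms by (auto intro!: tendsto_eq_intros std_normal_density_tendsto_0(1))
    show "((\<lambda>x'. - std_normal_density x' / x) has_real_derivative y * std_normal_density y / x) (at y)" for y
      using DERIV_cdivide[OF DERIV_minus[OF std_normal_density_deriv[of y]], of x] by simp
  qed (use assms in auto)
  finally have "measure std_normal_distribution {x<..} \<le> std_normal_density x / x"
    using assms by (simp add: emeasure_eq_measure)
  also have "\<dots> \<le> exp (- x\<^sup>2 / 2) / x"
    using assms std_normal_density_le by (intro divide_right_mono) auto
  finally show ?thesis .
qed

text \<open>One integration by parts gains the factor 1 / |r|, uniformly in the cut-off b. The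
  boundary term is a value of the density and the remaining integral is at most E|x| = sqrt(2 / pi);
  both are at most 1.\<close>

lemma norm_integral_iexp_atMost_le:
  assumes "r \<noteq> 0"
  shows "cmod (\<integral>x. iexp (r * x) * indicator {..b} x \<partial>std_normal_distribution) \<le> 2 / \<bar>r\<bar>"
proof -
  \<comment> \<open>The derivative of \<open>F\<close> is \<open>f1 + f2\<close>: \<open>f2\<close>
    contains the wanted integrand with the factor i r, while the modulus of \<open>f1\<close> does
    not depend on r.\<close>
  define F where "F x = std_normal_density x *\<^sub>R iexp (r * x)" for x
  define f1 where "f1 x = (- x * std_normal_density x) *\<^sub>R iexp (r * x)" for x
  define f2 where "f2 x = std_normal_density x *\<^sub>R (\<i> * of_real r * iexp (r * x))" for x
  have mf[measurable]: "(\<lambda>x. iexp (r * x)) \<in> borel_measurable borel"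
    by (intro borel_measurable_continuous_onI continuous_intros)
  have i0: "integrable lborel (\<lambda>x. \<bar>x\<bar> * std_normal_density x)"
    using integrable_std_normal_moment_abs[of 1] by (simp add: mult.commute)
  have [measurable]: "f1 \<in> borel_measurable borel" "f2 \<in> borel_measurable borel"
    unfolding f1_def f2_def by measurable
  have i1: "integrable lborel f1"
    by (rule Bochner_Integration.integrable_bound[OF i0]) (auto simp: f1_def abs_mult)
  have i2: "integrable lborel f2"
    by (rule Bochner_Integration.integrable_bound[where f="\<lambda>x. r * std_normal_density x"])
      (auto simp: f2_def norm_mult abs_mult)
  have D: "(F has_vector_derivative f1 x + f2 x) (at x)" for x
  proof -
    have 1: "((\<lambda>x. iexp (r * x)) has_vector_derivative \<i> * of_real r * iexp (r * x)) (at x)"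
      by (auto intro!: derivative_eq_intros simp: has_vector_derivative_complex_iff Re_exp Im_exp)
    show ?thesis
      using has_vector_derivative_scaleR[OF std_normal_density_deriv 1]
      unfolding F_def f1_def f2_def by (simp add: add.commute)
  qed
  have cont: "isCont (\<lambda>x. f1 x + f2 x) x" for x
    unfolding f1_def f2_def std_normal_density_def by (intro continuous_intros) auto
  have "(LBINT x=-\<infinity>..ereal b. f1 x + f2 x) = F b - 0"
  proof (rule interval_integral_FTC_integrable[OF _ D cont])
    show "set_integrable lborel (einterval (- \<infinity>) (ereal b)) (\<lambda>x. f1 x + f2 x)"
      unfolding set_integrable_def using i1 i2 by (intro integrable_mult_indicator) auto
    have "(F \<longlongrightarrow> 0) at_bot"
      by (rule tendsto_norm_zero_cancel) (simp add: F_def std_normal_density_tendsto_0)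
    then show "((F \<circ> real_of_ereal) \<longlongrightarrow> 0) (at_right (- \<infinity>))"
      by (simp add: ereal_tendsto_simps)
    have "isCont F b" using D has_vector_derivative_continuous by blast
    then have "(F \<longlongrightarrow> F b) (at_left b)" by (simp add: isCont_def filterlim_at_split)
    then show "((F \<circ> real_of_ereal) \<longlongrightarrow> F b) (at_left (ereal b))"
      by (simp add: ereal_tendsto_simps)
  qed simp
  moreover have "(LBINT x=-\<infinity>..ereal b. f1 x + f2 x) = (\<integral>x. indicator {..b} x *\<^sub>R (f1 x + f2 x) \<partial>lborel)"
  proof -
    have "(LBINT x=-\<infinity>..ereal b. f1 x + f2 x) = (LBINT x:{..<b}. f1 x + f2 x)"
      by (simp add: interval_lebesgue_integral_def einterval_def lessThan_def)
    \<comment> \<open>The interval integral runs over the open half-line; its endpoint is a null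
      set.\<close>
    also have "\<dots> = (LBINT x:{..b}. f1 x + f2 x)"
      using AE_lborel_singleton[of b] i1 i2 unfolding set_lebesgue_integral_def
      by (intro integral_cong_AE) (auto simp: indicator_def elim!: eventually_mono)
    finally show ?thesis by (simp add: set_lebesgue_integral_def)
  qed
  moreover have "\<dots> = (\<integral>x. indicator {..b} x *\<^sub>R f1 x \<partial>lborel) + (\<integral>x. indicator {..b} x *\<^sub>R f2 x \<partial>lborel)"
    unfolding scaleR_add_right using i1 i2 by (intro Bochner_Integration.integral_add integrable_mult_indicator) auto
  moreover have "(\<integral>x. indicator {..b} x *\<^sub>R f2 x \<partial>lborel) = \<i> * of_real r * (\<integral>x. iexp (r * x) * indicator {..b} x \<partial>std_normal_distribution)"
  proof -
    have "indicator {..b} x *\<^sub>R f2 x = \<i> * of_real r * (std_normal_density x *\<^sub>R (iexp (r * x) * indicator {..b} x))" for x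
      by (simp add: f2_def indicator_def)
    then have "(\<integral>x. indicator {..b} x *\<^sub>R f2 x \<partial>lborel)
        = \<i> * of_real r * (\<integral>x. std_normal_density x *\<^sub>R (iexp (r * x) * indicator {..b} x) \<partial>lborel)"
      by (simp only: integral_mult_right_zero)
    also have "(\<integral>x. std_normal_density x *\<^sub>R (iexp (r * x) * indicator {..b} x) \<partial>lborel)
        = (\<integral>x. iexp (r * x) * indicator {..b} x \<partial>std_normal_distribution)"
      by (rule integral_density[symmetric]) auto
    finally show ?thesis .
  qed
  ultimately have "\<i> * of_real r * (\<integral>x. iexp (r * x) * indicator {..b} x \<partial>std_normal_distribution)
      = F b - (\<integral>x. indicator {..b} x *\<^sub>R f1 x \<partial>lborel)"
    by (simp add: algebra_simps)
  from arg_cong[OF this, of cmod]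
  have "\<bar>r\<bar> * cmod (\<integral>x. iexp (r * x) * indicator {..b} x \<partial>std_normal_distribution)
      = cmod (F b - (\<integral>x. indicator {..b} x *\<^sub>R f1 x \<partial>lborel))"
    by (simp only: norm_mult norm_ii norm_of_real mult_1)
  also have "\<dots> \<le> cmod (F b) + cmod (\<integral>x. indicator {..b} x *\<^sub>R f1 x \<partial>lborel)"
    by (rule norm_triangle_ineq4)
  also have "cmod (F b) \<le> 1"
  proof -
    have "cmod (F b) = std_normal_density b" by (simp add: F_def)
    also have "\<dots> \<le> exp (- b\<^sup>2 / 2)" by (rule std_normal_density_le)
    also have "\<dots> \<le> 1" by simp
    finally show ?thesis .
  qed
  also have "cmod (\<integral>x. indicator {..b} x *\<^sub>R f1 x \<partial>lborel) \<le> (\<integral>x. \<bar>x\<bar> * std_normal_density x \<partial>lborel)"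
  proof -
    have "cmod (\<integral>x. indicator {..b} x *\<^sub>R f1 x \<partial>lborel) \<le> (\<integral>x. cmod (indicator {..b} x *\<^sub>R f1 x) \<partial>lborel)"
      by (rule integral_norm_bound)
    also have "\<dots> \<le> (\<integral>x. \<bar>x\<bar> * std_normal_density x \<partial>lborel)"
      by (intro integral_mono i0 integrable_norm integrable_mult_indicator i1)
        (auto simp: f1_def indicator_def abs_mult)
    finally show ?thesis .
  qed
  also have "(\<integral>x. \<bar>x\<bar> * std_normal_density x \<partial>lborel) \<le> 1"
  proof -
    have "(\<integral>x. \<bar>x\<bar> * std_normal_density x \<partial>lborel) = sqrt (2 / pi)"
      using integral_std_normal_moment_abs_odd[of 0] by (simp add: mult.commute)
    then show ?thesis using pi_gt3 by simp
  qed
  finally have "\<bar>r\<bar> * cmod (\<integral>x. iexp (r * x) * indicator {..b} x \<partial>std_normal_distribution) \<le> 2"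
    by simp
  then show ?thesis using assms by (simp add: pos_le_divide_eq mult.commute)
qed

text \<open>The standard Gaussian has no atoms.\<close>

lemma isCont_Phi: "isCont Phi x"
proof -
  interpret real_distribution std_normal_distribution by (rule real_dist_normal_dist)
  have "emeasure std_normal_distribution {x} = 0"
    by (subst emeasure_density) (auto simp: nn_integral_indicator_singleton)
  then show ?thesis by (simp add: isCont_cdf measure_def)
qed

text \<open>The density is positive everywhere, so a null half-line would be Lebesgue null.
  Positivity makes the limit laws with variance \<Phi>(u) genuine Gaussians.\<close>

lemma Phi_pos: "Phi x > 0"
proof -
  interpret real_distribution std_normal_distribution by (rule real_dist_normal_dist)
  have "emeasure std_normal_distribution {..x} \<noteq> 0"
  proof
    assume "emeasure std_normal_distribution {..x} = 0"
    then have "{..x} \<in> null_sets std_normal_distribution" by auto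
    then have "AE y in lborel. y \<in> {..x} \<longrightarrow> ennreal (std_normal_density y) = 0"
      by (subst (asm) null_sets_density_iff) auto
    then have "AE y in lborel. y \<notin> {..x}"
      by eventually_elim (metis ennreal_eq_0_iff normal_density_pos not_le zero_less_one)
    then have "{..x} \<in> null_sets lborel" by (simp add: AE_iff_null_sets)
    then have "{x - 1..x} \<in> null_sets lborel" by (rule null_sets_subset) auto
    then show False by (auto simp: null_sets_def)
  qed
  then have "measure std_normal_distribution {..x} \<noteq> 0"
    by (simp only: emeasure_eq_measure) simp
  then show ?thesis unfolding cdf_def using measure_nonneg[of std_normal_distribution "{..x}"] by linarith
qed

section \<open>From characteristic functions to convergence in distribution\<close>

text \<open>Bounded second moments give tightness by Chebyshev's inequality; the rest is
  \<open>levy_continuity_complex\<close>. The bound C need not be the second moment of the limit,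
  and in the application it is larger.\<close>

lemma converges_in_distribution_complexI:
  fixes M :: "nat \<Rightarrow> 'a measure" and Z :: "nat \<Rightarrow> 'a \<Rightarrow> complex"
  assumes M: "\<And>n. prob_space (M n)" and Z: "\<And>n. Z n \<in> borel_measurable (M n)"
    and int: "\<And>n. integrable (M n) (\<lambda>\<omega>. (cmod (Z n \<omega>))\<^sup>2)"
    and le: "\<And>n. (\<integral>\<omega>. (cmod (Z n \<omega>))\<^sup>2 \<partial>M n) \<le> C"
    and \<mu>: "prob_space \<mu>" "sets \<mu> = sets borel"
    and char: "\<And>\<theta>. (\<lambda>n. \<integral>\<omega>. exp (\<i> * of_real (\<theta> \<bullet> Z n \<omega>)) \<partial>M n) \<longlonglongrightarrow> (\<integral>z. exp (\<i> * of_real (\<theta> \<bullet> z)) \<partial>\<mu>)"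
  shows "converges_in_distribution M Z \<mu>"
  unfolding converges_in_distribution_def
proof (intro allI impI)
  fix f :: "complex \<Rightarrow> real" assume f: "continuous_on UNIV f" "bounded (range f)"
  let ?\<nu> = "\<lambda>n. distr (M n) borel (Z n)"
  show "(\<lambda>n. \<integral>z. f z \<partial>?\<nu> n) \<longlonglongrightarrow> (\<integral>z. f z \<partial>\<mu>)"
  proof (rule levy_continuity_complex[OF _ _ \<mu> _ _ f])
    show "prob_space (?\<nu> n)" for n by (rule prob_space.prob_space_distr[OF M Z])
    show "sets (?\<nu> n) = sets borel" for n by simp
    fix \<theta> :: complex
    have "(\<lambda>z. exp (\<i> * complex_of_real (\<theta> \<bullet> z))) \<in> borel_measurable borel"
      by (intro borel_measurable_continuous_onI continuous_intros)
    then have "(\<integral>z. exp (\<i> * of_real (\<theta> \<bullet> z)) \<partial>?\<nu> n) = (\<integral>\<omega>. exp (\<i> * of_real (\<theta> \<bullet> Z n \<omega>)) \<partial>M n)" for n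
      using Z by (intro integral_distr) auto
    then show "(\<lambda>n. \<integral>z. exp (\<i> * of_real (\<theta> \<bullet> z)) \<partial>?\<nu> n) \<longlonglongrightarrow> (\<integral>z. exp (\<i> * of_real (\<theta> \<bullet> z)) \<partial>\<mu>)"
      using char by simp
  next
    fix \<delta> :: real assume \<delta>: "\<delta> > 0"
    \<comment> \<open>Chosen for Chebyshev's inequality, so that C / R^2 \<le> \<delta>. The maximum
      with 1 keeps \<open>R\<close> positive even if C = 0.\<close>
    define R where "R = sqrt (max 1 (C / \<delta>))"
    have R: "R > 0" "C \<le> R\<^sup>2 * \<delta>" using \<delta> by (auto simp: R_def field_simps max_def)
    have "measure (?\<nu> n) {z. R < cmod z} \<le> \<delta>" for n
    proof -
      interpret prob_space "M n" by (rule M)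
      have [measurable]: "Z n \<in> borel_measurable (M n)" by (rule Z)
      have "measure (?\<nu> n) {z. R < cmod z} = measure (M n) {\<omega> \<in> space (M n). R < cmod (Z n \<omega>)}"
        by (subst measure_distr) (auto simp: vimage_def intro!: arg_cong2[where f=measure])
      also have "\<dots> \<le> measure (M n) {\<omega> \<in> space (M n). R\<^sup>2 \<le> (cmod (Z n \<omega>))\<^sup>2}"
        using R by (intro finite_measure_mono) (auto intro!: power_mono)
      also have "\<dots> \<le> (\<integral>\<omega>. (cmod (Z n \<omega>))\<^sup>2 \<partial>M n) / R\<^sup>2"
        using R by (intro integral_Markov_inequality_measure[where A="{}"] int) auto
      also have "\<dots> \<le> (R\<^sup>2 * \<delta>) / R\<^sup>2" using le[of n] R by (intro divide_right_mono) auto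
      finally show ?thesis using R by simp
    qed
    then show "\<exists>R. \<forall>n. measure (?\<nu> n) {z. R < cmod z} \<le> \<delta>" by blast
  qed
qed

section \<open>Characteristic functions of the limit laws\<close>

lemma integral_gaussian_real:
  fixes h :: "real \<Rightarrow> 'b::{banach, second_countable_topology}"
  assumes v: "v > 0" and [measurable]: "h \<in> borel_measurable borel"
  shows "(\<integral>x. h x \<partial>gaussian_real v) = (\<integral>x. h (sqrt v * x) \<partial>std_normal_distribution)"
proof -
  have *: "normal_density 0 (sqrt v) (0 + sqrt v * x) = std_normal_density x / sqrt v" for x
    using v by (simp add: normal_density_def power_mult_distrib real_sqrt_mult)
  have "(\<integral>x. h x \<partial>gaussian_real v) = (\<integral>x. normal_density 0 (sqrt v) x *\<^sub>R h x \<partial>lborel)"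
    unfolding gaussian_real_def by (rule integral_density) auto
  also have "\<dots> = sqrt v *\<^sub>R (\<integral>x. normal_density 0 (sqrt v) (0 + sqrt v * x) *\<^sub>R h (0 + sqrt v * x) \<partial>lborel)"
    using v by (subst lborel_integral_real_affine[where c="sqrt v" and t=0]) auto
  also have "\<dots> = (\<integral>x. sqrt v *\<^sub>R (normal_density 0 (sqrt v) (0 + sqrt v * x) *\<^sub>R h (0 + sqrt v * x)) \<partial>lborel)"
    by (rule integral_scaleR_right[symmetric])
  also have "\<dots> = (\<integral>x. std_normal_density x *\<^sub>R h (sqrt v * x) \<partial>lborel)"
    unfolding * using v by simp
  also have "\<dots> = (\<integral>x. h (sqrt v * x) \<partial>std_normal_distribution)"
    by (rule integral_density[symmetric]) auto
  finally show ?thesis .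
qed

lemma prob_space_gaussian_real: "v > 0 \<Longrightarrow> prob_space (gaussian_real v)"
  unfolding gaussian_real_def by (rule prob_space_normal_density) simp

lemma sets_gaussian_real[simp, measurable_cong]: "sets (gaussian_real v) = sets borel"
  by (simp add: gaussian_real_def)

lemma char_gaussian_real:
  assumes "v > 0"
  shows "(\<integral>x. iexp (t * x) \<partial>gaussian_real v) = of_real (exp (- v * t\<^sup>2 / 2))"
proof -
  have "(\<lambda>x. iexp (t * x)) \<in> borel_measurable borel"
    by (intro borel_measurable_continuous_onI continuous_intros)
  from integral_gaussian_real[OF assms this]
  have "(\<integral>x. iexp (t * x) \<partial>gaussian_real v) = char std_normal_distribution (t * sqrt v)"
    by (simp add: char_def mult.assoc)
  also have "\<dots> = of_real (exp (- v * t\<^sup>2 / 2))"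
    using assms by (simp add: char_std_normal_distribution power_mult_distrib mult.commute)
  finally show ?thesis .
qed

lemma
  assumes "v > 0"
  shows prob_space_gaussian_real_in_complex: "prob_space (gaussian_real_in_complex v)"
    and char_gaussian_real_in_complex:
      "(\<integral>z. exp (\<i> * of_real (\<theta> \<bullet> z)) \<partial>gaussian_real_in_complex v) = of_real (exp (- v * (Re \<theta>)\<^sup>2 / 2))"
proof -
  interpret prob_space "gaussian_real v" by (rule prob_space_gaussian_real[OF assms])
  show "prob_space (gaussian_real_in_complex v)"
    unfolding gaussian_real_in_complex_def by (rule prob_space_distr) measurable
  have "(\<lambda>z. exp (\<i> * complex_of_real (\<theta> \<bullet> z))) \<in> borel_measurable borel"
    by (intro borel_measurable_continuous_onI continuous_intros)
  then have "(\<integral>z. exp (\<i> * of_real (\<theta> \<bullet> z)) \<partial>gaussian_real_in_complex v)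
      = (\<integral>x. iexp (Re \<theta> * x) \<partial>gaussian_real v)"
    unfolding gaussian_real_in_complex_def by (subst integral_distr) (auto simp: inner_complex_def)
  then show "(\<integral>z. exp (\<i> * of_real (\<theta> \<bullet> z)) \<partial>gaussian_real_in_complex v) = of_real (exp (- v * (Re \<theta>)\<^sup>2 / 2))"
    using char_gaussian_real[OF assms] by simp
qed

text \<open>Each coordinate has variance v / 2, which turns the factor 1/2 of the real case into
  1/4.\<close>

lemma
  assumes "v > 0"
  shows prob_space_gaussian_complex: "prob_space (gaussian_complex v)"
    and char_gaussian_complex:
      "(\<integral>z. exp (\<i> * of_real (\<theta> \<bullet> z)) \<partial>gaussian_complex v) = of_real (exp (- v * (cmod \<theta>)\<^sup>2 / 4))"
proof -
  let ?G = "gaussian_real (v / 2)"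
  interpret G: prob_space ?G by (rule prob_space_gaussian_real) (use assms in simp)
  interpret pair_prob_space ?G ?G ..
  have eq: "(\<lambda>(x, y). Complex x y) = (\<lambda>p. of_real (fst p) + \<i> * of_real (snd p))"
    by (auto simp: Complex_eq)
  have [measurable]: "(\<lambda>(x, y). Complex x y) \<in> borel_measurable (?G \<Otimes>\<^sub>M ?G)"
    unfolding eq by measurable
  show "prob_space (gaussian_complex v)"
    unfolding gaussian_complex_def by (rule prob_space_distr) measurable
  have [measurable]: "(\<lambda>x. iexp (t * x)) \<in> borel_measurable borel" for t
    by (intro borel_measurable_continuous_onI continuous_intros)
  have [measurable]: "(\<lambda>z. exp (\<i> * complex_of_real (\<theta> \<bullet> z))) \<in> borel_measurable borel"
    by (intro borel_measurable_continuous_onI continuous_intros)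
  have i: "integrable ?G (\<lambda>x. iexp (t * x))" for t
    by (intro G.integrable_const_bound[where B=1]) auto
  have "(\<integral>z. exp (\<i> * of_real (\<theta> \<bullet> z)) \<partial>gaussian_complex v)
      = (\<integral>p. iexp (Re \<theta> * fst p) * iexp (Im \<theta> * snd p) \<partial>(?G \<Otimes>\<^sub>M ?G))"
    unfolding gaussian_complex_def
    by (subst integral_distr) (auto simp: inner_complex_def exp_add[symmetric] algebra_simps intro!: Bochner_Integration.integral_cong)
  also have "\<dots> = (\<integral>x. \<integral>y. iexp (Re \<theta> * x) * iexp (Im \<theta> * y) \<partial>?G \<partial>?G)"
  proof -
    have "integrable (?G \<Otimes>\<^sub>M ?G) (\<lambda>p. iexp (Re \<theta> * fst p) * iexp (Im \<theta> * snd p))"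
      by (intro P.integrable_const_bound[where B=1]) (auto simp: norm_mult)
    from integral_fst'[OF this] show ?thesis by simp
  qed
  also have "\<dots> = (\<integral>x. iexp (Re \<theta> * x) \<partial>?G) * (\<integral>y. iexp (Im \<theta> * y) \<partial>?G)"
    by simp
  also have "\<dots> = of_real (exp (- (v/2) * (Re \<theta>)\<^sup>2 / 2)) * of_real (exp (- (v/2) * (Im \<theta>)\<^sup>2 / 2))"
    using assms by (simp only: char_gaussian_real half_gt_zero)
  also have "\<dots> = of_real (exp (- v * (cmod \<theta>)\<^sup>2 / 4))"
    by (simp add: cmod_power2 exp_add[symmetric] field_simps flip: of_real_mult)
  finally show "(\<integral>z. exp (\<i> * of_real (\<theta> \<bullet> z)) \<partial>gaussian_complex v) = of_real (exp (- v * (cmod \<theta>)\<^sup>2 / 4))" .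
qed

lemma sets_gaussian_complex[simp]: "sets (gaussian_complex v) = sets borel"
  by (simp add: gaussian_complex_def)

lemma sets_gaussian_real_in_complex[simp]: "sets (gaussian_real_in_complex v) = sets borel"
  by (simp add: gaussian_real_in_complex_def)

section \<open>Gaussian weighted sums\<close>

text \<open>The common shape of one branching step, used at the inner nodes as well as at the root.
  Independence enters twice, between the pairs and inside each pair. Both members of
  \<open>indep_var\<close> share one value type, hence the coercion of \<xi>. The bound on the p-th
  moments is normalised by the second moment, so C is invariant under rescaling of W and can be
  uniform in n.\<close>

locale gaussian_weighted_sum = prob_space +
  fixes I :: "'i set" and \<xi> :: "'i \<Rightarrow> 'a \<Rightarrow> real" and W :: "'i \<Rightarrow> 'a \<Rightarrow> complex"
    and s r p C m2 :: real
  assumes finite_I: "finite I" and I_nonempty: "I \<noteq> {}"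
    and indep_pairs: "indep_vars (\<lambda>_. borel) (\<lambda>k \<omega>. (\<xi> k \<omega>, W k \<omega>)) I"
    and indep_pair: "\<And>k. k \<in> I \<Longrightarrow> indep_var borel (\<lambda>\<omega>. complex_of_real (\<xi> k \<omega>)) borel (W k)"
    and distr_\<xi>: "\<And>k. k \<in> I \<Longrightarrow> distr M borel (\<xi> k) = std_normal_distribution"
    and p: "2 < p" "p \<le> 3"
    and moment_W: "\<And>k. k \<in> I \<Longrightarrow> has_moment p (W k)"
    and square_W: "\<And>k. k \<in> I \<Longrightarrow> (\<integral>\<omega>. (cmod (W k \<omega>))\<^sup>2 \<partial>M) = m2"
    and m2_pos: "m2 > 0"
    and powr_W: "\<And>k. k \<in> I \<Longrightarrow> (\<integral>\<omega>. cmod (W k \<omega>) powr p \<partial>M) \<le> C * m2 powr (p / 2)"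
begin

definition Y :: "'i \<Rightarrow> 'a \<Rightarrow> complex" where
  "Y k \<omega> = exp (Complex s r * of_real (\<xi> k \<omega>)) * W k \<omega>"

definition S :: "'a \<Rightarrow> complex" where
  "S \<omega> = (\<Sum>k\<in>I. Y k \<omega>)"

definition \<kappa> :: complex where
  "\<kappa> = (\<integral>x. exp (Complex s r * of_real x) \<partial>std_normal_distribution)"

lemma card_I: "real (card I) \<ge> 1"
  using finite_I I_nonempty by (simp add: Suc_leI card_gt_0_iff)

lemma \<xi>_measurable:
  assumes "k \<in> I"
  shows "\<xi> k \<in> borel_measurable M"
proof -
  have "(\<lambda>\<omega>. Re (complex_of_real (\<xi> k \<omega>))) \<in> borel_measurable M"
    using indep_var_rv1[OF indep_pair[OF assms]] borel_measurable_Re by (rule measurable_compose)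
  then show ?thesis by simp
qed

lemma W_measurable: "k \<in> I \<Longrightarrow> W k \<in> borel_measurable M"
  using moment_W by auto

lemma C_nonneg: "C \<ge> 0"
proof -
  obtain k where k: "k \<in> I" using I_nonempty by auto
  have "0 \<le> (\<integral>\<omega>. cmod (W k \<omega>) powr p \<partial>M)" by simp
  also have "\<dots> \<le> C * m2 powr (p / 2)" by (rule powr_W[OF k])
  finally show ?thesis using m2_pos by (simp add: zero_le_mult_iff)
qed

lemma
  fixes g :: "real \<Rightarrow> 'b::{real_normed_field, banach, second_countable_topology}" and f :: "complex \<Rightarrow> 'b"
  assumes k: "k \<in> I" and [measurable]: "g \<in> borel_measurable borel" "f \<in> borel_measurable borel"
    and g: "integrable std_normal_distribution g" and f: "integrable M (\<lambda>\<omega>. f (W k \<omega>))"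
  shows integrable_prod: "integrable M (\<lambda>\<omega>. g (\<xi> k \<omega>) * f (W k \<omega>))"
    and integral_prod: "(\<integral>\<omega>. g (\<xi> k \<omega>) * f (W k \<omega>) \<partial>M) = (\<integral>x. g x \<partial>std_normal_distribution) * (\<integral>\<omega>. f (W k \<omega>) \<partial>M)"
proof -
  note [measurable] = \<xi>_measurable[OF k]
  have iv: "indep_var borel (\<lambda>\<omega>. g (\<xi> k \<omega>)) borel (\<lambda>\<omega>. f (W k \<omega>))"
    using indep_var_compose[OF indep_pair[OF k], of "\<lambda>z. g (Re z)" borel f borel] by (simp add: comp_def)
  have gi: "integrable M (\<lambda>\<omega>. g (\<xi> k \<omega>))"
    using g unfolding distr_\<xi>[OF k, symmetric] by (subst (asm) integrable_distr_eq) auto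
  show "integrable M (\<lambda>\<omega>. g (\<xi> k \<omega>) * f (W k \<omega>))" by (rule indep_var_integrable[OF iv gi f])
  have "(\<integral>\<omega>. g (\<xi> k \<omega>) \<partial>M) = (\<integral>x. g x \<partial>std_normal_distribution)"
    unfolding distr_\<xi>[OF k, symmetric] by (subst integral_distr) auto
  then show "(\<integral>\<omega>. g (\<xi> k \<omega>) * f (W k \<omega>) \<partial>M) = (\<integral>x. g x \<partial>std_normal_distribution) * (\<integral>\<omega>. f (W k \<omega>) \<partial>M)"
    using indep_var_lebesgue_integral[OF iv gi f] by simp
qed

lemma norm_exp_real: "cmod (exp (Complex s r * of_real x)) = exp (s * x)"
  by (simp add: norm_exp_eq_Re)

lemma exp_measurable[measurable]: "(\<lambda>x. exp (Complex s r * of_real x)) \<in> borel_measurable borel"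
  by (intro borel_measurable_continuous_onI continuous_intros)

lemma exp_integrable: "integrable std_normal_distribution (\<lambda>x. exp (Complex s r * of_real x))"
  by (rule Bochner_Integration.integrable_bound[OF integrable_std_normal_exp[of s]]) (auto simp: norm_exp_real)

lemma norm_\<kappa>: "cmod \<kappa> \<le> exp (s\<^sup>2 / 2)"
proof -
  have "cmod \<kappa> \<le> (\<integral>x. cmod (exp (Complex s r * of_real x)) \<partial>std_normal_distribution)"
    unfolding \<kappa>_def by (rule integral_norm_bound)
  then show ?thesis by (simp only: norm_exp_real integral_std_normal_exp)
qed

lemma norm_Y: "cmod (Y k \<omega>) = exp (s * \<xi> k \<omega>) * cmod (W k \<omega>)"
  unfolding Y_def norm_mult norm_exp_real ..

lemma Y_measurable: "k \<in> I \<Longrightarrow> Y k \<in> borel_measurable M"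
  unfolding Y_def using \<xi>_measurable W_measurable by measurable

lemma norm_Y_powr: "cmod (Y k \<omega>) powr q = exp (q * s * \<xi> k \<omega>) * cmod (W k \<omega>) powr q"
  by (simp add: norm_Y powr_mult powr_def[of "exp _"] mult_ac)

lemma
  assumes k: "k \<in> I" and q: "0 \<le> q" "q \<le> p"
  shows integrable_Y_powr: "integrable M (\<lambda>\<omega>. cmod (Y k \<omega>) powr q)"
    and integral_Y_powr: "(\<integral>\<omega>. cmod (Y k \<omega>) powr q \<partial>M) = exp (q\<^sup>2 * s\<^sup>2 / 2) * (\<integral>\<omega>. cmod (W k \<omega>) powr q \<partial>M)"
proof -
  have "integrable M (\<lambda>\<omega>. cmod (W k \<omega>) powr q)"
    using has_moment_mono[OF moment_W[OF k] q] by auto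
  note * = integrable_prod[OF k _ _ integrable_std_normal_exp[of "q * s"] this]
    integral_prod[OF k _ _ integrable_std_normal_exp[of "q * s"] this]
  show "integrable M (\<lambda>\<omega>. cmod (Y k \<omega>) powr q)"
    unfolding norm_Y_powr by (rule *) auto
  show "(\<integral>\<omega>. cmod (Y k \<omega>) powr q \<partial>M) = exp (q\<^sup>2 * s\<^sup>2 / 2) * (\<integral>\<omega>. cmod (W k \<omega>) powr q \<partial>M)"
    unfolding norm_Y_powr
    by (subst *) (auto simp: integral_std_normal_exp power_mult_distrib)
qed

lemma moment_Y: "k \<in> I \<Longrightarrow> has_moment p (Y k)"
  unfolding has_moment_def using integrable_Y_powr[of k p] Y_measurable p by auto

lemma moment2_Y: "k \<in> I \<Longrightarrow> has_moment 2 (Y k)"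
  using has_moment_mono[OF moment_Y] p by auto

lemma moment2_W: "k \<in> I \<Longrightarrow> has_moment 2 (W k)"
  using has_moment_mono[OF moment_W] p by auto

lemma integrable_Y: "k \<in> I \<Longrightarrow> integrable M (Y k)"
  using has_moment_integrable[OF moment2_Y] by auto

lemma integrable_W: "k \<in> I \<Longrightarrow> integrable M (W k)"
  using has_moment_integrable[OF moment2_W] by auto

lemma square_Y: "k \<in> I \<Longrightarrow> (\<integral>\<omega>. (cmod (Y k \<omega>))\<^sup>2 \<partial>M) = exp (2 * s\<^sup>2) * m2"
  using integral_Y_powr[of k 2] p square_W by (simp add: power2_eq_square)

lemma expectation_Y: "k \<in> I \<Longrightarrow> (\<integral>\<omega>. Y k \<omega> \<partial>M) = \<kappa> * (\<integral>\<omega>. W k \<omega> \<partial>M)"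
  unfolding Y_def \<kappa>_def
  by (rule integral_prod[of k "\<lambda>x. exp (Complex s r * of_real x)" "\<lambda>w. w"])
    (auto intro: exp_integrable integrable_W)

lemma norm_expectation_square_le:
  assumes "has_moment 2 X"
  shows "(cmod (\<integral>\<omega>. X \<omega> \<partial>M))\<^sup>2 \<le> (\<integral>\<omega>. (cmod (X \<omega>))\<^sup>2 \<partial>M)"
proof -
  have i: "integrable M (\<lambda>\<omega>. (cmod (X \<omega>))\<^sup>2)" "integrable M (\<lambda>\<omega>. cmod (X \<omega>))"
    using has_moment_square[OF assms] has_moment_integrable[OF assms] by auto
  have "cmod (\<integral>\<omega>. X \<omega> \<partial>M) \<le> (\<integral>\<omega>. cmod (X \<omega>) \<partial>M)" by (rule integral_norm_bound)
  then have "(cmod (\<integral>\<omega>. X \<omega> \<partial>M))\<^sup>2 \<le> (\<integral>\<omega>. cmod (X \<omega>) \<partial>M)\<^sup>2" by (intro power_mono) auto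
  also have "\<dots> \<le> (\<integral>\<omega>. (cmod (X \<omega>))\<^sup>2 \<partial>M)"
    using variance_eq[OF i(2,1)] variance_positive[of "\<lambda>\<omega>. cmod (X \<omega>)"] by simp
  finally show ?thesis .
qed

lemma norm_W_le: "k \<in> I \<Longrightarrow> (\<integral>\<omega>. cmod (W k \<omega>) \<partial>M) \<le> sqrt m2"
  using norm_expectation_square_le[OF has_moment_bound[OF moment2_W, of k "\<lambda>\<omega>. of_real (cmod (W k \<omega>))"]]
    square_W W_measurable by (simp add: real_le_rsqrt)

lemma norm_expectation_Y_le:
  assumes "k \<in> I" shows "cmod (\<integral>\<omega>. Y k \<omega> \<partial>M) \<le> exp (s\<^sup>2 / 2) * sqrt m2"
proof -
  have "cmod (\<integral>\<omega>. W k \<omega> \<partial>M) \<le> sqrt m2"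
    by (rule order_trans[OF integral_norm_bound norm_W_le[OF assms]])
  then show ?thesis
    unfolding expectation_Y[OF assms] norm_mult using norm_\<kappa> by (intro mult_mono) auto
qed

lemma indep_Y: "indep_vars (\<lambda>_. borel) Y I"
proof -
  have "(\<lambda>(x, w). exp (Complex s r * of_real x) * w) \<in> borel_measurable (borel :: (real \<times> complex) measure)"
    unfolding split_def by (intro borel_measurable_continuous_onI continuous_intros)
  from indep_vars_compose2[OF indep_pairs this]
  show ?thesis unfolding Y_def[abs_def] by simp
qed

lemma moment_S: "has_moment p S"
  unfolding S_def[abs_def] by (intro has_moment_sum moment_Y) (use p in auto)

lemma moment2_S: "has_moment 2 S"
  using has_moment_mono[OF moment_S] p by auto

lemma expectation_S: "(\<integral>\<omega>. S \<omega> \<partial>M) = (\<Sum>k\<in>I. \<integral>\<omega>. Y k \<omega> \<partial>M)"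
  unfolding S_def by (intro Bochner_Integration.integral_sum integrable_Y)

lemma square_S:
  "(\<integral>\<omega>. (cmod (S \<omega>))\<^sup>2 \<partial>M) = (\<Sum>k\<in>I. exp (2 * s\<^sup>2) * m2 - (cmod (\<integral>\<omega>. Y k \<omega> \<partial>M))\<^sup>2) + (cmod (\<integral>\<omega>. S \<omega> \<partial>M))\<^sup>2"
  unfolding expectation_S using expectation_norm_square_sum[OF finite_I indep_Y moment2_Y]
  by (simp add: S_def square_Y)

lemma complex_variance_S:
  "complex_variance M S = (\<Sum>k\<in>I. exp (2 * s\<^sup>2) * m2 - (cmod (\<integral>\<omega>. Y k \<omega> \<partial>M))\<^sup>2)"
  unfolding complex_variance_def square_S by simp

end

section \<open>Propagation of the moment bound to the next level\<close>

text \<open>Up to the factor C, the quantity bounded by K is the ratio between the summed p-th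
  moments of Y and the power p/2 of the summed second moments. It stays bounded below the first
  level and diverges at the first, so this extension is meant for inner nodes.\<close>

locale gaussian_weighted_sum_mean = gaussian_weighted_sum +
  fixes m1 :: complex and K :: real
  assumes mean_W: "\<And>k. k \<in> I \<Longrightarrow> (\<integral>\<omega>. W k \<omega> \<partial>M) = m1"
    and K: "real (card I) powr (1 - p / 2) * exp ((p\<^sup>2 / 2 - p) * s\<^sup>2) \<le> K"
begin

text \<open>The second moment of \<open>S\<close>: diagonal terms plus products of means. It takes
  over the role of \<open>m2\<close> one level higher.\<close>

definition m2' :: real where
  "m2' = real (card I) * (exp (2 * s\<^sup>2) * m2) + (real (card I) * (real (card I) - 1)) * (cmod (\<kappa> * m1))\<^sup>2"

lemma expectation_S_mean: "(\<integral>\<omega>. S \<omega> \<partial>M) = of_nat (card I) * (\<kappa> * m1)"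
  unfolding expectation_S using expectation_Y mean_W by simp

lemma square_S_mean: "(\<integral>\<omega>. (cmod (S \<omega>))\<^sup>2 \<partial>M) = m2'"
  unfolding square_S expectation_S_mean using expectation_Y mean_W
  by (simp add: m2'_def norm_mult power_mult_distrib algebra_simps power2_eq_square)

lemma m2'_ge: "real (card I) * (exp (2 * s\<^sup>2) * m2) \<le> m2'"
  unfolding m2'_def using card_I by simp

lemma m2'_pos: "m2' > 0"
  using m2'_ge card_I m2_pos by (intro less_le_trans[OF _ m2'_ge]) auto

text \<open>Centre the summands, apply \<open>rosenthal\<close>, and add the mean back. The 3 is 2
  from Rosenthal plus 1 from the mean; each 2^p is the price of one use of
  \<open>powr_add_le'\<close>. Only \<open>m2'\<close> appears on the right, so the bound has the
  form of the hypothesis and can be iterated.\<close>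

lemma powr_S_le:
  "(\<integral>\<omega>. cmod (S \<omega>) powr p \<partial>M) \<le> (2 powr p * (3 + 2 powr p * (K * C + 1))) * m2' powr (p / 2)"
proof -
  let ?N = "real (card I)"
  define \<mu> where "\<mu> = \<kappa> * m1"
  define b where "b = exp (2 * s\<^sup>2) * m2"
  have b: "b > 0" using m2_pos by (simp add: b_def)
  have \<mu>: "(\<integral>\<omega>. Y k \<omega> \<partial>M) = \<mu>" if "k \<in> I" for k using expectation_Y mean_W that by (simp add: \<mu>_def)
  define Y0 where "Y0 k \<omega> = Y k \<omega> - \<mu>" for k \<omega>
  have mY0: "has_moment p (Y0 k)" if "k \<in> I" for k
    unfolding Y0_def[abs_def] using p that by (intro has_moment_diff moment_Y has_moment_const) auto
  have indY0: "indep_vars (\<lambda>_. borel) Y0 I"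
    unfolding Y0_def[abs_def] by (rule indep_vars_compose2[OF indep_Y, of "\<lambda>_ y. y - \<mu>"]) measurable
  have EY0: "(\<integral>\<omega>. Y0 k \<omega> \<partial>M) = 0" if "k \<in> I" for k
    unfolding Y0_def using integrable_Y[OF that] \<mu>[OF that] by (simp add: prob_space)
  have Nb: "?N * b \<le> m2'" using m2'_ge by (simp add: b_def)
  have sq0: "(\<integral>\<omega>. (cmod (Y0 k \<omega>))\<^sup>2 \<partial>M) \<le> b" if k: "k \<in> I" for k
  proof -
    have "(\<integral>\<omega>. (cmod (Y0 k \<omega>))\<^sup>2 \<partial>M) = b - (cmod \<mu>)\<^sup>2"
      using expectation_centered_square[OF moment2_Y[OF k]]
      unfolding \<mu>[OF k] complex_variance_def square_Y[OF k] Y0_def b_def .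
    then show ?thesis by simp
  qed
  have "(\<Sum>k\<in>I. \<integral>\<omega>. (cmod (Y0 k \<omega>))\<^sup>2 \<partial>M) \<le> (\<Sum>k\<in>I. b)" by (rule sum_mono[OF sq0])
  also have "\<dots> \<le> m2'" using Nb by simp
  finally have V: "(\<Sum>k\<in>I. \<integral>\<omega>. (cmod (Y0 k \<omega>))\<^sup>2 \<partial>M) \<le> m2'" .
  have p2: "2 + (p - 2) = p" "1 + (p - 2) / 2 = p / 2" by (simp_all add: field_simps)
  have ros: "(\<integral>\<omega>. cmod (\<Sum>k\<in>I. Y0 k \<omega>) powr p \<partial>M) \<le> 2 * m2' powr (p / 2) + (\<Sum>k\<in>I. \<integral>\<omega>. cmod (Y0 k \<omega>) powr p \<partial>M)"
    using rosenthal[OF finite_I indY0, of "p - 2" m2'] p mY0 EY0 V m2'_pos unfolding p2 by simp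
  have n\<mu>: "cmod \<mu> powr p \<le> b powr (p / 2)"
  proof -
    obtain k where k: "k \<in> I" using I_nonempty by auto
    have "(cmod \<mu>)\<^sup>2 \<le> b" using norm_expectation_square_le[OF moment2_Y[OF k]] \<mu>[OF k] square_Y[OF k] by (simp add: b_def)
    then have "((cmod \<mu>)\<^sup>2) powr (p / 2) \<le> b powr (p / 2)" using p by (intro powr_mono2) auto
    then show ?thesis by (cases "\<mu> = 0") (auto simp: powr_powr simp flip: powr_numeral)
  qed
  have Y0p: "(\<integral>\<omega>. cmod (Y0 k \<omega>) powr p \<partial>M) \<le> 2 powr p * (exp (p\<^sup>2 * s\<^sup>2 / 2) * (C * m2 powr (p / 2)) + b powr (p / 2))"
    if k: "k \<in> I" for k
  proof -
    have iY: "integrable M (\<lambda>\<omega>. cmod (Y k \<omega>) powr p)" using moment_Y[OF k] by auto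
    have "(\<integral>\<omega>. cmod (Y0 k \<omega>) powr p \<partial>M) \<le> (\<integral>\<omega>. 2 powr p * (cmod (Y k \<omega>) powr p + cmod \<mu> powr p) \<partial>M)"
    proof (rule integral_mono)
      show "integrable M (\<lambda>\<omega>. cmod (Y0 k \<omega>) powr p)" using mY0[OF k] by auto
      show "integrable M (\<lambda>\<omega>. 2 powr p * (cmod (Y k \<omega>) powr p + cmod \<mu> powr p))" using iY by simp
      fix \<omega>
      have "cmod (Y0 k \<omega>) powr p \<le> (cmod (Y k \<omega>) + cmod \<mu>) powr p"
        unfolding Y0_def using p by (intro powr_mono2 norm_triangle_ineq4) auto
      also have "\<dots> \<le> 2 powr p * (cmod (Y k \<omega>) powr p + cmod \<mu> powr p)" using p by (intro powr_add_le') auto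
      finally show "cmod (Y0 k \<omega>) powr p \<le> 2 powr p * (cmod (Y k \<omega>) powr p + cmod \<mu> powr p)" .
    qed
    also have "\<dots> = 2 powr p * ((\<integral>\<omega>. cmod (Y k \<omega>) powr p \<partial>M) + cmod \<mu> powr p)"
      using iY by (simp add: prob_space)
    also have "\<dots> \<le> 2 powr p * (exp (p\<^sup>2 * s\<^sup>2 / 2) * (C * m2 powr (p / 2)) + b powr (p / 2))"
      using integral_Y_powr[OF k, of p] p powr_W[OF k] n\<mu> by (intro mult_left_mono add_mono) auto
    finally show ?thesis .
  qed
  \<comment> \<open>The hypothesis on K enters here: splitting N and the exponential isolates the
    quantity it bounds, and what remains is the power p/2 of N b.\<close>
  have e1: "?N * (exp (p\<^sup>2 * s\<^sup>2 / 2) * (C * m2 powr (p / 2))) \<le> K * C * m2' powr (p / 2)"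
  proof -
    have "(?N * b) powr (p / 2) = ?N powr (p / 2) * (exp (p * s\<^sup>2) * m2 powr (p / 2))"
      using card_I m2_pos by (simp add: b_def powr_mult powr_def[of "exp _"] mult_ac)
    note f1 = this
    have f2: "?N = ?N powr (1 - p / 2) * ?N powr (p / 2)"
      using card_I by (simp flip: powr_add)
    have f3: "exp (p\<^sup>2 * s\<^sup>2 / 2) = exp ((p\<^sup>2 / 2 - p) * s\<^sup>2) * exp (p * s\<^sup>2)"
      by (simp add: exp_add[symmetric] algebra_simps)
    have "?N * (exp (p\<^sup>2 * s\<^sup>2 / 2) * (C * m2 powr (p / 2)))
        = (?N powr (1 - p / 2) * ?N powr (p / 2)) * ((exp ((p\<^sup>2 / 2 - p) * s\<^sup>2) * exp (p * s\<^sup>2)) * (C * m2 powr (p / 2)))"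
      by (rule arg_cong2[where f="\<lambda>x y. x * (y * (C * m2 powr (p / 2)))", OF f2 f3])
    also have "\<dots> = (?N powr (1 - p / 2) * exp ((p\<^sup>2 / 2 - p) * s\<^sup>2)) * C * (?N * b) powr (p / 2)"
      unfolding f1 by (simp only: mult_ac)
    also have "\<dots> \<le> K * C * m2' powr (p / 2)"
    proof -
      have "0 \<le> K" by (rule order_trans[OF _ K]) simp
      then show ?thesis
        using K C_nonneg Nb b card_I p by (intro mult_mono powr_mono2) auto
    qed
    finally show ?thesis .
  qed
  \<comment> \<open>Uses N \<le> N^(p/2), valid since N \<ge> 1 and p > 2.\<close>
  have e2: "?N * b powr (p / 2) \<le> m2' powr (p / 2)"
  proof -
    have "?N powr 1 \<le> ?N powr (p / 2)" using card_I p by (intro powr_mono) auto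
    then have "?N * b powr (p / 2) \<le> (?N * b) powr (p / 2)"
      using card_I b by (simp add: powr_mult mult_right_mono)
    also have "\<dots> \<le> m2' powr (p / 2)" using Nb b card_I p by (intro powr_mono2) auto
    finally show ?thesis .
  qed
  have "(\<Sum>k\<in>I. \<integral>\<omega>. cmod (Y0 k \<omega>) powr p \<partial>M)
      \<le> 2 powr p * (?N * (exp (p\<^sup>2 * s\<^sup>2 / 2) * (C * m2 powr (p / 2))) + ?N * b powr (p / 2))"
    using sum_mono[OF Y0p] by (simp add: algebra_simps)
  also have "\<dots> \<le> 2 powr p * (K * C * m2' powr (p / 2) + m2' powr (p / 2))"
    using e1 e2 by (intro mult_left_mono add_mono) auto
  finally have c: "(\<integral>\<omega>. cmod (\<Sum>k\<in>I. Y0 k \<omega>) powr p \<partial>M) \<le> (2 + 2 powr p * (K * C + 1)) * m2' powr (p / 2)"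
    using ros by (simp add: algebra_simps)
  define m where "m = (\<integral>\<omega>. S \<omega> \<partial>M)"
  have SY0: "S \<omega> = (\<Sum>k\<in>I. Y0 k \<omega>) + m" for \<omega>
    unfolding m_def expectation_S_mean Y0_def S_def sum_subtractf by (simp add: \<mu>_def)
  have nm: "cmod m powr p \<le> m2' powr (p / 2)"
  proof -
    have "(cmod m)\<^sup>2 \<le> m2'" using norm_expectation_square_le[OF moment2_S] square_S_mean by (simp add: m_def)
    then have "((cmod m)\<^sup>2) powr (p / 2) \<le> m2' powr (p / 2)" using p by (intro powr_mono2) auto
    then show ?thesis by (cases "m = 0") (auto simp: powr_powr simp flip: powr_numeral)
  qed
  have mS0: "has_moment p (\<lambda>\<omega>. \<Sum>k\<in>I. Y0 k \<omega>)" using p by (intro has_moment_sum mY0) auto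
  have "(\<integral>\<omega>. cmod (S \<omega>) powr p \<partial>M) \<le> (\<integral>\<omega>. 2 powr p * (cmod (\<Sum>k\<in>I. Y0 k \<omega>) powr p + cmod m powr p) \<partial>M)"
  proof (rule integral_mono)
    show "integrable M (\<lambda>\<omega>. cmod (S \<omega>) powr p)" using moment_S by auto
    show "integrable M (\<lambda>\<omega>. 2 powr p * (cmod (\<Sum>k\<in>I. Y0 k \<omega>) powr p + cmod m powr p))"
      using has_momentD(2)[OF mS0] by simp
    fix \<omega>
    have "cmod (S \<omega>) powr p \<le> (cmod (\<Sum>k\<in>I. Y0 k \<omega>) + cmod m) powr p"
      unfolding SY0 using p by (intro powr_mono2 norm_triangle_ineq) auto
    also have "\<dots> \<le> 2 powr p * (cmod (\<Sum>k\<in>I. Y0 k \<omega>) powr p + cmod m powr p)" using p by (intro powr_add_le') auto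
    finally show "cmod (S \<omega>) powr p \<le> 2 powr p * (cmod (\<Sum>k\<in>I. Y0 k \<omega>) powr p + cmod m powr p)" .
  qed
  also have "\<dots> = 2 powr p * ((\<integral>\<omega>. cmod (\<Sum>k\<in>I. Y0 k \<omega>) powr p \<partial>M) + cmod m powr p)"
    using has_momentD(2)[OF mS0] by (simp add: prob_space)
  also have "\<dots> \<le> 2 powr p * ((2 + 2 powr p * (K * C + 1)) * m2' powr (p / 2) + m2' powr (p / 2))"
    using c nm by (intro mult_left_mono add_mono) auto
  finally show ?thesis by (simp add: algebra_simps)
qed

end

section \<open>Truncation and the central limit theorem\<close>

lemma norm_iexp_diff_le: "cmod (iexp a - iexp b) \<le> \<bar>a - b\<bar>"
proof -
  have "iexp a - iexp b = iexp b * (iexp (a - b) - 1)"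
    by (simp add: algebra_simps exp_add[symmetric])
  then have "cmod (iexp a - iexp b) = cmod (iexp (a - b) - 1)" by (simp add: norm_mult)
  also have "\<dots> \<le> \<bar>a - b\<bar>" using iexp_approx1[of "a - b" 0] by simp
  finally show ?thesis .
qed

text \<open>The Taylor remainder of the exponential is bounded by a square and by a cube. The
  smaller of the two interpolates to any exponent between 2 and 3, which is needed because third
  moments may not be under control.\<close>

lemma min_square_cube_le_powr:
  fixes x p :: real
  assumes "2 \<le> p" "p \<le> 3"
  shows "min (6 * x\<^sup>2) (\<bar>x\<bar> ^ 3) \<le> 6 * \<bar>x\<bar> powr p"
proof (cases "x = 0")
  case False
  have c: "\<bar>x\<bar> ^ 3 = \<bar>x\<bar> powr 3" "x\<^sup>2 = \<bar>x\<bar> powr 2" using False by simp_all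
  show ?thesis
  proof (cases "\<bar>x\<bar> \<le> 1")
    case True
    have "\<bar>x\<bar> ^ 3 \<le> \<bar>x\<bar> powr p" unfolding c using True assms False by (intro powr_mono') auto
    moreover have "0 \<le> \<bar>x\<bar> powr p" by simp
    ultimately show ?thesis by (intro min.coboundedI2) linarith
  next
    case False
    then have "x\<^sup>2 \<le> \<bar>x\<bar> powr p" unfolding c using assms by (intro powr_mono) auto
    then show ?thesis by (intro min.coboundedI1) simp
  qed
qed simp

lemma exp_minus_taylor2:
  fixes x :: real
  assumes "0 \<le> x"
  shows "\<bar>1 - x - exp (- x)\<bar> \<le> x\<^sup>2 / 2"
proof -
  have "1 - x \<le> exp (- x)" using exp_ge_add_one_self[of "- x"] by simp
  moreover have "exp (- x) \<le> 1 - x + x\<^sup>2 / 2"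
  proof -
    let ?f = "\<lambda>x::real. 1 - x + x\<^sup>2 / 2 - exp (- x)"
    have "?f 0 \<le> ?f x"
    proof (rule DERIV_nonneg_imp_nondecreasing[OF assms])
      fix y :: real assume "0 \<le> y"
      have "(?f has_real_derivative - 1 + y + exp (- y)) (at y)"
        by (auto intro!: derivative_eq_intros)
      moreover have "0 \<le> - 1 + y + exp (- y)" using exp_ge_add_one_self[of "- y"] by simp
      ultimately show "\<exists>z. (?f has_real_derivative z) (at y) \<and> 0 \<le> z" by blast
    qed
    then show ?thesis by simp
  qed
  ultimately show ?thesis by simp
qed

text \<open>The comparison is with exp(-v/2) instead of 1 - v/2: these factors have modulus at most
  1 and multiply to the exponential of the total variance. The price is the term v^2 / 8.\<close>

lemma (in prob_space) char_second_order_bound: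
  fixes U :: "'a \<Rightarrow> real"
  assumes [measurable]: "U \<in> borel_measurable M" and p: "2 < p" "p \<le> 3"
    and i: "integrable M (\<lambda>\<omega>. \<bar>U \<omega>\<bar> powr p)" and zero: "(\<integral>\<omega>. U \<omega> \<partial>M) = 0"
  shows "cmod ((\<integral>\<omega>. iexp (U \<omega>) \<partial>M) - of_real (exp (- (\<integral>\<omega>. (U \<omega>)\<^sup>2 \<partial>M) / 2)))
    \<le> (\<integral>\<omega>. \<bar>U \<omega>\<bar> powr p \<partial>M) + (\<integral>\<omega>. (U \<omega>)\<^sup>2 \<partial>M)\<^sup>2 / 8"
proof -
  let ?v = "\<integral>\<omega>. (U \<omega>)\<^sup>2 \<partial>M"
  have m: "has_moment p (\<lambda>\<omega>. of_real (U \<omega>))" using i by (simp add: has_moment_def)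
  have i1: "integrable M U" using has_moment_integrable[OF m] p by (simp add: complex_of_real_integrable_eq)
  have i2: "integrable M (\<lambda>\<omega>. (U \<omega>)\<^sup>2)" using has_moment_square[OF m] p by simp
  have "cmod (char (distr M borel U) 1 - (1 - 1\<^sup>2 * ?v / 2))
      \<le> 1\<^sup>2 / 6 * (\<integral>\<omega>. min (6 * (U \<omega>)\<^sup>2) (\<bar>1\<bar> * \<bar>U \<omega>\<bar> ^ 3) \<partial>M)"
    using zero by (intro char_approx3' i1 i2) auto
  also have "char (distr M borel U) 1 = (\<integral>\<omega>. iexp (U \<omega>) \<partial>M)"
    unfolding char_def by (subst integral_distr) auto
  also have "(\<integral>\<omega>. min (6 * (U \<omega>)\<^sup>2) (\<bar>1\<bar> * \<bar>U \<omega>\<bar> ^ 3) \<partial>M) \<le> (\<integral>\<omega>. 6 * \<bar>U \<omega>\<bar> powr p \<partial>M)"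
  proof (rule integral_mono)
    show "integrable M (\<lambda>\<omega>. min (6 * (U \<omega>)\<^sup>2) (\<bar>1\<bar> * \<bar>U \<omega>\<bar> ^ 3))"
      by (rule Bochner_Integration.integrable_bound[of M "\<lambda>\<omega>. 6 * (U \<omega>)\<^sup>2"]) (use i2 in auto)
    show "min (6 * (U \<omega>)\<^sup>2) (\<bar>1\<bar> * \<bar>U \<omega>\<bar> ^ 3) \<le> 6 * \<bar>U \<omega>\<bar> powr p" for \<omega>
      using min_square_cube_le_powr[of p "U \<omega>"] p by simp
  qed (use i in simp)
  finally have 1: "cmod ((\<integral>\<omega>. iexp (U \<omega>) \<partial>M) - of_real (1 - ?v / 2)) \<le> (\<integral>\<omega>. \<bar>U \<omega>\<bar> powr p \<partial>M)"
    by simp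
  have "\<bar>1 - ?v / 2 - exp (- (?v / 2))\<bar> \<le> (?v / 2)\<^sup>2 / 2" by (rule exp_minus_taylor2) simp
  then have 2: "cmod (of_real (1 - ?v / 2) - of_real (exp (- ?v / 2)) :: complex) \<le> ?v\<^sup>2 / 8"
    unfolding of_real_diff[symmetric] norm_of_real by (simp add: power_divide)
  show ?thesis
    using norm_triangle_ineq[of "(\<integral>\<omega>. iexp (U \<omega>) \<partial>M) - of_real (1 - ?v / 2)" "of_real (1 - ?v / 2) - of_real (exp (- ?v / 2)) :: complex"] 1 2
    by simp
qed

section \<open>The truncated and normalised summands\<close>

definition std_normal_tail :: "real \<Rightarrow> real" where
  "std_normal_tail x = measure std_normal_distribution {x<..}"

text \<open>\<open>T\<close> is a free parameter; its choice comes only after all errors have been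
  expressed through it. A positive \<open>s\<close> makes the variance of \<open>S\<close> strictly
  positive.\<close>

locale truncated_gaussian_sum = gaussian_weighted_sum M I \<xi> W s r p C m2
  for M :: "'a measure" and I :: "'i set" and \<xi> W s r p C m2 +
  fixes T :: real and \<theta> :: complex
  assumes s_pos: "s > 0"
begin

definition v :: real where "v = complex_variance M S"

text \<open>The second moment of W / sqrt v; it is to X what \<open>m2\<close> is to Y.\<close>

definition c :: real where "c = m2 / v"

text \<open>Normalised by the variance of the whole sum and not of the truncated one, so that in the
  absence of exceedances X agrees with the standardized summand up to centring.\<close>

definition X :: "'i \<Rightarrow> 'a \<Rightarrow> complex" where
  "X k \<omega> = (if \<xi> k \<omega> \<le> T then Y k \<omega> else 0) / of_real (sqrt v)"

text \<open>Centred at the mean of the truncated variable, so that the expansion of the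
  characteristic function has no linear term. The difference to the mean of \<open>Y\<close> is
  handled by \<open>truncation_bias_le\<close>.\<close>

definition U :: "'i \<Rightarrow> 'a \<Rightarrow> real" where
  "U k \<omega> = \<theta> \<bullet> (X k \<omega> - (\<integral>\<omega>. X k \<omega> \<partial>M))"

lemma v_le: "v \<le> real (card I) * (exp (2 * s\<^sup>2) * m2)"
  unfolding v_def complex_variance_S sum_subtractf by (simp add: sum_nonneg)

text \<open>The squared mean of a summand is at most exp(s^2) m2, smaller than its second moment by
  the factor exp(-s^2). For large s centring is therefore invisible in the variance.\<close>

lemma v_ge: "real (card I) * (exp (2 * s\<^sup>2) * m2) * (1 - exp (- s\<^sup>2)) \<le> v"
proof -
  have "(cmod (\<integral>\<omega>. Y k \<omega> \<partial>M))\<^sup>2 \<le> exp (2 * s\<^sup>2) * m2 * exp (- s\<^sup>2)" if k: "k \<in> I" for k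
  proof -
    have "(cmod (\<integral>\<omega>. Y k \<omega> \<partial>M))\<^sup>2 \<le> (exp (s\<^sup>2 / 2) * sqrt m2)\<^sup>2"
      using norm_expectation_Y_le[OF k] by (intro power_mono) auto
    also have "\<dots> = exp (s\<^sup>2) * m2"
      using m2_pos by (simp add: power_mult_distrib flip: exp_double)
    also have "\<dots> = exp (2 * s\<^sup>2) * m2 * exp (- s\<^sup>2)"
      by (simp add: exp_add[symmetric])
    finally show ?thesis .
  qed
  then have "(\<Sum>k\<in>I. exp (2 * s\<^sup>2) * m2 - exp (2 * s\<^sup>2) * m2 * exp (- s\<^sup>2)) \<le> v"
    unfolding v_def complex_variance_S by (intro sum_mono diff_left_mono)
  then show ?thesis by (simp add: algebra_simps)
qed

lemma v_pos: "v > 0"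
proof -
  have "0 < real (card I) * (exp (2 * s\<^sup>2) * m2) * (1 - exp (- s\<^sup>2))"
    using card_I m2_pos s_pos by (intro mult_pos_pos) auto
  then show ?thesis using v_ge by (rule less_le_trans)
qed

lemma c_pos: "c > 0"
  using v_pos m2_pos by (simp add: c_def)

lemma X_measurable[measurable]: "k \<in> I \<Longrightarrow> X k \<in> borel_measurable M"
  unfolding X_def using \<xi>_measurable Y_measurable by measurable

lemma norm_X_le: "cmod (X k \<omega>) \<le> cmod (Y k \<omega> / of_real (sqrt v))"
  by (simp add: X_def norm_divide)

lemma moment_X: "k \<in> I \<Longrightarrow> has_moment p (X k)"
  using has_moment_bound[OF has_moment_cmult[OF moment_Y, of k "1 / of_real (sqrt v)"], of "X k"] norm_X_le p
  by simp

lemma moment2_X: "k \<in> I \<Longrightarrow> has_moment 2 (X k)"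
  using has_moment_mono[OF moment_X] p by auto

lemma integrable_X: "k \<in> I \<Longrightarrow> integrable M (X k)"
  using has_moment_integrable[OF moment2_X] by auto

lemma square_X:
  assumes k: "k \<in> I"
  shows "(\<integral>\<omega>. (cmod (X k \<omega>))\<^sup>2 \<partial>M) = exp (2 * s\<^sup>2) * Phi (T - 2 * s) * c"
proof -
  have eq: "(cmod (X k \<omega>))\<^sup>2 = (exp ((2 * s) * \<xi> k \<omega>) * indicator {..T} (\<xi> k \<omega>)) * (cmod (W k \<omega>))\<^sup>2 / v" for \<omega>
    using v_pos by (auto simp: X_def norm_divide norm_Y power_divide power_mult_distrib indicator_def exp_double[symmetric] mult.assoc)
  have "(\<integral>\<omega>. (cmod (X k \<omega>))\<^sup>2 \<partial>M) = (\<integral>\<omega>. (exp ((2 * s) * \<xi> k \<omega>) * indicator {..T} (\<xi> k \<omega>)) * (cmod (W k \<omega>))\<^sup>2 \<partial>M) / v"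
    unfolding eq by (rule integral_divide_zero)
  also have "(\<integral>\<omega>. (exp ((2 * s) * \<xi> k \<omega>) * indicator {..T} (\<xi> k \<omega>)) * (cmod (W k \<omega>))\<^sup>2 \<partial>M)
      = (\<integral>x. exp ((2 * s) * x) * indicator {..T} x \<partial>std_normal_distribution) * (\<integral>\<omega>. (cmod (W k \<omega>))\<^sup>2 \<partial>M)"
    by (rule integral_prod[OF k, of "\<lambda>x. exp ((2 * s) * x) * indicator {..T} x" "\<lambda>w. (cmod w)\<^sup>2"])
      (auto intro: integrable_std_normal_exp integrable_real_mult_indicator has_moment_square[OF moment2_W[OF k]])
  also have "\<dots> = (exp (2 * s\<^sup>2) * Phi (T - 2 * s)) * m2"
    unfolding integral_std_normal_exp_atMost square_W[OF k] by (simp add: power_mult_distrib)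
  finally show ?thesis by (simp add: c_def)
qed

lemma norm_expectation_X_le: 
  assumes k: "k \<in> I" shows "cmod (\<integral>\<omega>. X k \<omega> \<partial>M) \<le> exp (s\<^sup>2 / 2) * sqrt c"
proof -
  have "cmod (\<integral>\<omega>. X k \<omega> \<partial>M) \<le> (\<integral>\<omega>. cmod (X k \<omega>) \<partial>M)" by (rule integral_norm_bound)
  also have "\<dots> \<le> (\<integral>\<omega>. cmod (Y k \<omega>) / sqrt v \<partial>M)"
  proof (rule integral_mono)
    show "integrable M (\<lambda>\<omega>. cmod (X k \<omega>))" using integrable_X[OF k] by (rule integrable_norm)
    show "integrable M (\<lambda>\<omega>. cmod (Y k \<omega>) / sqrt v)" using integrable_norm[OF integrable_Y[OF k]] by simp
    show "cmod (X k \<omega>) \<le> cmod (Y k \<omega>) / sqrt v" for \<omega>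
      using norm_X_le[of k \<omega>] v_pos by (simp add: norm_divide)
  qed
  also have "\<dots> = (\<integral>\<omega>. cmod (Y k \<omega>) \<partial>M) / sqrt v" by (rule integral_divide_zero)
  also have "(\<integral>\<omega>. cmod (Y k \<omega>) \<partial>M) = exp (s\<^sup>2 / 2) * (\<integral>\<omega>. cmod (W k \<omega>) \<partial>M)"
    using integral_Y_powr[OF k, of 1] p by simp
  also have "exp (s\<^sup>2 / 2) * (\<integral>\<omega>. cmod (W k \<omega>) \<partial>M) / sqrt v \<le> exp (s\<^sup>2 / 2) * sqrt m2 / sqrt v"
    using norm_W_le[OF k] v_pos by (intro divide_right_mono mult_left_mono) auto
  also have "\<dots> = exp (s\<^sup>2 / 2) * sqrt c" by (simp add: c_def real_sqrt_divide)
  finally show ?thesis .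
qed

text \<open>Of the p factors exp(s \<xi>), p - 2 are bounded through \<xi> \<le> T and only two are
  integrated. Integrating all p of them would give exp(p^2 s^2 / 2), which is far larger when T is
  close to 2 s.\<close>

lemma powr_X_le:
  assumes k: "k \<in> I"
  shows "(\<integral>\<omega>. cmod (X k \<omega>) powr p \<partial>M) \<le> exp ((p - 2) * s * T) * exp (2 * s\<^sup>2) * C * c powr (p / 2)"
proof -
  let ?A = "exp ((p - 2) * s * T) / v powr (p / 2)"
  have sv: "sqrt v powr p = v powr (p / 2)" using v_pos by (simp add: powr_half_sqrt[symmetric] powr_powr)
  have iW: "integrable M (\<lambda>\<omega>. cmod (W k \<omega>) powr p)" using moment_W[OF k] by auto
  note pr = integrable_prod[OF k, of "\<lambda>x. exp ((2 * s) * x)" "\<lambda>w. cmod w powr p", OF _ _ integrable_std_normal_exp iW]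
    integral_prod[OF k, of "\<lambda>x. exp ((2 * s) * x)" "\<lambda>w. cmod w powr p", OF _ _ integrable_std_normal_exp iW]
  have pr1: "integrable M (\<lambda>\<omega>. exp ((2 * s) * \<xi> k \<omega>) * cmod (W k \<omega>) powr p)" by (rule pr) measurable
  have pr2: "(\<integral>\<omega>. exp ((2 * s) * \<xi> k \<omega>) * cmod (W k \<omega>) powr p \<partial>M) = exp (2 * s\<^sup>2) * (\<integral>\<omega>. cmod (W k \<omega>) powr p \<partial>M)"
    by (subst pr) (auto simp: integral_std_normal_exp power_mult_distrib)
  have "(\<integral>\<omega>. cmod (X k \<omega>) powr p \<partial>M) \<le> (\<integral>\<omega>. ?A * (exp ((2 * s) * \<xi> k \<omega>) * cmod (W k \<omega>) powr p) \<partial>M)"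
  proof (rule integral_mono)
    show "integrable M (\<lambda>\<omega>. cmod (X k \<omega>) powr p)" using moment_X[OF k] by auto
    show "integrable M (\<lambda>\<omega>. ?A * (exp ((2 * s) * \<xi> k \<omega>) * cmod (W k \<omega>) powr p))" using pr1 by (rule integrable_mult_right)
    fix \<omega>
    show "cmod (X k \<omega>) powr p \<le> ?A * (exp ((2 * s) * \<xi> k \<omega>) * cmod (W k \<omega>) powr p)"
    proof (cases "\<xi> k \<omega> \<le> T")
      case True
      have "(p - 2) * s * \<xi> k \<omega> \<le> (p - 2) * s * T" using True p s_pos by (intro mult_left_mono) auto
      then have "exp (p * s * \<xi> k \<omega>) \<le> exp ((p - 2) * s * T) * exp ((2 * s) * \<xi> k \<omega>)"
        by (simp add: exp_add[symmetric] algebra_simps)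
      then have "exp (p * s * \<xi> k \<omega>) * cmod (W k \<omega>) powr p / v powr (p / 2)
          \<le> exp ((p - 2) * s * T) * exp ((2 * s) * \<xi> k \<omega>) * cmod (W k \<omega>) powr p / v powr (p / 2)"
        by (intro divide_right_mono mult_right_mono) auto
      moreover have "cmod (X k \<omega>) powr p = exp (p * s * \<xi> k \<omega>) * cmod (W k \<omega>) powr p / v powr (p / 2)"
        using True v_pos by (simp add: X_def norm_divide powr_divide norm_Y_powr sv)
      ultimately show ?thesis by simp
    qed (simp add: X_def)
  qed
  also have "\<dots> = ?A * (exp (2 * s\<^sup>2) * (\<integral>\<omega>. cmod (W k \<omega>) powr p \<partial>M))" by (simp only: integral_mult_right_zero pr2)
  also have "\<dots> \<le> ?A * (exp (2 * s\<^sup>2) * (C * m2 powr (p / 2)))"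
    using powr_W[OF k] by (intro mult_left_mono) auto
  also have "\<dots> = exp ((p - 2) * s * T) * exp (2 * s\<^sup>2) * C * c powr (p / 2)"
    using m2_pos v_pos by (simp add: c_def powr_divide)
  finally show ?thesis .
qed

text \<open>Squaring doubles both parameters. The tilt by 2 s becomes a shift, which leaves a
  truncated Gaussian integral of frequency 2 r, to which \<open>norm_integral_iexp_atMost_le\<close>
  applies.\<close>

lemma norm_expectation_X_square_le:
  assumes k: "k \<in> I" and r: "r \<noteq> 0"
  shows "cmod (\<integral>\<omega>. (X k \<omega>)\<^sup>2 \<partial>M) \<le> exp (2 * s\<^sup>2) * c / \<bar>r\<bar>"
proof -
  define g where "g x = exp ((2 * s) * x) *\<^sub>R (iexp ((2 * r) * x) * indicator {..T} x)" for x
  have [measurable]: "(\<lambda>x. iexp (t * x)) \<in> borel_measurable borel" for t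
    by (intro borel_measurable_continuous_onI continuous_intros)
  have gm[measurable]: "g \<in> borel_measurable borel" unfolding g_def by measurable
  have gi: "integrable std_normal_distribution g"
    by (rule Bochner_Integration.integrable_bound[OF integrable_std_normal_exp[of "2 * s"]])
      (auto simp: g_def norm_mult indicator_def)
  have "exp (Complex s r * of_real x) ^ 2 = exp ((2 * s) * x) *\<^sub>R iexp ((2 * r) * x)" for x
    by (simp add: exp_double[symmetric] Complex_eq scaleR_conv_of_real exp_of_real[symmetric] exp_add[symmetric] algebra_simps)
  then have eq: "(X k \<omega>)\<^sup>2 = g (\<xi> k \<omega>) * (W k \<omega>)\<^sup>2 / of_real v" for \<omega>
    using v_pos by (auto simp: X_def Y_def g_def power_divide power_mult_distrib indicator_def simp flip: of_real_power)
  have iW: "integrable M (\<lambda>\<omega>. (W k \<omega>)\<^sup>2)"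
    using integrable_mult_of_square[OF moment2_W[OF k] moment2_W[OF k]] by (simp add: power2_eq_square)
  have "(\<integral>\<omega>. (X k \<omega>)\<^sup>2 \<partial>M) = (\<integral>x. g x \<partial>std_normal_distribution) * (\<integral>\<omega>. (W k \<omega>)\<^sup>2 \<partial>M) / of_real v"
    unfolding eq integral_divide_zero
    using integral_prod[OF k gm _ gi, of "\<lambda>w. w\<^sup>2"] iW by simp
  moreover have "cmod (\<integral>x. g x \<partial>std_normal_distribution) \<le> exp (2 * s\<^sup>2) / \<bar>r\<bar>"
  proof -
    have "(\<integral>x. g x \<partial>std_normal_distribution) = exp ((2 * s)\<^sup>2 / 2) *\<^sub>R (\<integral>x. iexp ((2 * r) * (x + 2 * s)) * indicator {..T} (x + 2 * s) \<partial>std_normal_distribution)"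
      unfolding g_def by (rule integral_std_normal_tilt) measurable
    also have "(\<lambda>x. iexp ((2 * r) * (x + 2 * s)) * indicator {..T} (x + 2 * s))
        = (\<lambda>x. iexp (4 * r * s) * (iexp ((2 * r) * x) * indicator {..T - 2 * s} x))"
      by (auto simp: fun_eq_iff indicator_def exp_add[symmetric] algebra_simps)
    also have "(\<integral>x. iexp (4 * r * s) * (iexp ((2 * r) * x) * indicator {..T - 2 * s} x) \<partial>std_normal_distribution)
        = iexp (4 * r * s) * (\<integral>x. iexp ((2 * r) * x) * indicator {..T - 2 * s} x \<partial>std_normal_distribution)"
      by (rule integral_mult_right_zero)
    finally have "cmod (\<integral>x. g x \<partial>std_normal_distribution)
        = exp (2 * s\<^sup>2) * cmod (\<integral>x. iexp ((2 * r) * x) * indicator {..T - 2 * s} x \<partial>std_normal_distribution)"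
      by (simp add: norm_mult power_mult_distrib)
    also have "\<dots> \<le> exp (2 * s\<^sup>2) * (2 / \<bar>2 * r\<bar>)"
      using r by (intro mult_left_mono norm_integral_iexp_atMost_le) auto
    finally show ?thesis by (simp add: abs_mult)
  qed
  moreover have "cmod (\<integral>\<omega>. (W k \<omega>)\<^sup>2 \<partial>M) \<le> m2"
    using integral_norm_bound[of M "\<lambda>\<omega>. (W k \<omega>)\<^sup>2"] square_W[OF k] by (simp add: norm_power)
  moreover have "cmod ((\<integral>x. g x \<partial>std_normal_distribution) * (\<integral>\<omega>. (W k \<omega>)\<^sup>2 \<partial>M) / of_real v)
      = cmod (\<integral>x. g x \<partial>std_normal_distribution) * cmod (\<integral>\<omega>. (W k \<omega>)\<^sup>2 \<partial>M) / v"
    using v_pos by (simp add: norm_mult norm_divide)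
  moreover have "A * B / v \<le> exp (2 * s\<^sup>2) / \<bar>r\<bar> * m2 / v"
    if "A \<le> exp (2 * s\<^sup>2) / \<bar>r\<bar>" "B \<le> m2" "0 \<le> B" for A B
    using that v_pos m2_pos by (intro divide_right_mono mult_mono) auto
  ultimately have "cmod (\<integral>\<omega>. (X k \<omega>)\<^sup>2 \<partial>M) \<le> exp (2 * s\<^sup>2) / \<bar>r\<bar> * m2 / v"
    by (metis norm_ge_zero)
  then show ?thesis by (simp add: c_def mult.commute)
qed

text \<open>Splits the second moment in direction \<theta> into an isotropic part, governed by
  E|X|^2, and a part governed by the pseudo-variance E X^2.\<close>

lemma inner_square_complex: "(\<theta> \<bullet> z)\<^sup>2 = ((cmod \<theta>)\<^sup>2 * (cmod z)\<^sup>2 + Re ((cnj \<theta>)\<^sup>2 * z\<^sup>2)) / 2" for z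
  unfolding cmod_power2 inner_complex_def by (simp add: power2_eq_square algebra_simps)

lemma U_measurable[measurable]: "k \<in> I \<Longrightarrow> U k \<in> borel_measurable M"
  unfolding U_def using X_measurable by measurable

lemma abs_U_le: "\<bar>U k \<omega>\<bar> \<le> cmod \<theta> * (cmod (X k \<omega>) + cmod (\<integral>\<omega>. X k \<omega> \<partial>M))"
  unfolding U_def
  by (rule order_trans[OF Cauchy_Schwarz_ineq2]) (intro mult_left_mono norm_triangle_ineq4 norm_ge_zero)

lemma moment_U: "k \<in> I \<Longrightarrow> has_moment p (\<lambda>\<omega>. of_real (U k \<omega>))"
proof (rule has_moment_bound[where X="\<lambda>\<omega>. \<theta> * (X k \<omega> - (\<integral>\<omega>. X k \<omega> \<partial>M))"])
  assume k: "k \<in> I"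
  show "has_moment p (\<lambda>\<omega>. \<theta> * (X k \<omega> - (\<integral>\<omega>. X k \<omega> \<partial>M)))"
    using p k by (intro has_moment_cmult has_moment_diff moment_X has_moment_const) auto
  show "(\<lambda>\<omega>. complex_of_real (U k \<omega>)) \<in> borel_measurable M" using k by measurable
  show "cmod (complex_of_real (U k \<omega>)) \<le> cmod (\<theta> * (X k \<omega> - (\<integral>\<omega>. X k \<omega> \<partial>M)))" for \<omega>
    unfolding norm_of_real norm_mult U_def by (rule Cauchy_Schwarz_ineq2)
qed (use p in simp)

lemma integrable_inner_X: "k \<in> I \<Longrightarrow> integrable M (\<lambda>\<omega>. \<theta> \<bullet> X k \<omega>)"
  using integrable_X by (rule integrable_inner_right)

lemma integrable_inner_X_square: "k \<in> I \<Longrightarrow> integrable M (\<lambda>\<omega>. (\<theta> \<bullet> X k \<omega>)\<^sup>2)"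
proof (rule Bochner_Integration.integrable_bound[of M "\<lambda>\<omega>. (cmod \<theta>)\<^sup>2 * (cmod (X k \<omega>))\<^sup>2"])
  assume k: "k \<in> I"
  show "integrable M (\<lambda>\<omega>. (cmod \<theta>)\<^sup>2 * (cmod (X k \<omega>))\<^sup>2)" using has_moment_square[OF moment2_X[OF k]] by simp
  show "(\<lambda>\<omega>. (\<theta> \<bullet> X k \<omega>)\<^sup>2) \<in> borel_measurable M" using k by measurable
  have "(\<theta> \<bullet> X k \<omega>)\<^sup>2 \<le> (cmod \<theta> * cmod (X k \<omega>))\<^sup>2" for \<omega>
    using Cauchy_Schwarz_ineq2 by (intro power2_le_iff_abs_le[THEN iffD2]) auto
  then show "AE \<omega> in M. norm ((\<theta> \<bullet> X k \<omega>)\<^sup>2) \<le> norm ((cmod \<theta>)\<^sup>2 * (cmod (X k \<omega>))\<^sup>2)"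
    by (simp add: power_mult_distrib)
qed

lemma expectation_U: "k \<in> I \<Longrightarrow> (\<integral>\<omega>. U k \<omega> \<partial>M) = 0"
  unfolding U_def inner_diff_right using integrable_inner_X integrable_X by (simp add: prob_space)

lemma expectation_U_square:
  assumes "k \<in> I"
  shows "(\<integral>\<omega>. (U k \<omega>)\<^sup>2 \<partial>M) = (\<integral>\<omega>. (\<theta> \<bullet> X k \<omega>)\<^sup>2 \<partial>M) - (\<theta> \<bullet> (\<integral>\<omega>. X k \<omega> \<partial>M))\<^sup>2"
proof -
  have "(\<theta> \<bullet> (\<integral>\<omega>. X k \<omega> \<partial>M)) = (\<integral>\<omega>. \<theta> \<bullet> X k \<omega> \<partial>M)"
    using integrable_X[OF assms] by simp
  then show ?thesis
    using variance_eq[OF integrable_inner_X[OF assms] integrable_inner_X_square[OF assms]]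
    unfolding U_def inner_diff_right by simp
qed

lemma expectation_U_square_le:
  assumes k: "k \<in> I"
  shows "(\<integral>\<omega>. (U k \<omega>)\<^sup>2 \<partial>M) \<le> (cmod \<theta>)\<^sup>2 * (exp (2 * s\<^sup>2) * c)"
proof -
  interpret N: real_distribution std_normal_distribution by (rule real_dist_normal_dist)
  have "(\<integral>\<omega>. (U k \<omega>)\<^sup>2 \<partial>M) \<le> (\<integral>\<omega>. (\<theta> \<bullet> X k \<omega>)\<^sup>2 \<partial>M)" unfolding expectation_U_square[OF k] by simp
  also have "\<dots> \<le> (\<integral>\<omega>. (cmod \<theta>)\<^sup>2 * (cmod (X k \<omega>))\<^sup>2 \<partial>M)"
  proof (rule integral_mono[OF integrable_inner_X_square[OF k]])
    show "integrable M (\<lambda>\<omega>. (cmod \<theta>)\<^sup>2 * (cmod (X k \<omega>))\<^sup>2)" using has_moment_square[OF moment2_X[OF k]] by simp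
    show "(\<theta> \<bullet> X k \<omega>)\<^sup>2 \<le> (cmod \<theta>)\<^sup>2 * (cmod (X k \<omega>))\<^sup>2" for \<omega>
      using Cauchy_Schwarz_ineq2[of \<theta> "X k \<omega>"] unfolding power_mult_distrib[symmetric]
      by (intro power2_le_iff_abs_le[THEN iffD2]) auto
  qed
  also have "\<dots> = (cmod \<theta>)\<^sup>2 * (exp (2 * s\<^sup>2) * Phi (T - 2 * s) * c)" by (simp add: square_X[OF k])
  also have "\<dots> \<le> (cmod \<theta>)\<^sup>2 * (exp (2 * s\<^sup>2) * 1 * c)"
    using c_pos N.cdf_bounded_prob by (intro mult_left_mono mult_right_mono) auto
  finally show ?thesis by simp
qed

lemma powr_U_le:
  assumes k: "k \<in> I"
  shows "(\<integral>\<omega>. \<bar>U k \<omega>\<bar> powr p \<partial>M)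
    \<le> (2 * cmod \<theta>) powr p * (exp ((p - 2) * s * T) * exp (2 * s\<^sup>2) * C * c powr (p / 2) + exp (p * s\<^sup>2 / 2) * c powr (p / 2))"
proof -
  let ?m = "cmod (\<integral>\<omega>. X k \<omega> \<partial>M)"
  have iX: "integrable M (\<lambda>\<omega>. cmod (X k \<omega>) powr p)" using moment_X[OF k] by auto
  have "(\<integral>\<omega>. \<bar>U k \<omega>\<bar> powr p \<partial>M) \<le> (\<integral>\<omega>. (2 * cmod \<theta>) powr p * (cmod (X k \<omega>) powr p + ?m powr p) \<partial>M)"
  proof (rule integral_mono)
    show "integrable M (\<lambda>\<omega>. \<bar>U k \<omega>\<bar> powr p)" using has_momentD(2)[OF moment_U[OF k]] by simp
    show "integrable M (\<lambda>\<omega>. (2 * cmod \<theta>) powr p * (cmod (X k \<omega>) powr p + ?m powr p))" using iX by simp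
    fix \<omega>
    have "\<bar>U k \<omega>\<bar> powr p \<le> (cmod \<theta> * (cmod (X k \<omega>) + ?m)) powr p"
      using p by (intro powr_mono2 abs_U_le) auto
    also have "\<dots> = cmod \<theta> powr p * (cmod (X k \<omega>) + ?m) powr p" by (simp add: powr_mult)
    also have "\<dots> \<le> cmod \<theta> powr p * (2 powr p * (cmod (X k \<omega>) powr p + ?m powr p))"
      using p by (intro mult_left_mono powr_add_le') auto
    finally show "\<bar>U k \<omega>\<bar> powr p \<le> (2 * cmod \<theta>) powr p * (cmod (X k \<omega>) powr p + ?m powr p)"
      by (simp add: powr_mult mult_ac)
  qed
  also have "\<dots> = (2 * cmod \<theta>) powr p * ((\<integral>\<omega>. cmod (X k \<omega>) powr p \<partial>M) + ?m powr p)"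
    using iX by (simp add: prob_space)
  also have "\<dots> \<le> (2 * cmod \<theta>) powr p * (exp ((p - 2) * s * T) * exp (2 * s\<^sup>2) * C * c powr (p / 2) + exp (p * s\<^sup>2 / 2) * c powr (p / 2))"
  proof (intro mult_left_mono add_mono powr_X_le k)
    have "?m powr p \<le> (exp (s\<^sup>2 / 2) * sqrt c) powr p"
      using p by (intro powr_mono2 norm_expectation_X_le k) auto
    also have "\<dots> = exp (p * s\<^sup>2 / 2) * c powr (p / 2)"
      using c_pos by (simp add: powr_mult powr_def[of "exp _"] powr_half_sqrt[symmetric] powr_powr)
    finally show "?m powr p \<le> exp (p * s\<^sup>2 / 2) * c powr (p / 2)" .
  qed simp
  finally show ?thesis .
qed

lemma indep_U: "indep_vars (\<lambda>_. borel) (\<lambda>k \<omega>. iexp (U k \<omega>)) I"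
proof -
  \<comment> \<open>Exhibits U k as a function of the pair alone, its mean being a constant, so that
    the independence of the pairs carries over.\<close>
  define f where "f k = (\<lambda>q::real \<times> complex. iexp (\<theta> \<bullet> ((if fst q \<le> T then exp (Complex s r * of_real (fst q)) * snd q else 0) / of_real (sqrt v) - (\<integral>\<omega>. X k \<omega> \<partial>M))))" for k
  have [measurable]: "fst \<in> borel_measurable (borel :: (real \<times> complex) measure)"
    "snd \<in> borel_measurable (borel :: (real \<times> complex) measure)"
    by (intro borel_measurable_continuous_onI continuous_intros)+
  have [measurable]: "(\<lambda>q. exp (Complex s r * of_real (fst q))) \<in> borel_measurable (borel :: (real \<times> complex) measure)"
    by (intro borel_measurable_continuous_onI continuous_intros)
  have "f k \<in> borel_measurable borel" for k unfolding f_def by measurable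
  then have "indep_vars (\<lambda>_. borel) (\<lambda>k \<omega>. f k (\<xi> k \<omega>, W k \<omega>)) I"
    by (intro indep_vars_compose2[OF indep_pairs])
  then show ?thesis unfolding f_def U_def X_def Y_def fst_conv snd_conv .
qed

text \<open>The difference is the mean of the discarded part. First moments tilt the Gaussian only
  by s, and T - s will lie far in the tail while T - 2 s stays bounded: the discarded part matters
  for the variance but not for the mean.\<close>

lemma truncation_bias_le:
  assumes k: "k \<in> I"
  shows "cmod ((\<integral>\<omega>. X k \<omega> \<partial>M) - (\<integral>\<omega>. Y k \<omega> \<partial>M) / of_real (sqrt v)) \<le> exp (s\<^sup>2 / 2) * std_normal_tail (T - s) * sqrt c"
proof -
  have iYv: "integrable M (\<lambda>\<omega>. Y k \<omega> / of_real (sqrt v))" using integrable_Y[OF k] by simp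
  have iW: "integrable M (\<lambda>\<omega>. cmod (W k \<omega>))" using integrable_W[OF k] by (rule integrable_norm)
  have eq: "(\<integral>\<omega>. X k \<omega> \<partial>M) - (\<integral>\<omega>. Y k \<omega> \<partial>M) / of_real (sqrt v) = (\<integral>\<omega>. X k \<omega> - Y k \<omega> / of_real (sqrt v) \<partial>M)"
    using integrable_X[OF k] iYv by (subst Bochner_Integration.integral_diff) auto
  have "cmod ((\<integral>\<omega>. X k \<omega> \<partial>M) - (\<integral>\<omega>. Y k \<omega> \<partial>M) / of_real (sqrt v)) \<le> (\<integral>\<omega>. cmod (X k \<omega> - Y k \<omega> / of_real (sqrt v)) \<partial>M)"
    unfolding eq by (rule integral_norm_bound)
  also have "\<dots> = (\<integral>\<omega>. (exp (s * \<xi> k \<omega>) * indicator {T<..} (\<xi> k \<omega>)) * cmod (W k \<omega>) / sqrt v \<partial>M)"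
  proof (rule Bochner_Integration.integral_cong[OF refl])
    fix \<omega>
    show "cmod (X k \<omega> - Y k \<omega> / of_real (sqrt v)) = (exp (s * \<xi> k \<omega>) * indicator {T<..} (\<xi> k \<omega>)) * cmod (W k \<omega>) / sqrt v"
    proof (cases "\<xi> k \<omega> \<le> T")
      case True
      then show ?thesis by (simp add: X_def)
    next
      case False
      then have "cmod (X k \<omega> - Y k \<omega> / of_real (sqrt v)) = cmod (Y k \<omega>) / \<bar>sqrt v\<bar>"
        by (simp only: X_def if_False div_0 diff_0 norm_minus_cancel norm_divide norm_of_real)
      with False show ?thesis using v_pos by (simp add: norm_Y)
    qed
  qed
  also have "\<dots> = (\<integral>\<omega>. (exp (s * \<xi> k \<omega>) * indicator {T<..} (\<xi> k \<omega>)) * cmod (W k \<omega>) \<partial>M) / sqrt v"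
    by (rule integral_divide_zero)
  also have "(\<integral>\<omega>. (exp (s * \<xi> k \<omega>) * indicator {T<..} (\<xi> k \<omega>)) * cmod (W k \<omega>) \<partial>M)
      = (\<integral>x. exp (s * x) * indicator {T<..} x \<partial>std_normal_distribution) * (\<integral>\<omega>. cmod (W k \<omega>) \<partial>M)"
    by (rule integral_prod[OF k, of "\<lambda>x. exp (s * x) * indicator {T<..} x" cmod])
      (auto intro: integrable_std_normal_exp integrable_real_mult_indicator iW)
  also have "(\<integral>x. exp (s * x) * indicator {T<..} x \<partial>std_normal_distribution) = exp (s\<^sup>2 / 2) * std_normal_tail (T - s)"
    unfolding std_normal_tail_def by (rule integral_std_normal_exp_greaterThan)
  also have "exp (s\<^sup>2 / 2) * std_normal_tail (T - s) * (\<integral>\<omega>. cmod (W k \<omega>) \<partial>M) / sqrt v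
      \<le> exp (s\<^sup>2 / 2) * std_normal_tail (T - s) * sqrt m2 / sqrt v"
    using v_pos norm_W_le[OF k] by (intro divide_right_mono mult_left_mono) (auto simp: std_normal_tail_def)
  also have "\<dots> = exp (s\<^sup>2 / 2) * std_normal_tail (T - s) * sqrt c" by (simp add: c_def real_sqrt_divide)
  finally show ?thesis .
qed

lemma prob_exceed:
  assumes k: "k \<in> I"
  shows "prob {\<omega> \<in> space M. T < \<xi> k \<omega>} = std_normal_tail T"
proof -
  note [measurable] = \<xi>_measurable[OF k]
  have "std_normal_tail T = measure (distr M borel (\<xi> k)) {T<..}" by (simp add: std_normal_tail_def distr_\<xi>[OF k])
  also have "\<dots> = prob {\<omega> \<in> space M. T < \<xi> k \<omega>}"
    by (subst measure_distr) (auto intro!: arg_cong[where f=prob])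
  finally show ?thesis by simp
qed

section \<open>Comparison with the Gaussian characteristic function\<close>

text \<open>Where some \<xi> exceeds T the integrands differ by at most 2, and the union bound gives
  the first term. Elsewhere the exponents differ only by the deterministic sum of the mean
  corrections, which gives the second.\<close>

lemma char_truncation_le:
  "cmod ((\<integral>\<omega>. iexp (\<theta> \<bullet> complex_standardize M S \<omega>) \<partial>M) - (\<Prod>k\<in>I. \<integral>\<omega>. iexp (U k \<omega>) \<partial>M))
    \<le> 2 * (real (card I) * std_normal_tail T) + cmod \<theta> * (real (card I) * (exp (s\<^sup>2 / 2) * std_normal_tail (T - s) * sqrt c))"
proof -
  define b where "b k = (\<integral>\<omega>. X k \<omega> \<partial>M) - (\<integral>\<omega>. Y k \<omega> \<partial>M) / of_real (sqrt v)" for k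
  define B where "B = (\<Sum>k\<in>I. cmod (b k))"
  define E where "E k = {\<omega> \<in> space M. T < \<xi> k \<omega>}" for k
  have Em: "E k \<in> events" if "k \<in> I" for k
    unfolding E_def using \<xi>_measurable[OF that] by measurable
  have [measurable]: "S \<in> borel_measurable M" using moment_S by auto
  have std: "complex_standardize M S \<omega> = (\<Sum>k\<in>I. (Y k \<omega> - (\<integral>\<omega>. Y k \<omega> \<partial>M)) / of_real (sqrt v))" for \<omega>
    unfolding complex_standardize_def expectation_S v_def[symmetric] S_def
    by (simp add: sum_subtractf sum_divide_distrib diff_divide_distrib)
  have [measurable]: "(\<lambda>\<omega>. complex_standardize M S \<omega>) \<in> borel_measurable M"
    unfolding complex_standardize_def by measurable
  have mi: "(\<lambda>x. iexp x) \<in> borel_measurable borel" by (intro borel_measurable_continuous_onI continuous_intros)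
  have m1[measurable]: "(\<lambda>\<omega>. iexp (\<theta> \<bullet> complex_standardize M S \<omega>)) \<in> borel_measurable M"
    by (rule measurable_compose[OF _ mi]) measurable
  have m2[measurable]: "(\<lambda>\<omega>. iexp (\<Sum>k\<in>I. U k \<omega>)) \<in> borel_measurable M"
    by (rule measurable_compose[OF _ mi]) measurable
  have i1: "integrable M (\<lambda>\<omega>. iexp (\<theta> \<bullet> complex_standardize M S \<omega>))"
    "integrable M (\<lambda>\<omega>. iexp (\<Sum>k\<in>I. U k \<omega>))"
    by (intro integrable_const_bound[where B=1]; simp)+
  have iE: "integrable M (indicator (E k) :: 'a \<Rightarrow> real)" if "k \<in> I" for k
    using Em[OF that] by (intro integrable_real_indicator) (auto simp: less_top[symmetric])
  have iU: "integrable M (\<lambda>\<omega>. iexp (U k \<omega>))" if "k \<in> I" for k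
    by (rule integrable_const_bound[where B=1]) (use that in \<open>auto intro!: measurable_compose[OF U_measurable mi]\<close>)
  have "(\<Prod>k\<in>I. \<integral>\<omega>. iexp (U k \<omega>) \<partial>M) = (\<integral>\<omega>. (\<Prod>k\<in>I. iexp (U k \<omega>)) \<partial>M)"
    by (rule indep_vars_lebesgue_integral[symmetric, OF finite_I indep_U iU])
  also have "\<dots> = (\<integral>\<omega>. iexp (\<Sum>k\<in>I. U k \<omega>) \<partial>M)"
    using finite_I by (simp add: exp_sum sum_distrib_left)
  finally have eq: "(\<integral>\<omega>. iexp (\<theta> \<bullet> complex_standardize M S \<omega>) \<partial>M) - (\<Prod>k\<in>I. \<integral>\<omega>. iexp (U k \<omega>) \<partial>M)
      = (\<integral>\<omega>. iexp (\<theta> \<bullet> complex_standardize M S \<omega>) - iexp (\<Sum>k\<in>I. U k \<omega>) \<partial>M)"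
    using i1 by simp
  have "cmod ((\<integral>\<omega>. iexp (\<theta> \<bullet> complex_standardize M S \<omega>) \<partial>M) - (\<Prod>k\<in>I. \<integral>\<omega>. iexp (U k \<omega>) \<partial>M))
      \<le> (\<integral>\<omega>. cmod (iexp (\<theta> \<bullet> complex_standardize M S \<omega>) - iexp (\<Sum>k\<in>I. U k \<omega>)) \<partial>M)"
    unfolding eq by (rule integral_norm_bound)
  also have "\<dots> \<le> (\<integral>\<omega>. 2 * (\<Sum>k\<in>I. indicator (E k) \<omega>) + cmod \<theta> * B \<partial>M)"
  proof (rule integral_mono)
    show "integrable M (\<lambda>\<omega>. cmod (iexp (\<theta> \<bullet> complex_standardize M S \<omega>) - iexp (\<Sum>k\<in>I. U k \<omega>)))"
      by (intro integrable_norm Bochner_Integration.integrable_diff i1)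
    show "integrable M (\<lambda>\<omega>. 2 * (\<Sum>k\<in>I. indicator (E k) \<omega>) + cmod \<theta> * B)"
      by (intro Bochner_Integration.integrable_add integrable_mult_right Bochner_Integration.integrable_sum iE integrable_const)
    fix \<omega> assume \<omega>: "\<omega> \<in> space M"
    have B0: "0 \<le> B" by (simp add: B_def sum_nonneg)
    show "cmod (iexp (\<theta> \<bullet> complex_standardize M S \<omega>) - iexp (\<Sum>k\<in>I. U k \<omega>)) \<le> 2 * (\<Sum>k\<in>I. indicator (E k) \<omega>) + cmod \<theta> * B"
    proof (cases "\<exists>k\<in>I. \<omega> \<in> E k")
      case True
      then obtain k where k: "k \<in> I" "\<omega> \<in> E k" by auto
      have "indicator (E k) \<omega> \<le> (\<Sum>k\<in>I. indicator (E k) \<omega> :: real)"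
        using k finite_I by (intro member_le_sum) auto
      then have 1: "1 \<le> (\<Sum>k\<in>I. indicator (E k) \<omega> :: real)" using k by simp
      have "cmod (iexp (\<theta> \<bullet> complex_standardize M S \<omega>) - iexp (\<Sum>k\<in>I. U k \<omega>)) \<le> 1 + 1"
        by (rule order_trans[OF norm_triangle_ineq4]) simp
      moreover have "0 \<le> cmod \<theta> * B" using B0 by simp
      ultimately show ?thesis using 1 by linarith
    next
      case False
      then have le: "\<xi> k \<omega> \<le> T" if "k \<in> I" for k using that \<omega> by (auto simp: E_def not_less)
      have eq: "\<theta> \<bullet> complex_standardize M S \<omega> - (\<Sum>k\<in>I. U k \<omega>) = \<theta> \<bullet> (\<Sum>k\<in>I. b k)"
        unfolding std U_def inner_sum_right sum_subtractf[symmetric] b_def inner_diff_right[symmetric]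
        using le by (intro sum.cong refl arg_cong[where f="\<lambda>z. \<theta> \<bullet> z"]) (simp add: X_def diff_divide_distrib)
      have "cmod (iexp (\<theta> \<bullet> complex_standardize M S \<omega>) - iexp (\<Sum>k\<in>I. U k \<omega>)) \<le> \<bar>\<theta> \<bullet> (\<Sum>k\<in>I. b k)\<bar>"
        unfolding eq[symmetric] by (rule norm_iexp_diff_le)
      also have "\<dots> \<le> cmod \<theta> * cmod (\<Sum>k\<in>I. b k)" by (rule Cauchy_Schwarz_ineq2)
      also have "\<dots> \<le> cmod \<theta> * B" unfolding B_def by (intro mult_left_mono norm_sum) auto
      also have "\<dots> \<le> 2 * (\<Sum>k\<in>I. indicator (E k) \<omega>) + cmod \<theta> * B" by (simp add: sum_nonneg)
      finally show ?thesis .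
    qed
  qed
  also have "\<dots> = 2 * (\<Sum>k\<in>I. prob (E k)) + cmod \<theta> * B"
  proof -
    have "(\<integral>\<omega>. (\<Sum>k\<in>I. indicator (E k) \<omega>) \<partial>M) = (\<Sum>k\<in>I. prob (E k))"
      using iE Em by (subst Bochner_Integration.integral_sum) (auto intro!: sum.cong)
    moreover have "integrable M (\<lambda>\<omega>. \<Sum>k\<in>I. indicator (E k) \<omega> :: real)"
      by (intro Bochner_Integration.integrable_sum iE)
    ultimately show ?thesis by (simp add: prob_space)
  qed
  also have "(\<Sum>k\<in>I. prob (E k)) = real (card I) * std_normal_tail T"
    using prob_exceed by (simp add: E_def)
  also have "B \<le> (\<Sum>k\<in>I. exp (s\<^sup>2 / 2) * std_normal_tail (T - s) * sqrt c)"
    unfolding B_def b_def by (intro sum_mono truncation_bias_le)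
  finally show ?thesis by (simp add: mult_left_mono)
qed

text \<open>All factors have modulus at most 1, so by telescoping the products differ by at most the
  sum of the differences of the factors.\<close>

lemma char_product_le:
  "cmod ((\<Prod>k\<in>I. \<integral>\<omega>. iexp (U k \<omega>) \<partial>M) - of_real (exp (- (\<Sum>k\<in>I. \<integral>\<omega>. (U k \<omega>)\<^sup>2 \<partial>M) / 2)))
    \<le> real (card I) * ((2 * cmod \<theta>) powr p * (exp ((p - 2) * s * T) * exp (2 * s\<^sup>2) * C * c powr (p / 2) + exp (p * s\<^sup>2 / 2) * c powr (p / 2))
        + ((cmod \<theta>)\<^sup>2 * (exp (2 * s\<^sup>2) * c))\<^sup>2 / 8)"
proof -
  have "(\<Prod>k\<in>I. exp (- (\<integral>\<omega>. (U k \<omega>)\<^sup>2 \<partial>M) / 2)) = exp (- (\<Sum>k\<in>I. \<integral>\<omega>. (U k \<omega>)\<^sup>2 \<partial>M) / 2)"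
    using finite_I by (simp add: exp_sum[symmetric] sum_negf sum_divide_distrib)
  then have "of_real (exp (- (\<Sum>k\<in>I. \<integral>\<omega>. (U k \<omega>)\<^sup>2 \<partial>M) / 2))
      = (\<Prod>k\<in>I. complex_of_real (exp (- (\<integral>\<omega>. (U k \<omega>)\<^sup>2 \<partial>M) / 2)))"
    by (metis of_real_prod)
  then have "cmod ((\<Prod>k\<in>I. \<integral>\<omega>. iexp (U k \<omega>) \<partial>M) - of_real (exp (- (\<Sum>k\<in>I. \<integral>\<omega>. (U k \<omega>)\<^sup>2 \<partial>M) / 2)))
      = cmod ((\<Prod>k\<in>I. \<integral>\<omega>. iexp (U k \<omega>) \<partial>M) - (\<Prod>k\<in>I. complex_of_real (exp (- (\<integral>\<omega>. (U k \<omega>)\<^sup>2 \<partial>M) / 2))))"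
    by simp
  also have "\<dots> \<le> (\<Sum>k\<in>I. cmod ((\<integral>\<omega>. iexp (U k \<omega>) \<partial>M) - of_real (exp (- (\<integral>\<omega>. (U k \<omega>)\<^sup>2 \<partial>M) / 2))))"
  proof (rule norm_prod_diff)
    fix k assume "k \<in> I"
    have "cmod (\<integral>\<omega>. iexp (U k \<omega>) \<partial>M) \<le> (\<integral>\<omega>. cmod (iexp (U k \<omega>)) \<partial>M)" by (rule integral_norm_bound)
    then show "cmod (\<integral>\<omega>. iexp (U k \<omega>) \<partial>M) \<le> 1" by (simp add: prob_space)
    have "exp (- (\<integral>\<omega>. (U k \<omega>)\<^sup>2 \<partial>M) / 2) \<le> 1" by simp
    then show "cmod (of_real (exp (- (\<integral>\<omega>. (U k \<omega>)\<^sup>2 \<partial>M) / 2))) \<le> 1" by (simp only: norm_of_real abs_exp_cancel)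
  qed
  also have "\<dots> \<le> (\<Sum>k\<in>I. (2 * cmod \<theta>) powr p * (exp ((p - 2) * s * T) * exp (2 * s\<^sup>2) * C * c powr (p / 2) + exp (p * s\<^sup>2 / 2) * c powr (p / 2))
        + ((cmod \<theta>)\<^sup>2 * (exp (2 * s\<^sup>2) * c))\<^sup>2 / 8)"
  proof (rule sum_mono)
    fix k assume k: "k \<in> I"
    have "cmod ((\<integral>\<omega>. iexp (U k \<omega>) \<partial>M) - of_real (exp (- (\<integral>\<omega>. (U k \<omega>)\<^sup>2 \<partial>M) / 2)))
        \<le> (\<integral>\<omega>. \<bar>U k \<omega>\<bar> powr p \<partial>M) + (\<integral>\<omega>. (U k \<omega>)\<^sup>2 \<partial>M)\<^sup>2 / 8"
      using has_momentD(2)[OF moment_U[OF k]] p by (intro char_second_order_bound U_measurable[OF k] expectation_U[OF k]) auto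
    also have "\<dots> \<le> (2 * cmod \<theta>) powr p * (exp ((p - 2) * s * T) * exp (2 * s\<^sup>2) * C * c powr (p / 2) + exp (p * s\<^sup>2 / 2) * c powr (p / 2))
        + ((cmod \<theta>)\<^sup>2 * (exp (2 * s\<^sup>2) * c))\<^sup>2 / 8"
      by (intro add_mono powr_U_le k divide_right_mono power_mono expectation_U_square_le) auto
    finally show "cmod ((\<integral>\<omega>. iexp (U k \<omega>) \<partial>M) - of_real (exp (- (\<integral>\<omega>. (U k \<omega>)\<^sup>2 \<partial>M) / 2)))
      \<le> (2 * cmod \<theta>) powr p * (exp ((p - 2) * s * T) * exp (2 * s\<^sup>2) * C * c powr (p / 2) + exp (p * s\<^sup>2 / 2) * c powr (p / 2))
        + ((cmod \<theta>)\<^sup>2 * (exp (2 * s\<^sup>2) * c))\<^sup>2 / 8" .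
  qed
  finally show ?thesis by simp
qed

lemma sum_mean_square_le:
  "(\<Sum>k\<in>I. (\<theta> \<bullet> (\<integral>\<omega>. X k \<omega> \<partial>M))\<^sup>2) \<le> real (card I) * ((cmod \<theta>)\<^sup>2 * (exp (s\<^sup>2) * c))"
proof -
  have "(\<theta> \<bullet> (\<integral>\<omega>. X k \<omega> \<partial>M))\<^sup>2 \<le> (cmod \<theta>)\<^sup>2 * (exp (s\<^sup>2) * c)" if k: "k \<in> I" for k
  proof -
    have "\<bar>\<theta> \<bullet> (\<integral>\<omega>. X k \<omega> \<partial>M)\<bar> \<le> cmod \<theta> * cmod (\<integral>\<omega>. X k \<omega> \<partial>M)" by (rule Cauchy_Schwarz_ineq2)
    also have "\<dots> \<le> cmod \<theta> * (exp (s\<^sup>2 / 2) * sqrt c)" by (intro mult_left_mono norm_expectation_X_le k) auto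
    finally have "\<bar>\<theta> \<bullet> (\<integral>\<omega>. X k \<omega> \<partial>M)\<bar>\<^sup>2 \<le> (cmod \<theta> * (exp (s\<^sup>2 / 2) * sqrt c))\<^sup>2" by (rule power_mono) simp
    also have "\<dots> = (cmod \<theta>)\<^sup>2 * (exp (s\<^sup>2) * c)"
      using c_pos by (simp add: power_mult_distrib flip: exp_double)
    finally show ?thesis by simp
  qed
  then have "(\<Sum>k\<in>I. (\<theta> \<bullet> (\<integral>\<omega>. X k \<omega> \<partial>M))\<^sup>2) \<le> (\<Sum>k\<in>I. (cmod \<theta>)\<^sup>2 * (exp (s\<^sup>2) * c))" by (rule sum_mono)
  then show ?thesis by simp
qed

text \<open>By \<open>inner_square_complex\<close> the isotropic part yields half of |\<theta>|^2.
  What remains is the pseudo-variance, smaller than the second moment by 1 / |r|, and the squared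
  means, smaller by exp(-s^2).\<close>

lemma sum_U_square_complex:
  assumes r: "r \<noteq> 0"
  shows "\<bar>(\<Sum>k\<in>I. \<integral>\<omega>. (U k \<omega>)\<^sup>2 \<partial>M) - real (card I) * (exp (2 * s\<^sup>2) * c) * Phi (T - 2 * s) * (cmod \<theta>)\<^sup>2 / 2\<bar>
    \<le> real (card I) * (exp (2 * s\<^sup>2) * c) * (cmod \<theta>)\<^sup>2 / \<bar>r\<bar> + real (card I) * ((cmod \<theta>)\<^sup>2 * (exp (s\<^sup>2) * c))"
proof -
  have iX2: "integrable M (\<lambda>\<omega>. (X k \<omega>)\<^sup>2)" if "k \<in> I" for k
    using integrable_mult_of_square[OF moment2_X[OF that] moment2_X[OF that]] by (simp add: power2_eq_square)
  have 1: "(\<integral>\<omega>. (\<theta> \<bullet> X k \<omega>)\<^sup>2 \<partial>M) = exp (2 * s\<^sup>2) * c * Phi (T - 2 * s) * (cmod \<theta>)\<^sup>2 / 2 + Re ((cnj \<theta>)\<^sup>2 * (\<integral>\<omega>. (X k \<omega>)\<^sup>2 \<partial>M)) / 2"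
    if k: "k \<in> I" for k
  proof -
    have iR: "integrable M (\<lambda>\<omega>. Re ((cnj \<theta>)\<^sup>2 * (X k \<omega>)\<^sup>2))"
      by (intro integrable_Re integrable_mult_right iX2 k)
    have "(\<integral>\<omega>. (\<theta> \<bullet> X k \<omega>)\<^sup>2 \<partial>M)
        = (\<integral>\<omega>. (cmod \<theta>)\<^sup>2 * (cmod (X k \<omega>))\<^sup>2 + Re ((cnj \<theta>)\<^sup>2 * (X k \<omega>)\<^sup>2) \<partial>M) / 2"
      unfolding inner_square_complex by (rule integral_divide_zero)
    also have "(\<integral>\<omega>. (cmod \<theta>)\<^sup>2 * (cmod (X k \<omega>))\<^sup>2 + Re ((cnj \<theta>)\<^sup>2 * (X k \<omega>)\<^sup>2) \<partial>M)
        = (\<integral>\<omega>. (cmod \<theta>)\<^sup>2 * (cmod (X k \<omega>))\<^sup>2 \<partial>M) + (\<integral>\<omega>. Re ((cnj \<theta>)\<^sup>2 * (X k \<omega>)\<^sup>2) \<partial>M)"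
      by (intro Bochner_Integration.integral_add iR integrable_mult_right has_moment_square[OF moment2_X[OF k]]) simp
    also have "(\<integral>\<omega>. Re ((cnj \<theta>)\<^sup>2 * (X k \<omega>)\<^sup>2) \<partial>M) = Re (\<integral>\<omega>. (cnj \<theta>)\<^sup>2 * (X k \<omega>)\<^sup>2 \<partial>M)"
      by (intro integral_Re integrable_mult_right iX2 k)
    also have "(\<integral>\<omega>. (cnj \<theta>)\<^sup>2 * (X k \<omega>)\<^sup>2 \<partial>M) = (cnj \<theta>)\<^sup>2 * (\<integral>\<omega>. (X k \<omega>)\<^sup>2 \<partial>M)" by (rule integral_mult_right_zero)
    finally show ?thesis by (simp only: integral_mult_right_zero square_X[OF k]) (simp add: add_divide_distrib mult_ac)
  qed
  let ?D = "\<Sum>k\<in>I. Re ((cnj \<theta>)\<^sup>2 * (\<integral>\<omega>. (X k \<omega>)\<^sup>2 \<partial>M)) / 2"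
  let ?m = "\<Sum>k\<in>I. (\<theta> \<bullet> (\<integral>\<omega>. X k \<omega> \<partial>M))\<^sup>2"
  have "(\<Sum>k\<in>I. \<integral>\<omega>. (U k \<omega>)\<^sup>2 \<partial>M) = (\<Sum>k\<in>I. exp (2 * s\<^sup>2) * c * Phi (T - 2 * s) * (cmod \<theta>)\<^sup>2 / 2
      + Re ((cnj \<theta>)\<^sup>2 * (\<integral>\<omega>. (X k \<omega>)\<^sup>2 \<partial>M)) / 2 - (\<theta> \<bullet> (\<integral>\<omega>. X k \<omega> \<partial>M))\<^sup>2)"
    by (rule sum.cong[OF refl]) (simp only: expectation_U_square 1)
  also have "\<dots> = real (card I) * (exp (2 * s\<^sup>2) * c) * Phi (T - 2 * s) * (cmod \<theta>)\<^sup>2 / 2 + ?D - ?m"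
    unfolding sum_subtractf sum.distrib by simp
  finally have eq: "(\<Sum>k\<in>I. \<integral>\<omega>. (U k \<omega>)\<^sup>2 \<partial>M) - real (card I) * (exp (2 * s\<^sup>2) * c) * Phi (T - 2 * s) * (cmod \<theta>)\<^sup>2 / 2 = ?D - ?m"
    by simp
  have "\<bar>?D\<bar> \<le> (\<Sum>k\<in>I. (exp (2 * s\<^sup>2) * c) * (cmod \<theta>)\<^sup>2 / \<bar>r\<bar>)"
  proof (rule order_trans[OF sum_abs sum_mono])
    fix k assume k: "k \<in> I"
    have "\<bar>Re ((cnj \<theta>)\<^sup>2 * (\<integral>\<omega>. (X k \<omega>)\<^sup>2 \<partial>M)) / 2\<bar> \<le> \<bar>Re ((cnj \<theta>)\<^sup>2 * (\<integral>\<omega>. (X k \<omega>)\<^sup>2 \<partial>M))\<bar>" by simp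
    also have "\<dots> \<le> cmod ((cnj \<theta>)\<^sup>2 * (\<integral>\<omega>. (X k \<omega>)\<^sup>2 \<partial>M))" by (rule abs_Re_le_cmod)
    also have "\<dots> = (cmod \<theta>)\<^sup>2 * cmod (\<integral>\<omega>. (X k \<omega>)\<^sup>2 \<partial>M)" by (simp add: norm_mult norm_power)
    also have "\<dots> \<le> (cmod \<theta>)\<^sup>2 * (exp (2 * s\<^sup>2) * c / \<bar>r\<bar>)"
      by (intro mult_left_mono norm_expectation_X_square_le k r) simp
    finally show "\<bar>Re ((cnj \<theta>)\<^sup>2 * (\<integral>\<omega>. (X k \<omega>)\<^sup>2 \<partial>M)) / 2\<bar> \<le> (exp (2 * s\<^sup>2) * c) * (cmod \<theta>)\<^sup>2 / \<bar>r\<bar>"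
      by (simp add: mult_ac)
  qed
  then have "\<bar>?D\<bar> \<le> real (card I) * (exp (2 * s\<^sup>2) * c) * (cmod \<theta>)\<^sup>2 / \<bar>r\<bar>" by (simp add: mult_ac)
  moreover have "0 \<le> ?m" by (simp add: sum_nonneg)
  ultimately show ?thesis using sum_mean_square_le unfolding eq by linarith
qed

text \<open>For real summands the pseudo-variance equals the second moment, and only the real part
  of \<theta> is seen.\<close>

lemma sum_U_square_real:
  assumes r: "r = 0" and W: "\<And>k \<omega>. k \<in> I \<Longrightarrow> Im (W k \<omega>) = 0"
  shows "\<bar>(\<Sum>k\<in>I. \<integral>\<omega>. (U k \<omega>)\<^sup>2 \<partial>M) - real (card I) * (exp (2 * s\<^sup>2) * c) * Phi (T - 2 * s) * (Re \<theta>)\<^sup>2\<bar>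
    \<le> real (card I) * ((cmod \<theta>)\<^sup>2 * (exp (s\<^sup>2) * c))"
proof -
  have 1: "(\<integral>\<omega>. (\<theta> \<bullet> X k \<omega>)\<^sup>2 \<partial>M) = exp (2 * s\<^sup>2) * c * Phi (T - 2 * s) * (Re \<theta>)\<^sup>2" if k: "k \<in> I" for k
  proof -
    have "Im (exp (Complex s r * of_real x)) = 0" for x
      using r by (simp add: Im_exp)
    then have "Im (X k \<omega>) = 0" for \<omega>
      by (simp add: X_def Y_def Im_divide_of_real W[OF k])
    then have "(\<theta> \<bullet> X k \<omega>)\<^sup>2 = (Re \<theta>)\<^sup>2 * (cmod (X k \<omega>))\<^sup>2" for \<omega>
      by (simp add: inner_complex_def cmod_power2 power_mult_distrib)
    then show ?thesis by (simp only: integral_mult_right_zero square_X[OF k]) (simp add: mult_ac)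
  qed
  let ?m = "\<Sum>k\<in>I. (\<theta> \<bullet> (\<integral>\<omega>. X k \<omega> \<partial>M))\<^sup>2"
  have "(\<Sum>k\<in>I. \<integral>\<omega>. (U k \<omega>)\<^sup>2 \<partial>M) = (\<Sum>k\<in>I. exp (2 * s\<^sup>2) * c * Phi (T - 2 * s) * (Re \<theta>)\<^sup>2 - (\<theta> \<bullet> (\<integral>\<omega>. X k \<omega> \<partial>M))\<^sup>2)"
    by (rule sum.cong[OF refl]) (simp only: expectation_U_square 1)
  also have "\<dots> = real (card I) * (exp (2 * s\<^sup>2) * c) * Phi (T - 2 * s) * (Re \<theta>)\<^sup>2 - ?m"
    unfolding sum_subtractf by simp
  finally have eq: "(\<Sum>k\<in>I. \<integral>\<omega>. (U k \<omega>)\<^sup>2 \<partial>M) - real (card I) * (exp (2 * s\<^sup>2) * c) * Phi (T - 2 * s) * (Re \<theta>)\<^sup>2 = - ?m"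
    by simp
  have "0 \<le> ?m" by (simp add: sum_nonneg)
  then show ?thesis using sum_mean_square_le unfolding eq by linarith
qed

text \<open>The sum of the second moments of the Y k divided by the variance of \<open>S\<close>. By
  \<open>v_le\<close> and \<open>v_ge\<close> it tends to 1 as s grows; expressing \<open>c\<close>
  through it leaves bounds in N, s and T.\<close>

definition \<rho> :: real where "\<rho> = real (card I) * (exp (2 * s\<^sup>2) * c)"

lemma \<rho>_bounds: "1 \<le> \<rho>" "\<rho> * (1 - exp (- s\<^sup>2)) \<le> 1"
proof -
  let ?A = "real (card I) * (exp (2 * s\<^sup>2) * m2)"
  have \<rho>: "\<rho> = ?A / v" by (simp add: \<rho>_def c_def)
  show "1 \<le> \<rho>" unfolding \<rho> using v_le v_pos by (simp add: le_divide_eq_1)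
  have "\<rho> * (1 - exp (- s\<^sup>2)) = ?A * (1 - exp (- s\<^sup>2)) / v" by (simp add: \<rho>)
  then show "\<rho> * (1 - exp (- s\<^sup>2)) \<le> 1" using v_ge v_pos by (simp add: divide_le_eq_1)
qed

lemma c_eq: "c = \<rho> / (real (card I) * exp (2 * s\<^sup>2))"
  using card_I by (simp add: \<rho>_def)

lemma powr_exp: "exp x powr y = exp (y * x)" for x y :: real
  by (simp add: powr_def mult.commute)

text \<open>Both error bounds, rewritten with \<open>c_eq\<close> as powers of \<rho> times explicit
  functions of N, s and T. The four terms stem from exceedances of T, the shift of the mean, the
  p-th moments, and the squared variances.\<close>

lemma char_le:
  "cmod ((\<integral>\<omega>. iexp (\<theta> \<bullet> complex_standardize M S \<omega>) \<partial>M) - of_real (exp (- (\<Sum>k\<in>I. \<integral>\<omega>. (U k \<omega>)\<^sup>2 \<partial>M) / 2)))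
    \<le> 2 * (real (card I) * std_normal_tail T)
      + cmod \<theta> * (sqrt \<rho> * (sqrt (real (card I)) * exp (- s\<^sup>2 / 2) * std_normal_tail (T - s)))
      + (2 * cmod \<theta>) powr p * \<rho> powr (p / 2) *
          (C * exp ((p - 2) * (s * T - s\<^sup>2 - ln (real (card I)) / 2)) + real (card I) powr (1 - p / 2))
      + cmod \<theta> ^ 4 * \<rho>\<^sup>2 / (8 * real (card I))"
proof -
  define N where "N = real (card I)"
  have N: "N \<ge> 1" using card_I by (simp add: N_def)
  have \<rho>: "\<rho> \<ge> 1" by (rule \<rho>_bounds)
  have sc: "N * (exp (s\<^sup>2 / 2) * t * sqrt c) = sqrt \<rho> * (sqrt N * exp (- s\<^sup>2 / 2) * t)" for t
  proof -
    have "sqrt (exp (2 * s\<^sup>2)) = exp (s\<^sup>2)"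
      by (rule real_sqrt_unique) (auto simp flip: exp_double)
    then have a: "sqrt c = sqrt \<rho> / (sqrt N * exp (s\<^sup>2))"
      unfolding c_eq N_def[symmetric] by (simp add: real_sqrt_divide real_sqrt_mult)
    have b: "exp (- s\<^sup>2 / 2) = exp (s\<^sup>2 / 2) / exp (s\<^sup>2)" by (simp add: exp_diff[symmetric])
    have "q * q * (e * t * (x / (q * f))) = x * (q * (e / f) * t)" if "q \<noteq> 0" "f \<noteq> 0" for q e x f :: real
      using that by simp
    from this[of "sqrt N" "exp (s\<^sup>2)"] show ?thesis
      unfolding a b using N by simp
  qed
  have cp: "c powr (p / 2) = \<rho> powr (p / 2) * N powr (- p / 2) * exp (- p * s\<^sup>2)"
    unfolding c_eq N_def[symmetric] using N \<rho>
    by (simp add: powr_divide powr_mult powr_exp powr_minus exp_minus field_simps)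
  have Np: "N * N powr (- p / 2) = N powr (1 - p / 2)"
  proof -
    have "N * N powr (- p / 2) = N powr 1 * N powr (- p / 2)" using N by simp
    also have "\<dots> = N powr (1 - p / 2)" unfolding powr_add[symmetric] by simp
    finally show ?thesis .
  qed
  have Np': "N powr (1 - p / 2) = exp ((p - 2) * (- ln N / 2))"
    using N by (simp add: powr_def field_simps)
  have t1: "N * (exp ((p - 2) * s * T) * exp (2 * s\<^sup>2) * C * c powr (p / 2))
      = \<rho> powr (p / 2) * (C * exp ((p - 2) * (s * T - s\<^sup>2 - ln N / 2)))"
  proof -
    have "N * (exp ((p - 2) * s * T) * exp (2 * s\<^sup>2) * C * c powr (p / 2))
        = \<rho> powr (p / 2) * C * ((N * N powr (- p / 2)) * (exp ((p - 2) * s * T) * exp (2 * s\<^sup>2) * exp (- p * s\<^sup>2)))"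
      unfolding cp by (simp only: mult_ac)
    also have "(N * N powr (- p / 2)) * (exp ((p - 2) * s * T) * exp (2 * s\<^sup>2) * exp (- p * s\<^sup>2))
        = exp ((p - 2) * (s * T - s\<^sup>2 - ln N / 2))"
      unfolding Np Np' exp_add[symmetric] by (simp add: algebra_simps)
    finally show ?thesis by simp
  qed
  have t2: "N * (exp (p * s\<^sup>2 / 2) * c powr (p / 2)) \<le> \<rho> powr (p / 2) * N powr (1 - p / 2)"
  proof -
    have "N * (exp (p * s\<^sup>2 / 2) * c powr (p / 2))
        = \<rho> powr (p / 2) * ((N * N powr (- p / 2)) * (exp (p * s\<^sup>2 / 2) * exp (- p * s\<^sup>2)))"
      unfolding cp by (simp only: mult_ac)
    also have "exp (p * s\<^sup>2 / 2) * exp (- p * s\<^sup>2) \<le> 1"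
      using p by (simp add: exp_add[symmetric])
    finally show ?thesis unfolding Np by (simp add: mult_left_mono mult_left_le)
  qed
  have t3: "N * (((cmod \<theta>)\<^sup>2 * (exp (2 * s\<^sup>2) * c))\<^sup>2 / 8) = cmod \<theta> ^ 4 * \<rho>\<^sup>2 / (8 * N)"
  proof -
    have "exp (2 * s\<^sup>2) * c = \<rho> / N" using N by (simp add: \<rho>_def N_def)
    then show ?thesis using N by (simp only:) (simp add: power2_eq_square power4_eq_xxxx mult_ac)
  qed
  define G where "G = (2 * cmod \<theta>) powr p"
  have "N * (G * (exp ((p - 2) * s * T) * exp (2 * s\<^sup>2) * C * c powr (p / 2) + exp (p * s\<^sup>2 / 2) * c powr (p / 2))
        + ((cmod \<theta>)\<^sup>2 * (exp (2 * s\<^sup>2) * c))\<^sup>2 / 8)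
      = G * (N * (exp ((p - 2) * s * T) * exp (2 * s\<^sup>2) * C * c powr (p / 2)) + N * (exp (p * s\<^sup>2 / 2) * c powr (p / 2)))
        + N * (((cmod \<theta>)\<^sup>2 * (exp (2 * s\<^sup>2) * c))\<^sup>2 / 8)"
    by (simp only: distrib_left mult_ac)
  also have "\<dots> \<le> G * (\<rho> powr (p / 2) * (C * exp ((p - 2) * (s * T - s\<^sup>2 - ln N / 2))) + \<rho> powr (p / 2) * N powr (1 - p / 2))
      + cmod \<theta> ^ 4 * \<rho>\<^sup>2 / (8 * N)"
    unfolding t1 t3 using t2 by (intro add_mono mult_left_mono order_refl) (auto simp: G_def)
  also have "\<dots> = G * \<rho> powr (p / 2) * (C * exp ((p - 2) * (s * T - s\<^sup>2 - ln N / 2)) + N powr (1 - p / 2))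
      + cmod \<theta> ^ 4 * \<rho>\<^sup>2 / (8 * N)"
    by (simp add: algebra_simps)
  finally have 1: "cmod ((\<Prod>k\<in>I. \<integral>\<omega>. iexp (U k \<omega>) \<partial>M) - of_real (exp (- (\<Sum>k\<in>I. \<integral>\<omega>. (U k \<omega>)\<^sup>2 \<partial>M) / 2)))
      \<le> G * \<rho> powr (p / 2) * (C * exp ((p - 2) * (s * T - s\<^sup>2 - ln N / 2)) + N powr (1 - p / 2))
      + cmod \<theta> ^ 4 * \<rho>\<^sup>2 / (8 * N)"
    using char_product_le unfolding N_def[symmetric] G_def[symmetric] by (rule order_trans[rotated])
  note 2 = char_truncation_le[folded N_def, unfolded sc]
  show ?thesis
    using norm_triangle_ineq[of "(\<integral>\<omega>. iexp (\<theta> \<bullet> complex_standardize M S \<omega>) \<partial>M) - (\<Prod>k\<in>I. \<integral>\<omega>. iexp (U k \<omega>) \<partial>M)"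
        "(\<Prod>k\<in>I. \<integral>\<omega>. iexp (U k \<omega>) \<partial>M) - of_real (exp (- (\<Sum>k\<in>I. \<integral>\<omega>. (U k \<omega>)\<^sup>2 \<partial>M) / 2))"] 1 2
    unfolding N_def[symmetric] G_def[symmetric] diff_add_cancel add_diff_eq by linarith
qed

text \<open>Treats both kinds of limit at once: the limiting variance in direction \<theta> is
  \<Phi>(u) q.\<close>

lemma sum_U_square_le:
  assumes "r \<noteq> 0 \<and> q = (cmod \<theta>)\<^sup>2 / 2 \<or> r = 0 \<and> (\<forall>k\<in>I. \<forall>\<omega>. Im (W k \<omega>) = 0) \<and> q = (Re \<theta>)\<^sup>2"
  shows "\<bar>(\<Sum>k\<in>I. \<integral>\<omega>. (U k \<omega>)\<^sup>2 \<partial>M) - \<rho> * Phi (T - 2 * s) * q\<bar>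
    \<le> \<rho> * ((if r = 0 then 0 else (cmod \<theta>)\<^sup>2 / \<bar>r\<bar>) + (cmod \<theta>)\<^sup>2 * exp (- s\<^sup>2))"
proof -
  have "exp (s\<^sup>2) = exp (2 * s\<^sup>2) * exp (- s\<^sup>2)" by (simp add: exp_add[symmetric])
  then have e: "real (card I) * ((cmod \<theta>)\<^sup>2 * (exp (s\<^sup>2) * c)) = \<rho> * ((cmod \<theta>)\<^sup>2 * exp (- s\<^sup>2))"
    by (simp add: \<rho>_def)
  show ?thesis
    using assms
  proof
    assume "r \<noteq> 0 \<and> q = (cmod \<theta>)\<^sup>2 / 2"
    then have "r \<noteq> 0" and q: "q = (cmod \<theta>)\<^sup>2 / 2" by auto
    from sum_U_square_complex[OF this(1)] \<open>r \<noteq> 0\<close> show ?thesis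
      unfolding e \<rho>_def[symmetric] q by (simp add: distrib_left)
  next
    assume "r = 0 \<and> (\<forall>k\<in>I. \<forall>\<omega>. Im (W k \<omega>) = 0) \<and> q = (Re \<theta>)\<^sup>2"
    then show ?thesis using sum_U_square_real unfolding e \<rho>_def[symmetric] by simp
  qed
qed

end

text \<open>
  The truncation level $T = L - \frac{\ln L}{2L}$, with $L = \sqrt{2 \ln N}$ the location of the
  maximum of $N$ standard Gaussians, is high enough to be exceeded by none of them, yet low enough
  to make every truncated summand negligible.
\<close>

lemma truncation_asymptotics:
  fixes L s N p :: real
  assumes L: "L \<ge> 4" and s: "\<bar>2 * s - L\<bar> \<le> L / 4" and N: "N = exp (L\<^sup>2 / 2)" and p: "p > 2"
  defines "T \<equiv> L - ln L / (2 * L)"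
  shows "N * std_normal_tail T \<le> 2 * exp (- ln L / 2)"
    and "sqrt N * exp (- s\<^sup>2 / 2) * std_normal_tail (T - s) \<le> 4 * exp (- 3 / 4 * ln L)"
    and "exp ((p - 2) * (s * T - s\<^sup>2 - ln N / 2)) \<le> exp (- (3 / 16) * (p - 2) * ln L)"
proof -
  \<comment> \<open>Solves 2 L \<delta> = ln L. Lowering L by \<delta> then decreases the square by
    at most ln L, so N exp(-T^2 / 2) is at most sqrt L, which the factor 1 / T of the Gaussian tail
    outweighs.\<close>
  define \<delta> where "\<delta> = ln L / (2 * L)"
  have lnL: "0 \<le> ln L" "ln L \<le> L" using L ln_bound[of L] by auto
  have \<delta>: "0 \<le> \<delta>" "\<delta> \<le> 1 / 2" "2 * L * \<delta> = ln L"
    using lnL L by (auto simp: \<delta>_def)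
  have T: "T = L - \<delta>" by (simp add: T_def \<delta>_def)
  have s': "3 / 8 * L \<le> s" "s \<le> 5 / 8 * L" using s unfolding abs_le_iff by linarith+
  have T1: "L / 2 \<le> T" using \<delta> L by (simp add: T)
  have T2: "L / 4 \<le> T - s" using \<delta> L s' s by (simp add: T abs_le_iff)
  have Tsq: "L\<^sup>2 - ln L \<le> T\<^sup>2"
  proof -
    have "T\<^sup>2 = L\<^sup>2 - 2 * L * \<delta> + \<delta>\<^sup>2" by (simp add: T power2_eq_square algebra_simps)
    then show ?thesis using \<delta>(3) by simp
  qed
  show "N * std_normal_tail T \<le> 2 * exp (- ln L / 2)"
  proof -
    have "N * std_normal_tail T \<le> exp (L\<^sup>2 / 2) * (exp (- T\<^sup>2 / 2) / T)"
      unfolding N std_normal_tail_def using T1 L by (intro mult_left_mono std_normal_tail_le) auto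
    also have "\<dots> = exp (L\<^sup>2 / 2 + - T\<^sup>2 / 2) / T" by (simp only: exp_add times_divide_eq_right)
    also have "\<dots> \<le> exp (ln L / 2) / (L / 2)"
      using Tsq T1 L by (intro frac_le) auto
    also have "\<dots> = 2 * (exp (ln L / 2) * exp (- ln L))" using L by (simp add: exp_minus field_simps)
    also have "exp (ln L / 2) * exp (- ln L) = exp (- ln L / 2)" unfolding exp_add[symmetric] by (simp add: field_simps)
    finally show ?thesis .
  qed
  show "sqrt N * exp (- s\<^sup>2 / 2) * std_normal_tail (T - s) \<le> 4 * exp (- 3 / 4 * ln L)"
  proof -
    have sqN: "sqrt N = exp (L\<^sup>2 / 4)"
      unfolding N by (rule real_sqrt_unique) (auto simp flip: exp_double)
    have "sqrt N * exp (- s\<^sup>2 / 2) * std_normal_tail (T - s) \<le> exp (L\<^sup>2 / 4) * exp (- s\<^sup>2 / 2) * (exp (- (T - s)\<^sup>2 / 2) / (T - s))"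
      unfolding sqN std_normal_tail_def using T2 L by (intro mult_left_mono std_normal_tail_le) auto
    also have "\<dots> = exp (L\<^sup>2 / 4 + - s\<^sup>2 / 2 + - (T - s)\<^sup>2 / 2) / (T - s)"
      by (simp only: exp_add times_divide_eq_right)
    \<comment> \<open>The exponent s^2 / 2 + (T - s)^2 / 2 is smallest at s = T / 2, where it equals
      T^2 / 4. It is therefore at least L^2 / 4 - ln L / 4 and cancels sqrt N up to a power of
      L.\<close>
    also have "\<dots> \<le> exp (ln L / 4) / (L / 4)"
    proof (intro frac_le)
      have ineq: "e / 4 + - a / 2 + - b / 2 \<le> l / 4" if "t \<le> 2 * (a + b)" "e - l \<le> t" for a b t e l :: real
        using that by (simp add: field_simps)
      have "T\<^sup>2 \<le> 2 * (s\<^sup>2 + (T - s)\<^sup>2)"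
        using zero_le_power2[of "T - 2 * s"] by (simp add: power2_eq_square algebra_simps)
      then have "L\<^sup>2 / 4 + - s\<^sup>2 / 2 + - (T - s)\<^sup>2 / 2 \<le> ln L / 4"
        using Tsq ineq by blast
      then show "exp (L\<^sup>2 / 4 + - s\<^sup>2 / 2 + - (T - s)\<^sup>2 / 2) \<le> exp (ln L / 4)" by (simp only: exp_le_cancel_iff)
    qed (use T2 L in auto)
    also have "\<dots> = 4 * (exp (ln L / 4) * exp (- ln L))" using L by (simp add: exp_minus field_simps)
    also have "exp (ln L / 4) * exp (- ln L) = exp (- 3 / 4 * ln L)" unfolding exp_add[symmetric] by (simp add: field_simps)
    finally show ?thesis .
  qed
  show "exp ((p - 2) * (s * T - s\<^sup>2 - ln N / 2)) \<le> exp (- (3 / 16) * (p - 2) * ln L)"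
  proof -
    \<comment> \<open>Since ln N = L^2 / 2, the exponent is minus a square minus s \<delta>. At
      criticality s - L / 2 stays bounded, so the decay comes from s \<delta> alone; with T = L
      there would be none.\<close>
    have "s * T - s\<^sup>2 - ln N / 2 = - (s - L / 2)\<^sup>2 - s * \<delta>"
      by (simp add: T N power2_eq_square algebra_simps)
    also have "\<dots> \<le> - s * \<delta>" by simp
    also have "\<dots> \<le> - (3 / 16) * ln L"
    proof -
      have "3 / 8 * L * \<delta> \<le> s * \<delta>" using s' \<delta> by (intro mult_right_mono) auto
      then show ?thesis using \<delta>(3) by simp
    qed
    finally have "(p - 2) * (s * T - s\<^sup>2 - ln N / 2) \<le> (p - 2) * (- (3 / 16) * ln L)"
      using p by (intro mult_left_mono) auto
    then show ?thesis by (simp add: mult_ac)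
  qed
qed

section \<open>Limit of the characteristic functions\<close>

text \<open>\<open>m2\<close> may vary with n, whereas p and C may not; this is where the uniform
  moment bound on the subtrees is used. The disjunction in \<open>r\<close> separates the isotropic
  from the real limit, and q is the variance of the limit in direction \<theta>, divided by
  \<Phi>(u).\<close>

theorem char_standardized_sum_tendsto:
  fixes M :: "nat \<Rightarrow> 'a measure" and I :: "nat \<Rightarrow> 'i set"
    and \<xi> :: "nat \<Rightarrow> 'i \<Rightarrow> 'a \<Rightarrow> real" and W :: "nat \<Rightarrow> 'i \<Rightarrow> 'a \<Rightarrow> complex" and s r m2 :: "nat \<Rightarrow> real" and p C u :: real
  assumes G: "\<forall>\<^sub>F n in sequentially. gaussian_weighted_sum (M n) (I n) (\<xi> n) (W n) p C (m2 n)"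
    and N: "filterlim (\<lambda>n. real (card (I n))) at_top sequentially"
    and su: "(\<lambda>n. 2 * s n - sqrt (2 * ln (real (card (I n))))) \<longlonglongrightarrow> - u"
    and r: "filterlim (\<lambda>n. \<bar>r n\<bar>) at_top sequentially \<and> q = (cmod \<theta>)\<^sup>2 / 2 \<or>
      (\<forall>n. r n = 0 \<and> (\<forall>k\<in>I n. \<forall>\<omega>. Im (W n k \<omega>) = 0)) \<and> q = (Re \<theta>)\<^sup>2"
  shows "(\<lambda>n. \<integral>\<omega>. iexp (\<theta> \<bullet> complex_standardize (M n) (gaussian_weighted_sum.S (I n) (\<xi> n) (W n) (s n) (r n)) \<omega>) \<partial>M n)
    \<longlonglongrightarrow> of_real (exp (- (Phi u * q) / 2))"
proof -
  define L where "L n = sqrt (2 * ln (real (card (I n))))" for n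
  define T where "T n = L n - ln (L n) / (2 * L n)" for n
  define \<rho>' where "\<rho>' n = truncated_gaussian_sum.\<rho> (M n) (I n) (\<xi> n) (W n) (s n) (r n) (m2 n)" for n
  define V where "V n = (\<Sum>k\<in>I n. \<integral>\<omega>. (truncated_gaussian_sum.U (M n) (I n) (\<xi> n) (W n) (s n) (r n) (T n) \<theta> k \<omega>)\<^sup>2 \<partial>M n)" for n
  define ch where "ch n = (\<integral>\<omega>. iexp (\<theta> \<bullet> complex_standardize (M n) (gaussian_weighted_sum.S (I n) (\<xi> n) (W n) (s n) (r n)) \<omega>) \<partial>M n)" for n
  define rr where "rr n = (if r n = 0 then 0 else (cmod \<theta>)\<^sup>2 / \<bar>r n\<bar>)" for n
  have su': "(\<lambda>n. 2 * s n - L n) \<longlonglongrightarrow> - u" using su by (simp add: L_def)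
  have L: "filterlim L at_top sequentially"
    unfolding L_def
    by (intro filterlim_compose[OF sqrt_at_top] filterlim_tendsto_pos_mult_at_top[OF tendsto_const _ filterlim_compose[OF ln_at_top N]]) auto
  have s_top: "filterlim s at_top sequentially"
  proof -
    have "filterlim (\<lambda>n. (2 * s n - L n) + L n) at_top sequentially"
      by (rule filterlim_tendsto_add_at_top[OF su' L])
    then have "filterlim (\<lambda>n. 2 * s n) at_top sequentially" by simp
    from filterlim_tendsto_pos_mult_at_top[OF tendsto_const _ this, of "1 / 2"]
    show ?thesis by simp
  qed
  have lnL: "filterlim (\<lambda>n. ln (L n)) at_top sequentially" by (rule filterlim_compose[OF ln_at_top L])
  have evL: "\<forall>\<^sub>F n in sequentially. L n \<ge> 4" using L by (auto simp: filterlim_at_top)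
  have evs: "\<forall>\<^sub>F n in sequentially. \<bar>2 * s n - L n\<bar> \<le> L n / 4"
  proof -
    have "(\<lambda>n. \<bar>2 * s n - L n\<bar>) \<longlonglongrightarrow> \<bar>u\<bar>" using tendsto_rabs[OF su'] by simp
    then have "\<forall>\<^sub>F n in sequentially. \<bar>2 * s n - L n\<bar> < \<bar>u\<bar> + 1" by (rule order_tendstoD) simp
    moreover have "\<forall>\<^sub>F n in sequentially. 4 * (\<bar>u\<bar> + 1) \<le> L n" using L by (auto simp: filterlim_at_top)
    ultimately show ?thesis by eventually_elim simp
  qed
  have evN: "\<forall>\<^sub>F n in sequentially. real (card (I n)) = exp ((L n)\<^sup>2 / 2)"
  proof -
    have "\<forall>\<^sub>F n in sequentially. 1 \<le> real (card (I n))" using N unfolding filterlim_at_top by blast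
    then show ?thesis by eventually_elim (simp add: L_def)
  qed
  have evspos: "\<forall>\<^sub>F n in sequentially. s n > 0" using s_top by (auto simp: filterlim_at_top_dense)
  have tg: "\<forall>\<^sub>F n in sequentially. truncated_gaussian_sum (M n) (I n) (\<xi> n) (W n) (s n) p C (m2 n)"
    using G evspos by eventually_elim (simp add: truncated_gaussian_sum_def truncated_gaussian_sum_axioms_def)
  have p_gt: "2 < p"
  proof -
    obtain n where "gaussian_weighted_sum (M n) (I n) (\<xi> n) (W n) p C (m2 n)"
      using eventually_happens[OF G] by auto
    then show ?thesis by (rule gaussian_weighted_sum.p)
  qed
  have e1: "\<forall>\<^sub>F n in sequentially. 1 \<le> \<rho>' n" "\<forall>\<^sub>F n in sequentially. \<rho>' n \<le> 1 / (1 - exp (- (s n)\<^sup>2))"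
  proof -
    show "\<forall>\<^sub>F n in sequentially. 1 \<le> \<rho>' n"
      using tg by eventually_elim (simp only: \<rho>'_def truncated_gaussian_sum.\<rho>_bounds)
    show "\<forall>\<^sub>F n in sequentially. \<rho>' n \<le> 1 / (1 - exp (- (s n)\<^sup>2))"
      using tg evspos
    proof eventually_elim
      fix n assume t: "truncated_gaussian_sum (M n) (I n) (\<xi> n) (W n) (s n) p C (m2 n)" and "s n > 0"
      then have "0 < 1 - exp (- (s n)\<^sup>2)" by simp
      then show "\<rho>' n \<le> 1 / (1 - exp (- (s n)\<^sup>2))"
        using truncated_gaussian_sum.\<rho>_bounds(2)[OF t] by (simp add: \<rho>'_def pos_le_divide_eq)
    qed
  qed
  have s2: "filterlim (\<lambda>n. (s n)\<^sup>2) at_top sequentially"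
    using filterlim_pow_at_top[OF _ s_top, of 2] by simp
  have es: "(\<lambda>n. exp (- (s n)\<^sup>2)) \<longlonglongrightarrow> 0"
    using filterlim_compose[OF exp_at_bot filterlim_compose[OF filterlim_uminus_at_bot_at_top s2]] by simp
  have \<rho>': "\<rho>' \<longlonglongrightarrow> 1"
  proof (rule tendsto_sandwich[OF e1 tendsto_const])
    have "(\<lambda>n. 1 / (1 - exp (- (s n)\<^sup>2))) \<longlonglongrightarrow> 1 / (1 - 0)" by (intro tendsto_intros es) auto
    then show "(\<lambda>n. 1 / (1 - exp (- (s n)\<^sup>2))) \<longlonglongrightarrow> 1" by simp
  qed
  have lL: "(\<lambda>n. ln (L n) / (2 * L n)) \<longlonglongrightarrow> 0"
  proof -
    have "((\<lambda>x::real. ln x / (2 * x)) \<longlongrightarrow> 0) at_top" by real_asymp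
    from filterlim_compose[OF this L] show ?thesis .
  qed
  \<comment> \<open>The correction ln L / (2 L) tends to 0, so lowering the truncation level below L
    does not affect the limit \<Phi>(u).\<close>
  have Tu: "(\<lambda>n. T n - 2 * s n) \<longlonglongrightarrow> u"
  proof -
    have "(\<lambda>n. - (2 * s n - L n) - ln (L n) / (2 * L n)) \<longlonglongrightarrow> - (- u) - 0" by (intro tendsto_intros su' lL)
    then show ?thesis by (simp add: T_def algebra_simps)
  qed
  have Phi: "(\<lambda>n. Phi (T n - 2 * s n)) \<longlonglongrightarrow> Phi u" by (rule isCont_tendsto_compose[OF isCont_Phi Tu])
  have rr: "rr \<longlonglongrightarrow> 0"
    using r
  proof
    assume "filterlim (\<lambda>n. \<bar>r n\<bar>) at_top sequentially \<and> q = (cmod \<theta>)\<^sup>2 / 2"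
    then have "(\<lambda>n. (cmod \<theta>)\<^sup>2 / \<bar>r n\<bar>) \<longlonglongrightarrow> 0" by (intro tendsto_divide_0[OF tendsto_const] filterlim_at_top_imp_at_infinity) auto
    moreover have "rr = (\<lambda>n. (cmod \<theta>)\<^sup>2 / \<bar>r n\<bar>)" by (auto simp: rr_def)
    ultimately show ?thesis by simp
  qed (auto simp: rr_def[abs_def])
  have Vdiff: "\<forall>\<^sub>F n in sequentially. norm (V n - \<rho>' n * Phi (T n - 2 * s n) * q) \<le> \<rho>' n * (rr n + (cmod \<theta>)\<^sup>2 * exp (- (s n)\<^sup>2))"
  proof -
    have "\<forall>\<^sub>F n in sequentially. r n \<noteq> 0 \<and> q = (cmod \<theta>)\<^sup>2 / 2 \<or> r n = 0 \<and> (\<forall>k\<in>I n. \<forall>\<omega>. Im (W n k \<omega>) = 0) \<and> q = (Re \<theta>)\<^sup>2"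
      using r
    proof
      assume *: "filterlim (\<lambda>n. \<bar>r n\<bar>) at_top sequentially \<and> q = (cmod \<theta>)\<^sup>2 / 2"
      then have "\<forall>\<^sub>F n in sequentially. 0 < \<bar>r n\<bar>" unfolding filterlim_at_top_dense by blast
      then show ?thesis by eventually_elim (use * in auto)
    qed auto
    with tg show ?thesis
    proof eventually_elim
      fix n assume t: "truncated_gaussian_sum (M n) (I n) (\<xi> n) (W n) (s n) p C (m2 n)"
        and c: "r n \<noteq> 0 \<and> q = (cmod \<theta>)\<^sup>2 / 2 \<or> r n = 0 \<and> (\<forall>k\<in>I n. \<forall>\<omega>. Im (W n k \<omega>) = 0) \<and> q = (Re \<theta>)\<^sup>2"
      show "norm (V n - \<rho>' n * Phi (T n - 2 * s n) * q) \<le> \<rho>' n * (rr n + (cmod \<theta>)\<^sup>2 * exp (- (s n)\<^sup>2))"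
        unfolding V_def \<rho>'_def rr_def real_norm_def by (rule truncated_gaussian_sum.sum_U_square_le[OF t c])
    qed
  qed
  have Vd0: "(\<lambda>n. V n - \<rho>' n * Phi (T n - 2 * s n) * q) \<longlonglongrightarrow> 0"
  proof (rule Lim_null_comparison[OF Vdiff])
    have "(\<lambda>n. \<rho>' n * (rr n + (cmod \<theta>)\<^sup>2 * exp (- (s n)\<^sup>2))) \<longlonglongrightarrow> 1 * (0 + (cmod \<theta>)\<^sup>2 * 0)"
      by (intro tendsto_intros \<rho>' rr es)
    then show "(\<lambda>n. \<rho>' n * (rr n + (cmod \<theta>)\<^sup>2 * exp (- (s n)\<^sup>2))) \<longlonglongrightarrow> 0" by simp
  qed
  have V: "V \<longlonglongrightarrow> Phi u * q"
  proof -
    have "(\<lambda>n. \<rho>' n * Phi (T n - 2 * s n) * q) \<longlonglongrightarrow> 1 * Phi u * q" by (intro tendsto_intros \<rho>' Phi)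
    from tendsto_add[OF Vd0 this] show ?thesis by simp
  qed
  have eV: "(\<lambda>n. complex_of_real (exp (- V n / 2))) \<longlonglongrightarrow> of_real (exp (- (Phi u * q) / 2))"
    by (intro tendsto_intros V) auto
  \<comment> \<open>The bound of \<open>char_le\<close> with the estimates of
    \<open>truncation_asymptotics\<close> inserted: negative powers of L and of N times convergent
    factors.\<close>
  define err where "err n = 2 * (2 * exp (- ln (L n) / 2))
      + cmod \<theta> * (sqrt (\<rho>' n) * (4 * exp (- 3 / 4 * ln (L n))))
      + (2 * cmod \<theta>) powr p * \<rho>' n powr (p / 2) * (C * exp (- (3 / 16) * (p - 2) * ln (L n)) + real (card (I n)) powr (1 - p / 2))
      + cmod \<theta> ^ 4 * (\<rho>' n)\<^sup>2 / (8 * real (card (I n)))" for n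
  have le: "\<forall>\<^sub>F n in sequentially. norm (ch n - of_real (exp (- V n / 2))) \<le> err n"
    using tg evL evs evN e1(1)
  proof eventually_elim
    fix n assume t: "truncated_gaussian_sum (M n) (I n) (\<xi> n) (W n) (s n) p C (m2 n)"
      and as: "4 \<le> L n" "\<bar>2 * s n - L n\<bar> \<le> L n / 4" "real (card (I n)) = exp ((L n)\<^sup>2 / 2)" and \<rho>'1: "1 \<le> \<rho>' n"
    interpret truncated_gaussian_sum "M n" "I n" "\<xi> n" "W n" "s n" "r n" p C "m2 n" "T n" \<theta> by (rule t)
    note b = truncation_asymptotics[OF as p_gt, folded T_def]
    have "norm (ch n - of_real (exp (- V n / 2))) \<le> 2 * (real (card (I n)) * std_normal_tail (T n))
      + cmod \<theta> * (sqrt (\<rho>' n) * (sqrt (real (card (I n))) * exp (- (s n)\<^sup>2 / 2) * std_normal_tail (T n - s n)))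
      + (2 * cmod \<theta>) powr p * \<rho>' n powr (p / 2) *
          (C * exp ((p - 2) * (s n * T n - (s n)\<^sup>2 - ln (real (card (I n))) / 2)) + real (card (I n)) powr (1 - p / 2))
      + cmod \<theta> ^ 4 * (\<rho>' n)\<^sup>2 / (8 * real (card (I n)))"
      unfolding ch_def V_def \<rho>'_def by (rule char_le)
    also have "\<dots> \<le> err n"
      unfolding err_def using C_nonneg \<rho>'1
      by (intro add_mono mult_left_mono b order_refl) auto
    finally show "norm (ch n - of_real (exp (- V n / 2))) \<le> err n" .
  qed
  have "err \<longlonglongrightarrow> 2 * (2 * 0) + cmod \<theta> * (sqrt 1 * (4 * 0)) + (2 * cmod \<theta>) powr p * 1 powr (p / 2) * (C * 0 + 0) + 0"
    unfolding err_def
  proof (intro tendsto_intros \<rho>')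
    have e: "(\<lambda>n. exp (- k * ln (L n))) \<longlonglongrightarrow> 0" if "k > 0" for k
    proof -
      have "filterlim (\<lambda>n. k * ln (L n)) at_top sequentially"
        using that by (intro filterlim_tendsto_pos_mult_at_top[OF tendsto_const _ lnL]) auto
      then have "filterlim (\<lambda>n. - (k * ln (L n))) at_bot sequentially"
        by (rule filterlim_compose[OF filterlim_uminus_at_bot_at_top])
      from filterlim_compose[OF exp_at_bot this] show ?thesis by simp
    qed
    show "(\<lambda>n. exp (- ln (L n) / 2)) \<longlonglongrightarrow> 0" using e[of "1 / 2"] by simp
    show "(\<lambda>n. exp (- 3 / 4 * ln (L n))) \<longlonglongrightarrow> 0" using e[of "3 / 4"] by simp
    show "(\<lambda>n. exp (- (3 / 16) * (p - 2) * ln (L n))) \<longlonglongrightarrow> 0" using e[of "3 / 16 * (p - 2)"] p_gt by simp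
    show "(\<lambda>n. real (card (I n)) powr (1 - p / 2)) \<longlonglongrightarrow> 0"
      using p_gt by (intro tendsto_neg_powr[OF _ N]) auto
    have "(\<lambda>n. cmod \<theta> ^ 4 * (\<rho>' n)\<^sup>2 / 8) \<longlonglongrightarrow> cmod \<theta> ^ 4 * 1\<^sup>2 / 8" by (intro tendsto_intros \<rho>') auto
    from tendsto_divide_0[OF this filterlim_at_top_imp_at_infinity[OF N]]
    show "(\<lambda>n. cmod \<theta> ^ 4 * (\<rho>' n)\<^sup>2 / (8 * real (card (I n)))) \<longlonglongrightarrow> 0" by simp
  qed auto
  then have "err \<longlonglongrightarrow> 0" by simp
  from Lim_null_comparison[OF le this] have "(\<lambda>n. ch n - of_real (exp (- V n / 2))) \<longlonglongrightarrow> 0" .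
  from tendsto_add[OF this eV] show ?thesis by (simp add: ch_def)
qed

section \<open>The tree\<close>

text \<open>The partition function of the subtree at w with r levels left. The level is read off
  from the length of w, and z j is the complex coefficient of level j. The recursion exhibits each
  value as a Gaussian weighted sum of the values at the children.\<close>

primrec tree_sum :: "(nat \<Rightarrow> complex) \<Rightarrow> (nat \<Rightarrow> nat) \<Rightarrow> nat \<Rightarrow> nat list \<Rightarrow> (nat list \<Rightarrow> real) \<Rightarrow> complex" where
  "tree_sum z N 0 w x = 1"
| "tree_sum z N (Suc r) w x =
    (\<Sum>k\<in>{1..N (Suc (length w))}. exp (z (Suc (length w)) * of_real (x (w @ [k]))) * tree_sum z N r (w @ [k]) x)"

lemma grem_words_snoc:
  "w @ [k] \<in> grem_words N (Suc j) \<longleftrightarrow> w \<in> grem_words N j \<and> k \<in> {1..N (Suc j)}"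
proof -
  have "{1..Suc j} = insert (Suc j) {1..j}" by auto
  then show ?thesis by (auto simp: grem_words_def nth_append)
qed

lemma grem_words_Cons:
  "k # v \<in> grem_words N (Suc j) \<longleftrightarrow> k \<in> {1..N 1} \<and> v \<in> grem_words (\<lambda>i. N (Suc i)) j"
proof -
  have "(\<forall>i\<in>{1..Suc j}. P i) \<longleftrightarrow> P 1 \<and> (\<forall>i\<in>{1..j}. P (Suc i))" for P
  proof -
    have "P i" if "P 1" "\<forall>i\<in>{1..j}. P (Suc i)" "i \<in> {1..Suc j}" for i
    proof (cases i)
      case (Suc m)
      then show ?thesis using that by (cases "m = 0") auto
    qed (use that in auto)
    then show ?thesis by auto
  qed
  then show ?thesis
    by (auto simp: grem_words_def nth_Cons' simp del: One_nat_def)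
qed

lemma grem_words_0: "grem_words N 0 = {[]}"
  by (auto simp: grem_words_def)

text \<open>A path below a node is consumed from its first letter on, which shifts N by one
  level.\<close>

lemma sum_grem_words_Suc:
  "(\<Sum>v\<in>grem_words N (Suc j). f v) = (\<Sum>k\<in>{1..N 1}. \<Sum>v\<in>grem_words (\<lambda>i. N (Suc i)) j. f (k # v))"
proof -
  have "grem_words N (Suc j) = (\<lambda>(k, v). k # v) ` ({1..N 1} \<times> grem_words (\<lambda>i. N (Suc i)) j)"
  proof (rule set_eqI)
    fix u
    show "u \<in> grem_words N (Suc j) \<longleftrightarrow> u \<in> (\<lambda>(k, v). k # v) ` ({1..N 1} \<times> grem_words (\<lambda>i. N (Suc i)) j)"
      by (cases u) (auto simp: grem_words_Cons image_iff simp del: One_nat_def, simp add: grem_words_def)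
  qed
  then show ?thesis
    by (simp add: sum.reindex inj_on_def sum.cartesian_product split_def del: One_nat_def)
qed

text \<open>Distributivity: the exponential along a path is a product whose first factor depends on
  the first letter only.\<close>

lemma tree_sum_eq_sum_words:
  "tree_sum z N r w x =
    (\<Sum>v\<in>grem_words (\<lambda>i. N (length w + i)) r. exp (\<Sum>i=1..r. z (length w + i) * of_real (x (w @ take i v))))"
proof (induction r arbitrary: w)
  case 0
  then show ?case by (simp add: grem_words_0)
next
  case (Suc r)
  have shift: "(\<Sum>i=1..Suc r. z (length w + i) * of_real (x (w @ take i (k # v))))
      = z (Suc (length w)) * of_real (x (w @ [k])) + (\<Sum>i=1..r. z (length (w @ [k]) + i) * of_real (x ((w @ [k]) @ take i v)))" for k v
    unfolding One_nat_def sum.atLeast1_atMost_eq sum.lessThan_Suc_shift by simp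
  show ?case
    unfolding sum_grem_words_Suc shift exp_add tree_sum.simps(2) Suc.IH
    by (simp add: sum_distrib_left)
qed

lemma grem_partition_eq_tree_sum:
  assumes "\<And>j. z j = \<beta> * of_real (sqrt (real n) * sqrt (a j))"
  shows "grem_partition d a N \<xi> n \<beta> \<omega> = tree_sum z N d [] (\<lambda>v. \<xi> v \<omega>)"
  unfolding tree_sum_eq_sum_words grem_partition_def grem_energy_def assms
  by (simp add: sum_distrib_left mult_ac)

lemma Im_tree_sum_eq_0:
  assumes "\<And>j. Im (z j) = 0"
  shows "Im (tree_sum z N r w x) = 0"
  by (induction r arbitrary: w) (auto simp: Im_exp assms intro!: sum.neutral)

section \<open>Independence of subtrees\<close>

text \<open>One fixed n. Nonempty levels exclude vanishing subtree sums; along the sequence they are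
  guaranteed only from some n on.\<close>

locale gaussian_tree = prob_space M for M :: "'a measure" +
  fixes d :: nat and N :: "nat \<Rightarrow> nat" and \<xi> :: "nat list \<Rightarrow> 'a \<Rightarrow> real" and s r :: "nat \<Rightarrow> real"
  assumes indep: "indep_vars (\<lambda>_. borel) \<xi> (\<Union>j\<in>{1..d}. grem_words N j)"
    and distr: "\<And>j w. j \<in> {1..d} \<Longrightarrow> w \<in> grem_words N j \<Longrightarrow> distr M borel (\<xi> w) = std_normal_distribution"
    and N_pos: "\<And>j. j \<in> {1..d} \<Longrightarrow> N j \<ge> 1"
begin

definition nodes :: "nat list set" where "nodes = (\<Union>j\<in>{1..d}. grem_words N j)"

text \<open>The labels on which the subtree sum at w depends. The label of w itself is excluded,
  since it belongs to the factor that multiplies this sum.\<close>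

definition below :: "nat list \<Rightarrow> nat list set" where "below w = {v \<in> nodes. strict_prefix w v}"

definition z :: "nat \<Rightarrow> complex" where "z j = Complex (s j) (r j)"

definition F :: "nat \<Rightarrow> nat list \<Rightarrow> 'a \<Rightarrow> complex" where
  "F l w \<omega> = tree_sum z N l w (\<lambda>v. \<xi> v \<omega>)"

lemma child:
  assumes "w \<in> grem_words N j" "j + Suc l = d" "k \<in> {1..N (Suc j)}"
  shows "w @ [k] \<in> grem_words N (Suc j)" "w @ [k] \<in> nodes" "w @ [k] \<in> below w"
    "below (w @ [k]) \<subseteq> below w" "length w = j"
proof -
  show 1: "w @ [k] \<in> grem_words N (Suc j)" using assms by (simp add: grem_words_snoc)
  then show 2: "w @ [k] \<in> nodes" unfolding nodes_def using assms(2) by (intro UN_I[of "Suc j"]) auto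
  then show "w @ [k] \<in> below w" by (auto simp: below_def strict_prefix_def)
  show "below (w @ [k]) \<subseteq> below w" by (auto simp: below_def strict_prefix_def prefix_def)
  show "length w = j" using assms by (simp add: grem_words_def)
qed

text \<open>Locality of the subtree sum. It allows to restrict the labels to disjoint sets of nodes,
  from which independence is read off.\<close>

lemma tree_sum_cong:
  assumes "w \<in> grem_words N j" "j + l = d" "\<And>v. v \<in> below w \<Longrightarrow> x v = y v"
  shows "tree_sum z N l w x = tree_sum z N l w y"
  using assms
proof (induction l arbitrary: w j)
  case (Suc l)
  note ch = child[OF Suc.prems(1,2)]
  have "tree_sum z N l (w @ [k]) x = tree_sum z N l (w @ [k]) y" "x (w @ [k]) = y (w @ [k])"
    if "k \<in> {1..N (Suc j)}" for k
    using ch[OF that] Suc.prems Suc.IH[of "w @ [k]" "Suc j"] by auto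
  then show ?case using Suc.prems(1) by (auto simp: grem_words_def intro!: sum.cong)
qed simp

lemma tree_sum_measurable:
  assumes "w \<in> grem_words N j" "j + l = d" "\<And>v. v \<in> below w \<Longrightarrow> X v \<in> borel_measurable M'"
  shows "(\<lambda>\<omega>. tree_sum z N l w (\<lambda>v. X v \<omega>)) \<in> borel_measurable M'"
  using assms
proof (induction l arbitrary: w j)
  case (Suc l)
  note ch = child[OF Suc.prems(1,2)]
  have len: "length w = j" using Suc.prems(1) by (simp add: grem_words_def)
  have "(\<lambda>\<omega>. tree_sum z N l (w @ [k]) (\<lambda>v. X v \<omega>)) \<in> borel_measurable M'" "X (w @ [k]) \<in> borel_measurable M'"
    if "k \<in> {1..N (Suc j)}" for k
    using ch[OF that] Suc.prems Suc.IH[of "w @ [k]" "Suc j"] by auto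
  then show ?case unfolding tree_sum.simps len by (intro borel_measurable_sum borel_measurable_times) auto
qed simp

text \<open>The pair of child k uses the labels of w @ [k] and of its descendants. For different k
  these sets are disjoint, since distinct words of equal length are not prefixes of one
  word.\<close>

lemma indep_children:
  assumes w: "w \<in> grem_words N j" "j + Suc l = d"
  shows "indep_vars (\<lambda>_. borel) (\<lambda>k \<omega>. (\<xi> (w @ [k]) \<omega>, F l (w @ [k]) \<omega>)) {1..N (Suc j)}"
proof -
  define K where "K k = insert (w @ [k]) (below (w @ [k]))" for k
  define f where "f k x = (x (w @ [k]), tree_sum z N l (w @ [k]) x)" for k and x :: "nat list \<Rightarrow> real"
  have Kn: "K k \<subseteq> nodes" if "k \<in> {1..N (Suc j)}" for k
    using child(2)[OF w that] by (auto simp: K_def below_def)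
  have pre: "prefix (w @ [k]) v" if "v \<in> K k" for v k
    using that by (auto simp: K_def below_def strict_prefix_def)
  have disj: "disjoint_family_on K {1..N (Suc j)}"
    unfolding disjoint_family_on_def
  proof (intro ballI impI)
    fix k k' :: nat assume "k \<in> {1..N (Suc j)}" "k' \<in> {1..N (Suc j)}" "k \<noteq> k'"
    show "K k \<inter> K k' = {}"
    proof (rule ccontr)
      assume "K k \<inter> K k' \<noteq> {}"
      then obtain v where "prefix (w @ [k]) v" "prefix (w @ [k']) v" using pre by blast
      then show False using \<open>k \<noteq> k'\<close> by (auto simp: prefix_def)
    qed
  qed
  have "indep_vars (\<lambda>k. PiM (K k) (\<lambda>_. borel)) (\<lambda>k \<omega>. restrict (\<lambda>v. \<xi> v \<omega>) (K k)) {1..N (Suc j)}"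
    using Kn disj unfolding nodes_def by (intro indep_vars_restrict[OF indep]) auto
  then have "indep_vars (\<lambda>_. borel) (\<lambda>k \<omega>. f k (restrict (\<lambda>v. \<xi> v \<omega>) (K k))) {1..N (Suc j)}"
  proof (rule indep_vars_compose2)
    fix k assume k: "k \<in> {1..N (Suc j)}"
    have m: "(\<lambda>x. x v) \<in> borel_measurable (PiM (K k) (\<lambda>_. borel :: real measure))" if "v \<in> K k" for v
      by (rule measurable_component_singleton[OF that])
    have "(\<lambda>x. tree_sum z N l (w @ [k]) (\<lambda>v. x v)) \<in> borel_measurable (PiM (K k) (\<lambda>_. borel :: real measure))"
      using child(1)[OF w k] w(2) by (intro tree_sum_measurable[where X="\<lambda>v x. x v"] m) (auto simp: K_def)
    then show "f k \<in> borel_measurable (PiM (K k) (\<lambda>_. borel))"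
      unfolding f_def[abs_def] borel_prod[symmetric] using m[of "w @ [k]"] by (intro measurable_Pair) (auto simp: K_def)
  qed
  moreover have "f k (restrict (\<lambda>v. \<xi> v \<omega>) (K k)) = (\<xi> (w @ [k]) \<omega>, F l (w @ [k]) \<omega>)" if "k \<in> {1..N (Suc j)}" for k \<omega>
  proof -
    have "tree_sum z N l (w @ [k]) (restrict (\<lambda>v. \<xi> v \<omega>) (K k)) = F l (w @ [k]) \<omega>"
      unfolding F_def using child(1)[OF w that] w(2) by (intro tree_sum_cong) (auto simp: K_def)
    then show ?thesis by (simp add: f_def K_def)
  qed
  ultimately show ?thesis
    by (subst indep_vars_cong[OF refl _ refl, where Y="\<lambda>k \<omega>. f k (restrict (\<lambda>v. \<xi> v \<omega>) (K k))"]) (auto simp: fun_eq_iff)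
qed

text \<open>Inside one pair the label of the child stands against the labels strictly below
  it.\<close>

lemma indep_child:
  assumes w: "w \<in> grem_words N j" "j + Suc l = d" and k: "k \<in> {1..N (Suc j)}"
  shows "indep_var borel (\<lambda>\<omega>. complex_of_real (\<xi> (w @ [k]) \<omega>)) borel (F l (w @ [k]))"
proof -
  let ?A = "{w @ [k]}" and ?B = "below (w @ [k])"
  have sub: "?A \<inter> ?B = {}" "?A \<subseteq> (\<Union>j\<in>{1..d}. grem_words N j)" "?B \<subseteq> (\<Union>j\<in>{1..d}. grem_words N j)"
    using child(2)[OF w k] by (auto simp: below_def nodes_def)
  note iv = indep_var_restrict[OF indep sub]
  have m: "(\<lambda>x. x v) \<in> borel_measurable (PiM ?B (\<lambda>_. borel :: real measure))" if "v \<in> ?B" for v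
    by (rule measurable_component_singleton[OF that])
  have mA: "(\<lambda>x. complex_of_real (x (w @ [k]))) \<in> borel_measurable (PiM ?A (\<lambda>_. borel :: real measure))"
  proof -
    have [measurable]: "(\<lambda>x. x (w @ [k])) \<in> borel_measurable (PiM ?A (\<lambda>_. borel :: real measure))"
      by (rule measurable_component_singleton) simp
    show ?thesis by measurable
  qed
  have mB: "(\<lambda>x. tree_sum z N l (w @ [k]) (\<lambda>v. x v)) \<in> borel_measurable (PiM ?B (\<lambda>_. borel :: real measure))"
    using child(1)[OF w k] w(2) by (intro tree_sum_measurable[where X="\<lambda>v x. x v"] m) auto
  have "indep_var borel ((\<lambda>x. complex_of_real (x (w @ [k]))) \<circ> (\<lambda>\<omega>. restrict (\<lambda>v. \<xi> v \<omega>) ?A))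
      borel ((\<lambda>x. tree_sum z N l (w @ [k]) (\<lambda>v. x v)) \<circ> (\<lambda>\<omega>. restrict (\<lambda>v. \<xi> v \<omega>) ?B))"
    by (rule indep_var_compose[OF iv mA mB])
  moreover have "tree_sum z N l (w @ [k]) (restrict (\<lambda>v. \<xi> v \<omega>) ?B) = F l (w @ [k]) \<omega>" for \<omega>
    unfolding F_def using child(1)[OF w k] w(2) by (intro tree_sum_cong) auto
  ultimately show ?thesis by (simp add: comp_def)
qed

lemma weighted_sum:
  assumes w: "w \<in> grem_words N j" "j + Suc l = d" and p: "2 < p" "p \<le> 3" and m2: "m2 > 0"
    and F: "\<And>v. v \<in> grem_words N (Suc j) \<Longrightarrow> has_moment p (F l v)"
      "\<And>v. v \<in> grem_words N (Suc j) \<Longrightarrow> (\<integral>\<omega>. (cmod (F l v \<omega>))\<^sup>2 \<partial>M) = m2"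
      "\<And>v. v \<in> grem_words N (Suc j) \<Longrightarrow> (\<integral>\<omega>. cmod (F l v \<omega>) powr p \<partial>M) \<le> C * m2 powr (p / 2)"
  shows "gaussian_weighted_sum M {1..N (Suc j)} (\<lambda>k. \<xi> (w @ [k])) (\<lambda>k. F l (w @ [k])) p C m2"
proof
  show "{1..N (Suc j)} \<noteq> {}" using N_pos[of "Suc j"] w(2) by auto
  show "indep_vars (\<lambda>_. borel) (\<lambda>k \<omega>. (\<xi> (w @ [k]) \<omega>, F l (w @ [k]) \<omega>)) {1..N (Suc j)}"
    by (rule indep_children[OF w])
  fix k assume k: "k \<in> {1..N (Suc j)}"
  show "indep_var borel (\<lambda>\<omega>. complex_of_real (\<xi> (w @ [k]) \<omega>)) borel (F l (w @ [k]))"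
    by (rule indep_child[OF w k])
  show "distr M borel (\<xi> (w @ [k])) = std_normal_distribution"
    using child(1)[OF w k] w(2) by (intro distr[of "Suc j"]) auto
  show "has_moment p (F l (w @ [k]))" "(\<integral>\<omega>. (cmod (F l (w @ [k]) \<omega>))\<^sup>2 \<partial>M) = m2"
    "(\<integral>\<omega>. cmod (F l (w @ [k]) \<omega>) powr p \<partial>M) \<le> C * m2 powr (p / 2)"
    using F child(1)[OF w k] by auto
qed (use p m2 in auto)

text \<open>One unfolding of the recursion. It transfers the results on abstract weighted sums to
  the subtree sums one level higher.\<close>

lemma S_eq_F:
  assumes "w \<in> grem_words N j"
    and "gaussian_weighted_sum M {1..N (Suc j)} (\<lambda>k. \<xi> (w @ [k])) (\<lambda>k. F l (w @ [k])) p C m2"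
  shows "gaussian_weighted_sum.S {1..N (Suc j)} (\<lambda>k. \<xi> (w @ [k])) (\<lambda>k. F l (w @ [k])) (s (Suc j)) (r (Suc j)) = F (Suc l) w"
proof -
  interpret G: gaussian_weighted_sum M "{1..N (Suc j)}" "\<lambda>k. \<xi> (w @ [k])" "\<lambda>k. F l (w @ [k])" "s (Suc j)" "r (Suc j)" p C m2
    by (rule assms(2))
  have len: "length w = j" using assms by (simp add: grem_words_def)
  show ?thesis
    by (rule ext) (simp only: F_def z_def len G.S_def G.Y_def tree_sum.simps)
qed

end

section \<open>Uniform moment bounds for subtrees\<close>

text \<open>The constant of \<open>powr_S_le\<close>, iterated from a leaf, where the subtree sum is
  1. It depends on p, K and the height, but not on n.\<close>

primrec moment_constant :: "real \<Rightarrow> real \<Rightarrow> nat \<Rightarrow> real" where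
  "moment_constant p K 0 = 1"
| "moment_constant p K (Suc l) = 2 powr p * (3 + 2 powr p * (K * moment_constant p K l + 1))"

text \<open>Induction on the height l. Mean and second moment depend only on the level, so m1 and m2
  are common to all its nodes. Because of l < d the induction stops below the root, and K is
  required for the levels 2, ..., d only.\<close>

lemma (in gaussian_tree) subtree_moments:
  assumes p: "2 < p" "p \<le> 3"
    and K: "\<And>j. j \<in> {2..d} \<Longrightarrow> real (N j) powr (1 - p / 2) * exp ((p\<^sup>2 / 2 - p) * (s j)\<^sup>2) \<le> K"
    and l: "l < d"
  shows "\<exists>m1 m2. m2 > 0 \<and> (\<forall>w\<in>grem_words N (d - l). has_moment p (F l w) \<and> (\<integral>\<omega>. F l w \<omega> \<partial>M) = m1 \<and>
    (\<integral>\<omega>. (cmod (F l w \<omega>))\<^sup>2 \<partial>M) = m2 \<and> (\<integral>\<omega>. cmod (F l w \<omega>) powr p \<partial>M) \<le> moment_constant p K l * m2 powr (p / 2))"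
  using l
proof (induction l)
  case 0
  then show ?case by (intro exI[of _ 1]) (simp add: F_def has_moment_const prob_space)
next
  case (Suc l)
  then obtain m1 m2 where m2: "m2 > 0" and F: "\<And>w. w \<in> grem_words N (d - l) \<Longrightarrow> has_moment p (F l w)"
    "\<And>w. w \<in> grem_words N (d - l) \<Longrightarrow> (\<integral>\<omega>. F l w \<omega> \<partial>M) = m1"
    "\<And>w. w \<in> grem_words N (d - l) \<Longrightarrow> (\<integral>\<omega>. (cmod (F l w \<omega>))\<^sup>2 \<partial>M) = m2"
    "\<And>w. w \<in> grem_words N (d - l) \<Longrightarrow> (\<integral>\<omega>. cmod (F l w \<omega>) powr p \<partial>M) \<le> moment_constant p K l * m2 powr (p / 2)"
    by force
  define j where "j = d - Suc l"
  have j: "j + Suc l = d" "d - l = Suc j" "Suc j \<in> {2..d}" using Suc.prems by (auto simp: j_def)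
  let ?I = "{1..N (Suc j)}"
  let ?m1 = "of_nat (card ?I) * (gaussian_weighted_sum.\<kappa> (s (Suc j)) (r (Suc j)) * m1)"
  let ?m2 = "gaussian_weighted_sum_mean.m2' ?I (s (Suc j)) (r (Suc j)) m2 m1"
  have G: "gaussian_weighted_sum_mean M ?I (\<lambda>k. \<xi> (w @ [k])) (\<lambda>k. F l (w @ [k])) (s (Suc j)) p (moment_constant p K l) m2 m1 K"
    if w: "w \<in> grem_words N j" for w
  proof -
    interpret gaussian_weighted_sum M ?I "\<lambda>k. \<xi> (w @ [k])" "\<lambda>k. F l (w @ [k])" "s (Suc j)" "r (Suc j)" p "moment_constant p K l" m2
      using F unfolding j(2) by (intro weighted_sum[OF w j(1) p m2]) auto
    show ?thesis
    proof
      show "(\<integral>\<omega>. F l (w @ [k]) \<omega> \<partial>M) = m1" if "k \<in> ?I" for k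
        using F(2) child(1)[OF w j(1) that] unfolding j(2) by blast
      show "real (card ?I) powr (1 - p / 2) * exp ((p\<^sup>2 / 2 - p) * (s (Suc j))\<^sup>2) \<le> K"
        using K[OF j(3)] by simp
    qed
  qed
  have res: "?m2 > 0 \<and> has_moment p (F (Suc l) w) \<and> (\<integral>\<omega>. F (Suc l) w \<omega> \<partial>M) = ?m1 \<and>
    (\<integral>\<omega>. (cmod (F (Suc l) w \<omega>))\<^sup>2 \<partial>M) = ?m2 \<and> (\<integral>\<omega>. cmod (F (Suc l) w \<omega>) powr p \<partial>M) \<le> moment_constant p K (Suc l) * ?m2 powr (p / 2)"
    if w: "w \<in> grem_words N j" for w
  proof -
    interpret G: gaussian_weighted_sum_mean M ?I "\<lambda>k. \<xi> (w @ [k])" "\<lambda>k. F l (w @ [k])" "s (Suc j)" "r (Suc j)" p "moment_constant p K l" m2 m1 K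
      by (rule G[OF w])
    show ?thesis
      using G.m2'_pos G.moment_S G.expectation_S_mean G.square_S_mean G.powr_S_le
      unfolding S_eq_F[OF w G.gaussian_weighted_sum_axioms] by simp
  qed
  \<comment> \<open>Positivity is known only in the presence of a node; the word of ones shows that
    the level is inhabited.\<close>
  have "?m2 > 0"
  proof -
    have "replicate j 1 \<in> grem_words N j" using N_pos j by (auto simp: grem_words_def)
    then show ?thesis using res by blast
  qed
  then show ?case using res unfolding j_def by blast
qed

section \<open>The limit theorem\<close>

lemma converges_in_distribution_offset:
  assumes "converges_in_distribution (\<lambda>n. M (n + k)) (\<lambda>n. Z (n + k)) \<mu>"
  shows "converges_in_distribution M Z \<mu>"
  using assms unfolding converges_in_distribution_def by (blast intro: LIMSEQ_offset)

section \<open>Scaling at and below criticality\<close>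

lemma abs_sqrt_diff_le:
  assumes "0 \<le> x" "0 \<le> y"
  shows "\<bar>sqrt x - sqrt y\<bar> \<le> sqrt \<bar>x - y\<bar>"
proof -
  have "sqrt x \<le> sqrt y + sqrt \<bar>x - y\<bar>"
    by (rule order_trans[OF _ sqrt_add_le_add_sqrt]) (use assms in auto)
  moreover have "sqrt y \<le> sqrt x + sqrt \<bar>x - y\<bar>"
    by (rule order_trans[OF _ sqrt_add_le_add_sqrt]) (use assms in auto)
  ultimately show ?thesis by linarith
qed

text \<open>As N / \<alpha>^n tends to 1, ln N = n ln \<alpha> + o(1), hence sqrt(2 ln N) =
  \<sigma>_1 sqrt(n a) + o(1). The term - u / (2 sqrt(n a)) of \<sigma>, multiplied by 2 sqrt(n a),
  produces the limit - u.\<close>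

lemma critical_scaling:
  fixes N :: "nat \<Rightarrow> nat" and \<sigma> :: "nat \<Rightarrow> real" and a \<alpha> u :: real
  assumes a: "a > 0" and \<alpha>: "\<alpha> > 1" and N: "(\<lambda>n. real (N n) / \<alpha> ^ n) \<longlonglongrightarrow> 1"
    and \<sigma>: "(\<lambda>n. \<sigma> n - (sqrt (2 * ln \<alpha> / a) / 2 - u / (2 * sqrt (real n * a)))) \<in> o(\<lambda>n. 1 / sqrt (real n))"
  shows "\<sigma> \<longlonglongrightarrow> sqrt (2 * ln \<alpha> / a) / 2"
    and "(\<lambda>n. 2 * (\<sigma> n * (sqrt (real n) * sqrt a)) - sqrt (2 * ln (real (N n)))) \<longlonglongrightarrow> - u"
    and "filterlim (\<lambda>n. real (N n)) at_top sequentially"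
proof -
  let ?\<sigma>1 = "sqrt (2 * ln \<alpha> / a)"
  define e where "e n = \<sigma> n - (?\<sigma>1 / 2 - u / (2 * sqrt (real n * a)))" for n
  have sn: "filterlim (\<lambda>n. sqrt (real n)) at_top sequentially"
    by (intro filterlim_compose[OF sqrt_at_top] filterlim_real_sequentially)
  have e: "(\<lambda>n. e n * sqrt (real n)) \<longlonglongrightarrow> 0"
    using smalloD_tendsto[OF \<sigma>] by (simp add: e_def)
  have inv: "(\<lambda>n. 1 / sqrt (real n)) \<longlonglongrightarrow> 0"
    by (intro tendsto_divide_0[OF tendsto_const] filterlim_at_top_imp_at_infinity sn)
  show "\<sigma> \<longlonglongrightarrow> ?\<sigma>1 / 2"
  proof -
    have "(\<lambda>n. ?\<sigma>1 / 2 - u / (2 * sqrt a) * (1 / sqrt (real n)) + (e n * sqrt (real n)) * (1 / sqrt (real n))) \<longlonglongrightarrow> ?\<sigma>1 / 2 - u / (2 * sqrt a) * 0 + 0 * 0"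
      by (intro tendsto_intros e inv)
    moreover have "\<forall>\<^sub>F n in sequentially. ?\<sigma>1 / 2 - u / (2 * sqrt a) * (1 / sqrt (real n)) + (e n * sqrt (real n)) * (1 / sqrt (real n)) = \<sigma> n"
      using eventually_gt_at_top[of 0] by eventually_elim (simp add: e_def real_sqrt_mult mult_ac)
    ultimately show ?thesis by (simp add: tendsto_cong)
  qed
  have ev: "\<forall>\<^sub>F n in sequentially. real (N n) / \<alpha> ^ n > 1 / 2" using order_tendstoD(1)[OF N, of "1 / 2"] by simp
  have "filterlim (\<lambda>n. \<alpha> ^ n) at_top sequentially" using \<alpha> by real_asymp
  then have "filterlim (\<lambda>n. (real (N n) / \<alpha> ^ n) * \<alpha> ^ n) at_top sequentially"
    by (rule filterlim_tendsto_pos_mult_at_top[OF N zero_less_one])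
  then show Nt: "filterlim (\<lambda>n. real (N n)) at_top sequentially" using \<alpha> by simp
  have evN: "\<forall>\<^sub>F n in sequentially. 1 \<le> real (N n)" using Nt unfolding filterlim_at_top by blast
  \<comment> \<open>The square root is Holder continuous of order 1/2, so nothing has to be divided
    by the growing roots.\<close>
  have d0: "(\<lambda>n. sqrt (2 * (real n * ln \<alpha>)) - sqrt (2 * ln (real (N n)))) \<longlonglongrightarrow> 0"
  proof (rule Lim_null_comparison)
    show "\<forall>\<^sub>F n in sequentially. norm (sqrt (2 * (real n * ln \<alpha>)) - sqrt (2 * ln (real (N n)))) \<le> sqrt \<bar>2 * ln (real (N n) / \<alpha> ^ n)\<bar>"
      using evN
    proof eventually_elim
      fix n assume n: "1 \<le> real (N n)"
      have "norm (sqrt (2 * (real n * ln \<alpha>)) - sqrt (2 * ln (real (N n)))) \<le> sqrt \<bar>2 * (real n * ln \<alpha>) - 2 * ln (real (N n))\<bar>"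
        unfolding real_norm_def using n \<alpha> by (intro abs_sqrt_diff_le) auto
      also have "\<bar>2 * (real n * ln \<alpha>) - 2 * ln (real (N n))\<bar> = \<bar>2 * ln (real (N n) / \<alpha> ^ n)\<bar>"
        using n \<alpha> by (simp add: ln_div ln_realpow abs_minus_commute)
      finally show "norm (sqrt (2 * (real n * ln \<alpha>)) - sqrt (2 * ln (real (N n)))) \<le> sqrt \<bar>2 * ln (real (N n) / \<alpha> ^ n)\<bar>" .
    qed
    have "(\<lambda>n. sqrt \<bar>2 * ln (real (N n) / \<alpha> ^ n)\<bar>) \<longlonglongrightarrow> sqrt \<bar>2 * ln 1\<bar>" by (intro tendsto_intros N) simp
    then show "(\<lambda>n. sqrt \<bar>2 * ln (real (N n) / \<alpha> ^ n)\<bar>) \<longlonglongrightarrow> 0" by simp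
  qed
  have "(\<lambda>n. (sqrt (2 * (real n * ln \<alpha>)) - sqrt (2 * ln (real (N n)))) - u + 2 * sqrt a * (e n * sqrt (real n))) \<longlonglongrightarrow> 0 - u + 2 * sqrt a * 0"
    by (intro tendsto_intros e d0)
  moreover have "\<forall>\<^sub>F n in sequentially. (sqrt (2 * (real n * ln \<alpha>)) - sqrt (2 * ln (real (N n)))) - u + 2 * sqrt a * (e n * sqrt (real n))
      = 2 * (\<sigma> n * (sqrt (real n) * sqrt a)) - sqrt (2 * ln (real (N n)))"
    using eventually_gt_at_top[of 0]
  proof eventually_elim
    fix n :: nat assume n: "0 < n"
    define q where "q = sqrt (real n) * sqrt a"
    have q: "q > 0" using n a by (simp add: q_def)
    have s1: "sqrt (2 * (real n * ln \<alpha>)) = ?\<sigma>1 * q"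
      unfolding q_def real_sqrt_mult[symmetric] using a by (simp add: field_simps)
    have "e n = \<sigma> n - (?\<sigma>1 / 2 - u / (2 * q))" by (simp add: e_def q_def real_sqrt_mult)
    then have "2 * (e n * q) = 2 * (\<sigma> n * q) - ?\<sigma>1 * q + u" using q by (simp add: field_simps)
    then show "(sqrt (2 * (real n * ln \<alpha>)) - sqrt (2 * ln (real (N n)))) - u + 2 * sqrt a * (e n * sqrt (real n))
      = 2 * (\<sigma> n * (sqrt (real n) * sqrt a)) - sqrt (2 * ln (real (N n)))"
      unfolding s1 q_def[symmetric] by (simp add: q_def mult_ac)
  qed
  ultimately show "(\<lambda>n. 2 * (\<sigma> n * (sqrt (real n) * sqrt a)) - sqrt (2 * ln (real (N n)))) \<longlonglongrightarrow> - u"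
    by (simp add: tendsto_cong)
qed

text \<open>The logarithm of the left-hand side is (p/2 - 1) (p s^2 - ln N). Subcriticality gives p
  s^2 \<le> n ln \<alpha>, and eventually N > \<alpha>^n / 2; this is where 2^(p/2 - 1) comes
  from.\<close>

lemma subcritical_bound:
  fixes N :: "nat \<Rightarrow> nat" and \<sigma> :: "nat \<Rightarrow> real" and a \<alpha> p \<sigma>0 :: real
  assumes a: "a > 0" and \<alpha>: "\<alpha> > 1" and N: "(\<lambda>n. real (N n) / \<alpha> ^ n) \<longlonglongrightarrow> 1"
    and \<sigma>: "\<sigma> \<longlonglongrightarrow> \<sigma>0" and p: "p > 2" "p * \<sigma>0\<^sup>2 * a < ln \<alpha>"
  shows "\<forall>\<^sub>F n in sequentially. real (N n) powr (1 - p / 2) * exp ((p\<^sup>2 / 2 - p) * (\<sigma> n * (sqrt (real n) * sqrt a))\<^sup>2)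
    \<le> exp ((p / 2 - 1) * ln 2)"
proof -
  have "(\<lambda>n. p * (\<sigma> n)\<^sup>2 * a) \<longlonglongrightarrow> p * \<sigma>0\<^sup>2 * a" by (intro tendsto_intros \<sigma>)
  then have "\<forall>\<^sub>F n in sequentially. p * (\<sigma> n)\<^sup>2 * a < ln \<alpha>" using p(2) by (rule order_tendstoD)
  moreover have "\<forall>\<^sub>F n in sequentially. 1 / 2 < real (N n) / \<alpha> ^ n" using N by (rule order_tendstoD) simp
  ultimately show ?thesis
  proof eventually_elim
    fix n assume 1: "p * (\<sigma> n)\<^sup>2 * a < ln \<alpha>" and 2: "1 / 2 < real (N n) / \<alpha> ^ n"
    let ?s = "\<sigma> n * (sqrt (real n) * sqrt a)"
    have N0: "real (N n) > 0"
    proof (rule ccontr)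
      assume "\<not> real (N n) > 0"
      then have "N n = 0" by simp
      with 2 show False by simp
    qed
    have "ln (1 / 2) \<le> ln (real (N n) / \<alpha> ^ n)" using 2 N0 \<alpha> by (subst ln_le_cancel_iff) auto
    then have l: "real n * ln \<alpha> - ln 2 \<le> ln (real (N n))" using N0 \<alpha> by (simp add: ln_div ln_realpow)
    have s: "?s\<^sup>2 = (\<sigma> n)\<^sup>2 * (real n * a)" using a by (simp add: power_mult_distrib)
    have "p * ?s\<^sup>2 = real n * (p * (\<sigma> n)\<^sup>2 * a)" unfolding s by (simp add: mult_ac)
    also have "\<dots> \<le> real n * ln \<alpha>" using 1 by (intro mult_left_mono) auto
    finally have "p * ?s\<^sup>2 - ln (real (N n)) \<le> ln 2" using l by simp
    then have le: "(p / 2 - 1) * (p * ?s\<^sup>2 - ln (real (N n))) \<le> (p / 2 - 1) * ln 2" using p by (intro mult_left_mono) auto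
    have "real (N n) powr (1 - p / 2) * exp ((p\<^sup>2 / 2 - p) * ?s\<^sup>2) = exp ((1 - p / 2) * ln (real (N n)) + (p\<^sup>2 / 2 - p) * ?s\<^sup>2)"
      using N0 unfolding exp_add by (simp add: powr_def)
    also have "(1 - p / 2) * ln (real (N n)) + (p\<^sup>2 / 2 - p) * ?s\<^sup>2 = (p / 2 - 1) * (p * ?s\<^sup>2 - ln (real (N n)))"
      by (simp add: power2_eq_square[of p] algebra_simps)
    also have "exp \<dots> \<le> exp ((p / 2 - 1) * ln 2)" using le by simp
    finally show "real (N n) powr (1 - p / 2) * exp ((p\<^sup>2 / 2 - p) * ?s\<^sup>2) \<le> exp ((p / 2 - 1) * ln 2)" .
  qed
qed

text \<open>A strict inequality at p = 2 persists in a right neighbourhood of 2, and finitely many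
  of them in a common one.\<close>

lemma exists_moment_exponent:
  fixes x :: real and y :: "'i \<Rightarrow> real"
  assumes "finite J" "\<And>j. j \<in> J \<Longrightarrow> 2 * x < y j"
  obtains p where "2 < p" "p \<le> 3" "\<And>j. j \<in> J \<Longrightarrow> p * x < y j"
proof -
  have "\<forall>\<^sub>F p in at_right 2. \<forall>j\<in>J. p * x < y j"
  proof (intro eventually_ball_finite assms(1) ballI)
    fix j assume "j \<in> J"
    have "((\<lambda>p. p * x) \<longlongrightarrow> 2 * x) (at_right 2)" by (intro tendsto_intros)
    then show "\<forall>\<^sub>F p in at_right 2. p * x < y j" using assms(2)[OF \<open>j \<in> J\<close>] by (rule order_tendstoD)
  qed
  moreover have "\<forall>\<^sub>F p in at_right 2. p \<in> {2<..<3::real}" by (rule eventually_at_right_real) simp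
  ultimately have "\<forall>\<^sub>F p in at_right 2. (\<forall>j\<in>J. p * x < y j) \<and> p \<in> {2<..<3::real}" by (rule eventually_conj)
  then obtain p where "\<forall>j\<in>J. p * x < y j" "p \<in> {2<..<3::real}"
    using eventually_happens[of _ "at_right (2::real)"] by auto
  then show thesis by (intro that[of p]) auto
qed

section \<open>Convergence of the standardized partition function\<close>

theorem theorem2p10:
  fixes d :: nat
    and a \<alpha> :: "nat \<Rightarrow> real"
    and N :: "nat \<Rightarrow> nat \<Rightarrow> nat"
    and M :: "nat \<Rightarrow> 'a measure"
    and \<xi> :: "nat \<Rightarrow> nat list \<Rightarrow> 'a \<Rightarrow> real"
    and \<sigma> :: "nat \<Rightarrow> real"
    and \<tau> u :: real
  assumes "d \<ge> 1"
    and "\<And>j. j \<in> {1..d} \<Longrightarrow> a j > 0"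
    and "\<And>j. j \<in> {1..d} \<Longrightarrow> \<alpha> j > 1"
    and "\<And>j. j \<in> {1..d} \<Longrightarrow> (\<lambda>n. real (N n j) / \<alpha> j ^ n) \<longlonglongrightarrow> 1"
    and "strict_mono_on {1..d} (grem_sigma a \<alpha>)"
    and "\<And>n. prob_space (M n)"
    and "\<And>n. prob_space.indep_vars (M n) (\<lambda>_. borel) (\<xi> n) (\<Union>j\<in>{1..d}. grem_words (N n) j)"
    and "\<And>n j w. j \<in> {1..d} \<Longrightarrow> w \<in> grem_words (N n) j \<Longrightarrow>
           distributed (M n) lborel (\<xi> n w) std_normal_density"
    and "(\<lambda>n. \<sigma> n - (grem_sigma a \<alpha> 1 / 2 - u / (2 * sqrt (real n * a 1))))
           \<in> o(\<lambda>n. 1 / sqrt (real n))"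
  shows "converges_in_distribution M
           (\<lambda>n. complex_standardize (M n)
                  (grem_partition d a (N n) (\<xi> n) n (Complex (\<sigma> n) \<tau>)))
           (if \<tau> \<noteq> 0 then gaussian_complex (cdf std_normal_distribution u)
            else gaussian_real_in_complex (cdf std_normal_distribution u))"
proof -
  note a = assms(2) and \<alpha> = assms(3) and Nlim = assms(4) and M = assms(6)
  have d1: "1 \<in> {1..d}" using \<open>d \<ge> 1\<close> by simp
  define \<sigma>1 where "\<sigma>1 = grem_sigma a \<alpha> 1"
  define s where "s n j = \<sigma> n * (sqrt (real n) * sqrt (a j))" for n j
  define r where "r n j = \<tau> * (sqrt (real n) * sqrt (a j))" for n j
  define Z where "Z n = grem_partition d a (N n) (\<xi> n) n (Complex (\<sigma> n) \<tau>)" for n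
  have \<sigma>asym: "(\<lambda>n. \<sigma> n - (sqrt (2 * ln (\<alpha> 1) / a 1) / 2 - u / (2 * sqrt (real n * a 1)))) \<in> o(\<lambda>n. 1 / sqrt (real n))"
    using assms(9) by (simp add: grem_sigma_def)
  note crit = critical_scaling[OF a[OF d1] \<alpha>[OF d1] Nlim[OF d1] \<sigma>asym]
  have \<sigma>lim: "\<sigma> \<longlonglongrightarrow> \<sigma>1 / 2" using crit(1) by (simp add: \<sigma>1_def grem_sigma_def)
  have \<sigma>sq: "(grem_sigma a \<alpha> j)\<^sup>2 = 2 * ln (\<alpha> j) / a j" "0 \<le> grem_sigma a \<alpha> j" if "j \<in> {1..d}" for j
    using a[OF that] \<alpha>[OF that] by (auto simp: grem_sigma_def)
  \<comment> \<open>The real part of \<beta> tends to \<sigma>_1 / 2, whose square accounts for the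
    4. In this form the 2 on the left can be enlarged to p.\<close>
  have sub: "2 * \<sigma>1\<^sup>2 < 4 * ln (\<alpha> j) / a j" if "j \<in> {2..d}" for j
  proof -
    have j: "j \<in> {1..d}" using that by auto
    have "\<sigma>1 < grem_sigma a \<alpha> j"
      unfolding \<sigma>1_def using strict_mono_onD[OF assms(5) d1 j] that by auto
    then have "\<sigma>1\<^sup>2 < (grem_sigma a \<alpha> j)\<^sup>2"
      using \<sigma>sq(2)[OF d1] by (intro power_strict_mono) (auto simp: \<sigma>1_def)
    then show ?thesis using \<sigma>sq(1)[OF j] by simp
  qed
  obtain p where p: "2 < p" "p \<le> 3" and psub: "\<And>j. j \<in> {2..d} \<Longrightarrow> p * \<sigma>1\<^sup>2 < 4 * ln (\<alpha> j) / a j"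
    using exists_moment_exponent[of "{2..d}" "\<sigma>1\<^sup>2" "\<lambda>j. 4 * ln (\<alpha> j) / a j"] sub by auto
  define K where "K = exp ((p / 2 - 1) * ln 2)"
  have evK: "\<forall>\<^sub>F n in sequentially. \<forall>j\<in>{2..d}. real (N n j) powr (1 - p / 2) * exp ((p\<^sup>2 / 2 - p) * (s n j)\<^sup>2) \<le> K"
  proof (intro eventually_ball_finite ballI)
    fix j assume j2: "j \<in> {2..d}"
    then have j: "j \<in> {1..d}" by auto
    have "p * (\<sigma>1 / 2)\<^sup>2 * a j < ln (\<alpha> j)"
      using psub[OF j2] a[OF j] by (simp add: power_divide field_simps)
    from subcritical_bound[OF a[OF j] \<alpha>[OF j] Nlim[OF j] \<sigma>lim p(1) this]
    show "\<forall>\<^sub>F n in sequentially. real (N n j) powr (1 - p / 2) * exp ((p\<^sup>2 / 2 - p) * (s n j)\<^sup>2) \<le> K"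
      unfolding s_def K_def .
  qed simp
  \<comment> \<open>Finitely many n may have empty levels; they are discarded below by means of
    n0.\<close>
  have evN: "\<forall>\<^sub>F n in sequentially. \<forall>j\<in>{1..d}. N n j \<ge> 1"
  proof (intro eventually_ball_finite ballI)
    fix j assume j: "j \<in> {1..d}"
    have "\<forall>\<^sub>F n in sequentially. 0 < real (N n j) / \<alpha> j ^ n" by (rule order_tendstoD(1)[OF Nlim[OF j]]) simp
    then show "\<forall>\<^sub>F n in sequentially. N n j \<ge> 1"
      by eventually_elim (metis One_nat_def Suc_leI div_0 gr0I less_irrefl of_nat_0)
  qed simp
  obtain n0 where n0: "\<And>n. n \<ge> n0 \<Longrightarrow> (\<forall>j\<in>{1..d}. N n j \<ge> 1) \<and>
      (\<forall>j\<in>{2..d}. real (N n j) powr (1 - p / 2) * exp ((p\<^sup>2 / 2 - p) * (s n j)\<^sup>2) \<le> K)"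
    using eventually_conj[OF evN evK] by (auto simp: eventually_sequentially)
  have tree: "gaussian_tree (M n) d (N n) (\<xi> n)" if n: "n \<ge> n0" for n
    unfolding gaussian_tree_def gaussian_tree_axioms_def
  proof (intro conjI allI impI M assms(7))
    fix j w assume jw: "j \<in> {1..d}" "w \<in> grem_words (N n) j"
    \<comment> \<open>\<open>distributed\<close> refers to \<open>lborel\<close>, the tree to
      \<open>borel\<close>; the two have the same measurable sets.\<close>
    have "distr (M n) borel (\<xi> n w) = distr (M n) lborel (\<xi> n w)" by (rule distr_cong) auto
    also have "\<dots> = std_normal_distribution"
      by (rule distributed_distr_eq_density[OF assms(8)[OF jw]])
    finally show "distr (M n) borel (\<xi> n w) = std_normal_distribution" .
  next
    show "N n j \<ge> 1" if "j \<in> {1..d}" for j using n0[OF n] that by blast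
  qed
  \<comment> \<open>Subtrees rooted at the first level have d - 1 levels left.\<close>
  define C where "C = moment_constant p K (d - 1)"
  define W where "W n k \<omega> = tree_sum (\<lambda>j. Complex (s n j) (r n j)) (N n) (d - 1) [k] (\<lambda>v. \<xi> n v \<omega>)" for n k \<omega>
  have root: "\<exists>m2. gaussian_weighted_sum (M n) {1..N n 1} (\<lambda>k. \<xi> n [k]) (W n) p C m2 \<and>
      gaussian_weighted_sum.S {1..N n 1} (\<lambda>k. \<xi> n [k]) (W n) (s n 1) (r n 1) = Z n"
    if n: "n \<ge> n0" for n
  proof -
    interpret T: gaussian_tree "M n" d "N n" "\<xi> n" "s n" "r n" by (rule tree[OF n])
    have "d - 1 < d" "d - (d - 1) = Suc 0" using \<open>d \<ge> 1\<close> by auto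
    then obtain m2 where m2: "m2 > 0" and F: "\<And>w. w \<in> grem_words (N n) (Suc 0) \<Longrightarrow> T.has_moment p (T.F (d - 1) w)"
      "\<And>w. w \<in> grem_words (N n) (Suc 0) \<Longrightarrow> (\<integral>\<omega>. (cmod (T.F (d - 1) w \<omega>))\<^sup>2 \<partial>M n) = m2"
      "\<And>w. w \<in> grem_words (N n) (Suc 0) \<Longrightarrow> (\<integral>\<omega>. cmod (T.F (d - 1) w \<omega>) powr p \<partial>M n) \<le> C * m2 powr (p / 2)"
      using T.subtree_moments[OF p, of K "d - 1"] n0[OF n] unfolding C_def by auto
    have w: "[] \<in> grem_words (N n) 0" "0 + Suc (d - 1) = d" using \<open>d \<ge> 1\<close> by (auto simp: grem_words_0)
    have WF: "W n = (\<lambda>k. T.F (d - 1) [k])"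
      by (simp add: fun_eq_iff W_def T.F_def T.z_def[abs_def])
    have G: "gaussian_weighted_sum (M n) {1..N n (Suc 0)} (\<lambda>k. \<xi> n ([] @ [k])) (\<lambda>k. T.F (d - 1) ([] @ [k])) p C m2"
      by (rule T.weighted_sum[OF w p m2 F])
    have "T.F (Suc (d - 1)) [] = Z n"
    proof
      fix \<omega>
      have "T.z j = Complex (\<sigma> n) \<tau> * of_real (sqrt (real n) * sqrt (a j))" for j
        by (simp add: T.z_def s_def r_def complex_eq_iff)
      then have "Z n \<omega> = tree_sum T.z (N n) d [] (\<lambda>v. \<xi> n v \<omega>)"
        unfolding Z_def by (rule grem_partition_eq_tree_sum)
      then show "T.F (Suc (d - 1)) [] \<omega> = Z n \<omega>" using \<open>d \<ge> 1\<close> by (simp add: T.F_def)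
    qed
    then show ?thesis using G T.S_eq_F[OF w(1) G] unfolding WF by auto
  qed
  \<comment> \<open>The second moments of the subtrees vary with n and are chosen separately for
    each n \<ge> n0, whereas C was fixed beforehand.\<close>
  then obtain m2 where G: "\<And>n. n \<ge> n0 \<Longrightarrow> gaussian_weighted_sum (M n) {1..N n 1} (\<lambda>k. \<xi> n [k]) (W n) p C (m2 n)"
    and S: "\<And>n. n \<ge> n0 \<Longrightarrow> gaussian_weighted_sum.S {1..N n 1} (\<lambda>k. \<xi> n [k]) (W n) (s n 1) (r n 1) = Z n"
    by metis
  have mom: "prob_space.has_moment (M n) 2 (Z n)" if n: "n \<ge> n0" for n
  proof -
    interpret G: gaussian_weighted_sum "M n" "{1..N n 1}" "\<lambda>k. \<xi> n [k]" "W n" "s n 1" "r n 1" p C "m2 n" by (rule G[OF n])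
    show ?thesis using G.moment2_S unfolding S[OF n] .
  qed
  note std = prob_space.complex_standardize_second_moment[OF M mom]
  let ?\<mu> = "if \<tau> \<noteq> 0 then gaussian_complex (Phi u) else gaussian_real_in_complex (Phi u)"
  have char: "(\<lambda>n. \<integral>\<omega>. iexp (\<theta> \<bullet> complex_standardize (M n) (Z n) \<omega>) \<partial>M n) \<longlonglongrightarrow> (\<integral>z. iexp (\<theta> \<bullet> z) \<partial>?\<mu>)" for \<theta>
  proof -
    \<comment> \<open>Matches both limits: \<Phi>(u) q / 2 is \<Phi>(u) |\<theta>|^2 / 4 in the
      complex case and \<Phi>(u) (Re \<theta>)^2 / 2 in the real one.\<close>
    define q where "q = (if \<tau> \<noteq> 0 then (cmod \<theta>)\<^sup>2 / 2 else (Re \<theta>)\<^sup>2)"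
    have "(\<lambda>n. \<integral>\<omega>. iexp (\<theta> \<bullet> complex_standardize (M n) (gaussian_weighted_sum.S {1..N n 1} (\<lambda>k. \<xi> n [k]) (W n) (s n 1) (r n 1)) \<omega>) \<partial>M n)
        \<longlonglongrightarrow> of_real (exp (- (Phi u * q) / 2))"
    proof (rule char_standardized_sum_tendsto)
      show "\<forall>\<^sub>F n in sequentially. gaussian_weighted_sum (M n) {1..N n 1} (\<lambda>k. \<xi> n [k]) (W n) p C (m2 n)"
        using G by (auto simp: eventually_sequentially)
      show "filterlim (\<lambda>n. real (card {1..N n 1})) at_top sequentially" using crit(3) by simp
      show "(\<lambda>n. 2 * s n 1 - sqrt (2 * ln (real (card {1..N n 1})))) \<longlonglongrightarrow> - u" using crit(2) by (simp add: s_def)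
      show "filterlim (\<lambda>n. \<bar>r n 1\<bar>) at_top sequentially \<and> q = (cmod \<theta>)\<^sup>2 / 2 \<or>
        (\<forall>n. r n 1 = 0 \<and> (\<forall>k\<in>{1..N n 1}. \<forall>\<omega>. Im (W n k \<omega>) = 0)) \<and> q = (Re \<theta>)\<^sup>2"
      proof (cases "\<tau> = 0")
        case True
        then show ?thesis by (auto simp: r_def q_def W_def intro!: Im_tree_sum_eq_0)
      next
        case False
        have "filterlim (\<lambda>n. (\<bar>\<tau>\<bar> * sqrt (a 1)) * sqrt (real n)) at_top sequentially"
          using False a[OF d1]
          by (intro filterlim_tendsto_pos_mult_at_top[OF tendsto_const] filterlim_compose[OF sqrt_at_top] filterlim_real_sequentially) auto
        moreover have "(\<lambda>n. \<bar>r n 1\<bar>) = (\<lambda>n. (\<bar>\<tau>\<bar> * sqrt (a 1)) * sqrt (real n))"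
          using a[OF d1] by (auto simp: r_def abs_mult)
        ultimately show ?thesis using False by (simp add: q_def)
      qed
    qed
    moreover have "\<forall>\<^sub>F n in sequentially. (\<integral>\<omega>. iexp (\<theta> \<bullet> complex_standardize (M n) (gaussian_weighted_sum.S {1..N n 1} (\<lambda>k. \<xi> n [k]) (W n) (s n 1) (r n 1)) \<omega>) \<partial>M n)
        = (\<integral>\<omega>. iexp (\<theta> \<bullet> complex_standardize (M n) (Z n) \<omega>) \<partial>M n)"
      using eventually_ge_at_top[of n0] by eventually_elim (simp only: S)
    moreover have "(\<integral>z. iexp (\<theta> \<bullet> z) \<partial>?\<mu>) = of_real (exp (- (Phi u * q) / 2))"
      by (simp add: q_def char_gaussian_complex[OF Phi_pos] char_gaussian_real_in_complex[OF Phi_pos])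
    ultimately show ?thesis by (simp only: tendsto_cong)
  qed
  have \<mu>: "prob_space ?\<mu>" "sets ?\<mu> = sets borel"
    using prob_space_gaussian_complex[OF Phi_pos[of u]] prob_space_gaussian_real_in_complex[OF Phi_pos[of u]] by auto
  \<comment> \<open>Moments are controlled only for n \<ge> n0. Shifting the index makes the
    hypotheses hold for every n and leaves the limit unchanged.\<close>
  have "converges_in_distribution (\<lambda>n. M (n + n0)) (\<lambda>n. complex_standardize (M (n + n0)) (Z (n + n0))) ?\<mu>"
  proof (rule converges_in_distribution_complexI[OF M _ _ _ \<mu>])
    fix n
    have n: "n + n0 \<ge> n0" by simp
    show "complex_standardize (M (n + n0)) (Z (n + n0)) \<in> borel_measurable (M (n + n0))"
      "integrable (M (n + n0)) (\<lambda>\<omega>. (cmod (complex_standardize (M (n + n0)) (Z (n + n0)) \<omega>))\<^sup>2)"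
      "(\<integral>\<omega>. (cmod (complex_standardize (M (n + n0)) (Z (n + n0)) \<omega>))\<^sup>2 \<partial>M (n + n0)) \<le> 1"
      by (rule std[OF n])+
    show "(\<lambda>n. \<integral>\<omega>. iexp (\<theta> \<bullet> complex_standardize (M (n + n0)) (Z (n + n0)) \<omega>) \<partial>M (n + n0))
        \<longlonglongrightarrow> (\<integral>z. iexp (\<theta> \<bullet> z) \<partial>?\<mu>)" for \<theta>
      by (rule LIMSEQ_ignore_initial_segment[OF char])
  qed
  then show ?thesis
    unfolding Z_def by (rule converges_in_distribution_offset)
qed

end
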